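(* Let $L>0$. There is a constant $C>0$, independent of $\epsilon$ and $\Delta$, such that for each $\epsilon>0$ and $\Delta>0$ one has $E_1(v;\epsilon,\Delta)>E_1(0;\epsilon,\Delta)$ for every nonzero $v\in\mathcal{A}_1$ such that either $$\|v\|_{L^2(\Omega)}<C\,\epsilon^{7/2}\Delta^{-2}$$ or $$\mathcal{L}^2(B(v))<C\,\epsilon^{6}\Delta^{-4}L^{-1}$$ holds. The same statements hold with $E_i$ and $\mathcal{A}_i$ in place of $E_1$ and $\mathcal{A}_1$ respectively, for $i=2,3$.
   Context: Let $L>0$, $\Omega=[0,L]\times[0,1]\subset\mathbb{R}^2$ with coordinates $(x,y)$, and let $\epsilon>0$, $\Delta> 0$ be parameters. $\mathcal{L}^2$ is two-dimensional Lebesgue measure, and subscripts $x,y$ denote (weak) partial derivatives. For a function $u$ on $\Omega$ put $B(u)=\{(x,y)\in\Omega:\ |u_y(x,y)|\ge 1\}$ and $A(u)=\Omega\setminus B(u)$ and define $$E_1(u;\epsilon,\Delta)=\int_\Omega \epsilon^2u_{yy}^2+u_x^2\,d\mathcal{L}^2+\Delta\,\mathcal{L}^2(A(u)),$$ $$E_2(u;\epsilon,\Delta)=\int_\Omega \epsilon^2|\nabla(u_y)|^2+u_x^2\,d\mathcal{L}^2+\Delta\,\mathcal{L}^2(A(u)),$$ $$E_3(u;\epsilon,\Delta)=\int_\Omega \epsilon^2|D^2u|^2+u_x^2\,d\mathcal{L}^2+\Delta\,\mathcal{L}^2(A(u)),$$ where $D^2u=\nabla(\nabla u)$. Let $W^{1,2}_p(\Omega,\mathbb{R})=\{u\in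 W^{1,2}(\Omega,\mathbb{R}): u(x,1)=u(x,0),\ 0\le x\le L\}$ (in the sense of traces). The admissible classes are $\mathcal{A}_1=\{u\in W^{1,2}_p(\Omega,\mathbb{R}): u_{yy}\in L^2(\Omega),\ u(0,y)=0 \text{ for } 0\le y\le 1\}$, $\mathcal{A}_2=\{u\in W^{1,2}_p(\Omega,\mathbb{R}): u_y\in W^{1,2}(\Omega),\ u(0,y)=0 \text{ for } 0\le y\le 1\}$, $\mathcal{A}_3=\{u\in W^{1,2}_p(\Omega,\mathbb{R}): \nabla u\in W^{1,2}(\Omega),\ u(0,y)=0 \text{ for } 0\le y\le 1\}$ (boundary values in the sense of traces). *)

theory Defs
  imports "HOL-Analysis.Analysis"
begin

text \<open>Functions on a set \<open>S\<close> are represented by total functions; only their values on \<open>S\<close>,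
  and those only up to Lebesgue null sets, are ever used.\<close>

definition square_integrable :: "'a::euclidean_space set \<Rightarrow> ('a \<Rightarrow> real) \<Rightarrow> bool" where
  "square_integrable S f \<longleftrightarrow>
     set_borel_measurable lebesgue S f \<and> set_integrable lebesgue S (\<lambda>z. (f z)\<^sup>2)"

definition L2norm :: "'a::euclidean_space set \<Rightarrow> ('a \<Rightarrow> real) \<Rightarrow> real" where
  "L2norm S f = sqrt (LINT z:S|lebesgue. (f z)\<^sup>2)"

abbreviation pderiv_at :: "'a::euclidean_space \<Rightarrow> ('a \<Rightarrow> real) \<Rightarrow> 'a \<Rightarrow> real" where
  "pderiv_at b f \<equiv> (\<lambda>z. frechet_derivative f (at z) b)"

primrec C_k :: "nat \<Rightarrow> ('a::euclidean_space \<Rightarrow> real) \<Rightarrow> bool" where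
  "C_k 0 f \<longleftrightarrow> continuous_on UNIV f"
| "C_k (Suc k) f \<longleftrightarrow> (\<forall>z. f differentiable (at z)) \<and> (\<forall>b\<in>Basis. C_k k (pderiv_at b f))"

definition smooth :: "('a::euclidean_space \<Rightarrow> real) \<Rightarrow> bool" where
  "smooth f \<longleftrightarrow> (\<forall>k. C_k k f)"

definition test_function :: "'a::euclidean_space set \<Rightarrow> ('a \<Rightarrow> real) \<Rightarrow> bool" where
  "test_function S \<phi> \<longleftrightarrow> smooth \<phi> \<and> compact (closure {z. \<phi> z \<noteq> 0})
     \<and> closure {z. \<phi> z \<noteq> 0} \<subseteq> interior S"

definition locally_integrable :: "'a::euclidean_space set \<Rightarrow> ('a \<Rightarrow> real) \<Rightarrow> bool" where
  "locally_integrable S f \<longleftrightarrow>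
     (\<forall>K. compact K \<and> K \<subseteq> interior S \<longrightarrow> set_integrable lebesgue K f)"

definition has_weak_deriv ::
  "'a::euclidean_space set \<Rightarrow> 'a \<Rightarrow> ('a \<Rightarrow> real) \<Rightarrow> ('a \<Rightarrow> real) \<Rightarrow> bool" where
  "has_weak_deriv S b f g \<longleftrightarrow> locally_integrable S f \<and> locally_integrable S g \<and>
     (\<forall>\<phi>. test_function S \<phi> \<longrightarrow>
        (LINT z:S|lebesgue. f z * pderiv_at b \<phi> z) = - (LINT z:S|lebesgue. g z * \<phi> z))"

text \<open>Weak derivatives are unique only up to null sets in the interior of \<open>S\<close>;
  \<open>weak_deriv\<close> picks one representative. It is meaningful only if \<open>weakly_differentiable\<close>
  holds.\<close>

definition weakly_differentiable :: "'a::euclidean_space set \<Rightarrow> 'a \<Rightarrow> ('a \<Rightarrow> real) \<Rightarrow> bool" where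
  "weakly_differentiable S b f \<longleftrightarrow> (\<exists>g. has_weak_deriv S b f g)"

definition weak_deriv :: "'a::euclidean_space set \<Rightarrow> 'a \<Rightarrow> ('a \<Rightarrow> real) \<Rightarrow> 'a \<Rightarrow> real" where
  "weak_deriv S b f = (SOME g. has_weak_deriv S b f g)"

definition W12 :: "'a::euclidean_space set \<Rightarrow> ('a \<Rightarrow> real) set" where
  "W12 S = {u. square_integrable S u \<and>
     (\<forall>b\<in>Basis. weakly_differentiable S b u \<and> square_integrable S (weak_deriv S b u))}"

definition Omega :: "real \<Rightarrow> (real \<times> real) set" where
  "Omega L = {0..L} \<times> {0..1}"

abbreviation ex :: "real \<times> real" where "ex \<equiv> (1, 0)"
abbreviation ey :: "real \<times> real" where "ey \<equiv> (0, 1)"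

abbreviation wD :: "real \<Rightarrow> real \<times> real \<Rightarrow> (real \<times> real \<Rightarrow> real) \<Rightarrow> real \<times> real \<Rightarrow> real" where
  "wD L b u \<equiv> weak_deriv (Omega L) b u"

text \<open>The boundary of the rectangle, as arc-length parametrised edges.\<close>

definition edges :: "real \<Rightarrow> (real set \<times> (real \<Rightarrow> real \<times> real)) set" where
  "edges L = {({0..L}, \<lambda>x. (x, 0)), ({0..L}, \<lambda>x. (x, 1)), ({0..1}, \<lambda>y. (0, y)), ({0..1}, \<lambda>y. (L, y))}"

text \<open>\<open>g\<close> (restricted to the boundary) is the trace of \<open>u \<in> W12 (Omega L)\<close>: the limit in
  \<open>L\<^sup>2\<close> of the boundary of the boundary values of functions that are smooth up to the
  boundary and converge to \<open>u\<close> in \<open>W12 (Omega L)\<close>. By the trace theorem every such \<open>u\<close> has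
  exactly one trace, up to null sets of the boundary.\<close>

definition is_trace :: "real \<Rightarrow> (real \<times> real \<Rightarrow> real) \<Rightarrow> (real \<times> real \<Rightarrow> real) \<Rightarrow> bool" where
  "is_trace L u g \<longleftrightarrow> (\<forall>(I, \<gamma>)\<in>edges L. square_integrable I (\<lambda>t. g (\<gamma> t))) \<and>
     (\<exists>\<phi> :: nat \<Rightarrow> real \<times> real \<Rightarrow> real. (\<forall>n. smooth (\<phi> n)) \<and>
        (\<lambda>n. L2norm (Omega L) (\<lambda>z. \<phi> n z - u z)) \<longlonglongrightarrow> 0 \<and>
        (\<forall>b\<in>Basis. (\<lambda>n. L2norm (Omega L) (\<lambda>z. pderiv_at b (\<phi> n) z - wD L b u z)) \<longlonglongrightarrow> 0) \<and>
        (\<forall>(I, \<gamma>)\<in>edges L. (\<lambda>n. L2norm I (\<lambda>t. \<phi> n (\<gamma> t) - g (\<gamma> t))) \<longlonglongrightarrow> 0))"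

definition W12p :: "real \<Rightarrow> (real \<times> real \<Rightarrow> real) set" where
  "W12p L = {u \<in> W12 (Omega L).
     \<exists>g. is_trace L u g \<and> (AE x in lebesgue. x \<in> {0..L} \<longrightarrow> g (x, 1) = g (x, 0))}"

definition zero_left :: "real \<Rightarrow> (real \<times> real \<Rightarrow> real) \<Rightarrow> bool" where
  "zero_left L u \<longleftrightarrow> (\<exists>g. is_trace L u g \<and> (AE y in lebesgue. y \<in> {0..1} \<longrightarrow> g (0, y) = 0))"

definition A1 :: "real \<Rightarrow> (real \<times> real \<Rightarrow> real) set" where
  "A1 L = {u \<in> W12p L. weakly_differentiable (Omega L) ey (wD L ey u) \<and>
     square_integrable (Omega L) (wD L ey (wD L ey u)) \<and> zero_left L u}"

definition A2 :: "real \<Rightarrow> (real \<times> real \<Rightarrow> real) set" where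
  "A2 L = {u \<in> W12p L. wD L ey u \<in> W12 (Omega L) \<and> zero_left L u}"

definition A3 :: "real \<Rightarrow> (real \<times> real \<Rightarrow> real) set" where
  "A3 L = {u \<in> W12p L. (\<forall>b\<in>Basis. wD L b u \<in> W12 (Omega L)) \<and> zero_left L u}"

definition setB :: "real \<Rightarrow> (real \<times> real \<Rightarrow> real) \<Rightarrow> (real \<times> real) set" where
  "setB L u = {z \<in> Omega L. \<bar>wD L ey u z\<bar> \<ge> 1}"

definition setA :: "real \<Rightarrow> (real \<times> real \<Rightarrow> real) \<Rightarrow> (real \<times> real) set" where
  "setA L u = Omega L - setB L u"

definition E1 :: "real \<Rightarrow> (real \<times> real \<Rightarrow> real) \<Rightarrow> real \<Rightarrow> real \<Rightarrow> real" where
  "E1 L u \<epsilon> \<Delta> =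
     (LINT z:Omega L|lebesgue. \<epsilon>\<^sup>2 * (wD L ey (wD L ey u) z)\<^sup>2 + (wD L ex u z)\<^sup>2)
     + \<Delta> * measure lebesgue (setA L u)"

definition E2 :: "real \<Rightarrow> (real \<times> real \<Rightarrow> real) \<Rightarrow> real \<Rightarrow> real \<Rightarrow> real" where
  "E2 L u \<epsilon> \<Delta> =
     (LINT z:Omega L|lebesgue.
        \<epsilon>\<^sup>2 * (\<Sum>b\<in>Basis. (wD L b (wD L ey u) z)\<^sup>2) + (wD L ex u z)\<^sup>2)
     + \<Delta> * measure lebesgue (setA L u)"

definition E3 :: "real \<Rightarrow> (real \<times> real \<Rightarrow> real) \<Rightarrow> real \<Rightarrow> real \<Rightarrow> real" where
  "E3 L u \<epsilon> \<Delta> =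
     (LINT z:Omega L|lebesgue.
        \<epsilon>\<^sup>2 * (\<Sum>b\<in>Basis. \<Sum>c\<in>Basis. (wD L b (wD L c u) z)\<^sup>2) + (wD L ex u z)\<^sup>2)
     + \<Delta> * measure lebesgue (setA L u)"

definition nonzero_on :: "'a::euclidean_space set \<Rightarrow> ('a \<Rightarrow> real) \<Rightarrow> bool" where
  "nonzero_on S v \<longleftrightarrow> \<not> (AE z in lebesgue. z \<in> S \<longrightarrow> v z = 0)"

end

theory Submission
  imports Defs
begin

text \<open>
  Let \<open>v\<close> be admissible with energy at most that of \<open>0\<close>, which is \<open>\<Delta> * L\<close>. Write
  \<open>w = v\<^sub>y\<close>, \<open>q = v\<^sub>y\<^sub>y\<close>, \<open>p = v\<^sub>x\<close>, let \<open>b\<close> be the measure of \<open>B = {\<bar>w\<bar> \<ge> 1}\<close> and put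
  \<open>l = \<Delta> / \<epsilon>\<^sup>2\<close>. Since \<open>B\<close> pays no penalty, the energy comparison says
  \<open>\<epsilon>\<^sup>2 \<integral>q\<^sup>2 + \<integral>p\<^sup>2 \<le> \<Delta> * b\<close>. The task is to turn this into lower bounds for \<open>b\<close> and for \<open>\<integral>v\<^sup>2\<close>.

  On almost every vertical line \<open>{x} \<times> [0,1]\<close> put \<open>\<beta> x = \<bar>B \<inter> line\<bar>\<close>, \<open>K x = \<integral>q\<^sup>2\<close>, \<open>m x = \<integral>v\<^sup>2\<close>.
  Periodicity of \<open>v\<close> gives \<open>w\<close> mean zero on the line, so \<open>\<bar>w\<bar> \<le> sqrt (K x)\<close> there; hence
  \<open>K x \<ge> 1\<close> as soon as \<open>\<beta> x > 0\<close>. Moreover \<open>w\<close> is Hoelder continuous of order \<open>1/2\<close>, so within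
  distance \<open>1 / (4 K x)\<close> of a point of \<open>B\<close> it keeps its sign and is at least \<open>1/2\<close> in modulus. Over
  that distance \<open>v\<close> changes by an amount proportional to it, and integrating the square of the change
  gives \<open>\<beta> x \<le> 384 * m x * (K x)\<^sup>2\<close> (lemma \<open>slice_bounds\<close>).

  Let \<open>M\<close> bound \<open>m\<close>. Integrating in \<open>x\<close> with \<open>\<integral>K \<le> l * b\<close> yields \<open>l \<ge> 1\<close>, \<open>1 \<le> 384 M l\<^sup>2\<close> and
  \<open>b \<le> 384 l\<^sup>2 \<integral>v\<^sup>2\<close> (lemma \<open>integrate_slices\<close>). The condition \<open>v = 0\<close> on the left edge allows the choice
  \<open>M = 8 L \<Delta> b\<close>, which gives the bound on \<open>b\<close>; averaging over a strip of width
  \<open>h = sqrt (\<integral>v\<^sup>2) / sqrt (\<Delta> * b)\<close> allows the choice \<open>M = 16 sqrt (\<integral>v\<^sup>2) sqrt (\<Delta> * b)\<close>, which together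
  with the upper bound for \<open>b\<close> gives the bound on \<open>\<integral>v\<^sup>2\<close> (lemmas \<open>trace_slice_bounds\<close> and
  \<open>scaling_bounds\<close>).

  Two facts connect this argument with the definitions. A function with a weak \<open>y\<close>-derivative
  is, on almost every vertical line, the indefinite integral of that derivative
  (lemma \<open>weak_deriv_ey_slices\<close>), which is seen by testing against products of explicit smooth bumps.
  Boundary values are exploited on the smooth functions that define the trace, and the resulting
  inequalities are stable under \<open>L\<^sup>2\<close> limits. The other two energies dominate the first one and
  agree with it at \<open>0\<close>.
\<close>

section \<open>Smooth functions\<close>

lemma C_k_continuous: "C_k k f \<Longrightarrow> continuous_on UNIV f"
  by (cases k) (auto intro!: continuous_at_imp_continuous_on differentiable_imp_continuous_within)

lemma C_k_Suc_imp: "C_k (Suc k) f \<Longrightarrow> C_k k f"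
proof (induction k arbitrary: f)
  case 0 then show ?case using C_k_continuous[of "Suc 0"] by simp
next
  case (Suc k) then show ?case by simp
qed

lemma C_k_const: "C_k k (\<lambda>_. c)"
  by (induction k arbitrary: c) auto

lemma C_k_add: "C_k k f \<Longrightarrow> C_k k g \<Longrightarrow> C_k k (\<lambda>z. f z + g z)"
proof (induction k arbitrary: f g)
  case 0 then show ?case by (auto intro: continuous_intros)
next
  case (Suc k)
  have "pderiv_at b (\<lambda>z. f z + g z) = (\<lambda>z. pderiv_at b f z + pderiv_at b g z)" for b
  proof
    fix z
    have "((\<lambda>z. f z + g z) has_derivative (\<lambda>h. frechet_derivative f (at z) h + frechet_derivative g (at z) h)) (at z)"
      using Suc.prems by (intro has_derivative_add) (auto simp: frechet_derivative_works[symmetric])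
    from frechet_derivative_at[OF this]
    show "pderiv_at b (\<lambda>z. f z + g z) z = pderiv_at b f z + pderiv_at b g z" by metis
  qed
  then show ?case using Suc by (auto intro: differentiable_add)
qed

lemma C_k_mult: "C_k k f \<Longrightarrow> C_k k g \<Longrightarrow> C_k k (\<lambda>z. f z * g z)"
proof (induction k arbitrary: f g)
  case 0 then show ?case by (auto intro: continuous_intros)
next
  case (Suc k)
  have "pderiv_at b (\<lambda>z. f z * g z) = (\<lambda>z. f z * pderiv_at b g z + pderiv_at b f z * g z)" for b
  proof
    fix z
    have "((\<lambda>z. f z * g z) has_derivative (\<lambda>h. f z * frechet_derivative g (at z) h + frechet_derivative f (at z) h * g z)) (at z)"
      using Suc.prems by (intro has_derivative_mult) (auto simp: frechet_derivative_works[symmetric])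
    from frechet_derivative_at[OF this]
    show "pderiv_at b (\<lambda>z. f z * g z) z = f z * pderiv_at b g z + pderiv_at b f z * g z" by metis
  qed
  moreover have "C_k k f" "C_k k g" using Suc.prems C_k_Suc_imp by blast+
  ultimately show ?case using Suc by (auto intro: differentiable_mult C_k_add)
qed

lemma C_k_cmult: "C_k k f \<Longrightarrow> C_k k (\<lambda>z. c * f z)"
  using C_k_mult[OF C_k_const] .

lemma C_k_sum: "finite I \<Longrightarrow> (\<And>i. i \<in> I \<Longrightarrow> C_k k (f i)) \<Longrightarrow> C_k k (\<lambda>z. \<Sum>i\<in>I. f i z)"
  by (induction rule: finite_induct) (auto intro: C_k_add C_k_const)

text \<open>Used both to rescale functions of one variable and to regard a function of one
  coordinate as a function on the plane.\<close>

lemma C_k_compose_affine: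
  fixes A :: "'a::euclidean_space \<Rightarrow> 'b::euclidean_space"
  assumes "linear A"
  shows "C_k k f \<Longrightarrow> C_k k (\<lambda>z. f (A z + c))"
proof (induction k arbitrary: f)
  case 0
  have "continuous_on UNIV (\<lambda>z. A z + c)"
    using assms by (intro continuous_intros linear_continuous_on) (simp add: linear_conv_bounded_linear)
  then show ?case using 0 by (auto intro: continuous_on_compose2[of UNIV f UNIV])
next
  case (Suc k)
  have der: "((\<lambda>z. f (A z + c)) has_derivative (\<lambda>h. frechet_derivative f (at (A z + c)) (A h))) (at z)" for z
  proof -
    have 1: "((\<lambda>z. A z + c) has_derivative A) (at z)"
      using assms by (auto intro!: derivative_eq_intros bounded_linear_imp_has_derivative simp: linear_conv_bounded_linear)
    have 2: "(f has_derivative frechet_derivative f (at (A z + c))) (at (A z + c))"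
      using Suc.prems by (auto simp: frechet_derivative_works[symmetric])
    show ?thesis using has_derivative_compose[OF 1 2] by simp
  qed
  have "pderiv_at b (\<lambda>z. f (A z + c)) = (\<lambda>z. \<Sum>i\<in>Basis. (A b \<bullet> i) * pderiv_at i f (A z + c))" for b
  proof
    fix z
    have lin: "linear (frechet_derivative f (at (A z + c)))"
      using Suc.prems by (intro linear_frechet_derivative) auto
    have "pderiv_at b (\<lambda>z. f (A z + c)) z = frechet_derivative f (at (A z + c)) (A b)"
      using frechet_derivative_at[OF der] by metis
    also have "\<dots> = frechet_derivative f (at (A z + c)) (\<Sum>i\<in>Basis. (A b \<bullet> i) *\<^sub>R i)"
      by (simp add: euclidean_representation)
    also have "\<dots> = (\<Sum>i\<in>Basis. (A b \<bullet> i) * pderiv_at i f (A z + c))"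
      using lin by (simp add: linear_sum linear_scale)
    finally show "pderiv_at b (\<lambda>z. f (A z + c)) z = (\<Sum>i\<in>Basis. (A b \<bullet> i) * pderiv_at i f (A z + c))" .
  qed
  moreover have "C_k k (\<lambda>z. \<Sum>i\<in>Basis. (A b \<bullet> i) * pderiv_at i f (A z + c))" for b
    using Suc by (intro C_k_sum C_k_cmult) auto
  ultimately show ?case using der by (auto simp: differentiable_def)
qed

lemma pderiv_at_real:
  fixes f :: "real \<Rightarrow> real"
  assumes "(f has_real_derivative d) (at x)"
  shows "pderiv_at 1 f x = d"
  using frechet_derivative_at[of f "(*) d" x] assms by (simp add: has_field_derivative_def) (metis mult.right_neutral)

lemma C_k_Suc_real:
  fixes f :: "real \<Rightarrow> real"
  assumes "\<And>x. (f has_real_derivative f' x) (at x)"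
  shows "C_k (Suc k) f \<longleftrightarrow> C_k k f'"
proof -
  have "pderiv_at 1 f = f'" using pderiv_at_real[OF assms] by auto
  moreover have "f differentiable (at x)" for x
    using assms[of x] by (meson real_differentiable_def)
  ultimately show ?thesis by simp
qed

section \<open>Smooth bumps\<close>

text \<open>The family \<open>P(1/x) exp(-1/x)\<close>, extended by \<open>0\<close> to \<open>x \<le> 0\<close>, is closed under
  differentiation. Allowing all polynomials \<open>P\<close> makes smoothness of \<open>exp(-1/x)\<close> a one-line induction.\<close>

definition exp_recip :: "real poly \<Rightarrow> real \<Rightarrow> real" where
  "exp_recip P x = (if x \<le> 0 then 0 else poly P (1 / x) * exp (- (1 / x)))"

lemma poly_times_exp_tendsto_0: "((\<lambda>t::real. poly P t * exp (- t)) \<longlongrightarrow> 0) at_top"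
proof -
  have "((\<lambda>t::real. \<Sum>i\<le>degree P. coeff P i * (t ^ i * exp (- t))) \<longlongrightarrow> (\<Sum>i\<le>degree P. coeff P i * 0)) at_top"
  proof (intro tendsto_sum tendsto_mult tendsto_const)
    fix i show "((\<lambda>t::real. t ^ i * exp (- t)) \<longlongrightarrow> 0) at_top"
      using tendsto_power_div_exp_0[of i] by (simp add: exp_minus divide_inverse)
  qed
  then show ?thesis by (simp add: poly_altdef sum_distrib_right mult.assoc)
qed

lemma exp_recip_tendsto_0: "(exp_recip P \<longlongrightarrow> 0) (at 0)"
proof -
  have "((\<lambda>x::real. poly P (inverse x) * exp (- inverse x)) \<longlongrightarrow> 0) (at_right 0)"
    using filterlim_compose[OF poly_times_exp_tendsto_0 filterlim_inverse_at_top_right] .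
  then have r: "(exp_recip P \<longlongrightarrow> 0) (at_right 0)"
    by (rule Lim_transform_eventually)
       (auto simp: exp_recip_def eventually_at_filter inverse_eq_divide)
  have l: "(exp_recip P \<longlongrightarrow> 0) (at_left 0)"
    by (rule tendsto_eventually) (auto simp: exp_recip_def eventually_at_filter)
  show ?thesis using l r by (simp add: filterlim_split_at)
qed

text \<open>With \<open>t = 1/x\<close> one has \<open>d/dx = - t\<^sup>2 d/dt\<close>, which sends \<open>P(t) exp(-t)\<close> to
  \<open>t\<^sup>2 (P - P')(t) exp(-t)\<close>; at \<open>0\<close> the difference quotient is the member for \<open>t P(t)\<close>.\<close>

lemma exp_recip_deriv:
  "(exp_recip P has_real_derivative exp_recip ([:0, 0, 1:] * (P - pderiv P)) x) (at x)"
proof -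
  consider "x < 0" | "x = 0" | "x > 0" by linarith
  then show ?thesis
  proof cases
    case 1
    have "((\<lambda>_. 0) has_real_derivative 0) (at x)" by simp
    moreover have "eventually (\<lambda>y. y < 0) (nhds x)"
      using 1 by (intro eventually_nhds_in_open[of "{..<0}", simplified]) auto
    ultimately have "(exp_recip P has_real_derivative 0) (at x)"
      by (subst DERIV_cong_ev[OF refl _ refl, of _ "\<lambda>_. 0"])
         (auto simp: exp_recip_def elim: eventually_mono)
    then show ?thesis using 1 by (simp add: exp_recip_def)
  next
    case 2
    have "(exp_recip ([:0,1:] * P) \<longlongrightarrow> 0) (at 0)" by (rule exp_recip_tendsto_0)
    then have "((\<lambda>h. (exp_recip P (0 + h) - exp_recip P 0) / h) \<longlongrightarrow> 0) (at 0)"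
      by (rule Lim_transform_eventually)
         (auto simp: exp_recip_def eventually_at_filter)
    then show ?thesis using 2 by (simp add: DERIV_def exp_recip_def)
  next
    case 3
    have "((\<lambda>x. poly P (1 / x) * exp (- (1 / x))) has_real_derivative
        exp_recip ([:0, 0, 1:] * (P - pderiv P)) x) (at x)"
      using 3 by (auto intro!: derivative_eq_intros DERIV_chain'[OF _ poly_DERIV]
        simp: exp_recip_def field_simps power2_eq_square)
    moreover have "eventually (\<lambda>y. y > 0) (nhds x)"
      using 3 by (intro eventually_nhds_in_open[of "{0<..}", simplified]) auto
    ultimately show ?thesis
      by (subst DERIV_cong_ev[OF refl _ refl, of _ "\<lambda>x. poly P (1 / x) * exp (- (1 / x))"])
         (auto simp: exp_recip_def elim: eventually_mono)
  qed
qed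

lemma C_k_exp_recip: "C_k k (exp_recip P)"
proof (induction k arbitrary: P)
  case 0
  have "isCont (exp_recip P) x" for x using exp_recip_deriv DERIV_isCont by blast
  then show ?case by (simp add: continuous_at_imp_continuous_on)
next
  case (Suc k) then show ?case using C_k_Suc_real[OF exp_recip_deriv] by simp
qed

text \<open>Smooth, supported in \<open>{a..b}\<close>, with values in \<open>[0, 1]\<close>. The factor \<open>n\<close> sharpens the profile, so
  that the functions tend to the indicator of the open interval as \<open>n \<rightarrow> \<infinity>\<close>.\<close>

definition bump :: "nat \<Rightarrow> real \<Rightarrow> real \<Rightarrow> real \<Rightarrow> real" where
  "bump n a b x = exp_recip 1 (real n * (x - a)) * exp_recip 1 (real n * (b - x))"

lemma C_k_bump: "C_k k (bump n a b)"
proof -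
  have 1: "C_k k (\<lambda>x. exp_recip 1 (real n * x + (- real n * a)))"
    by (rule C_k_compose_affine[OF _ C_k_exp_recip]) (simp add: linear_iff algebra_simps)
  have 2: "C_k k (\<lambda>x. exp_recip 1 ((- real n) * x + (real n * b)))"
    by (rule C_k_compose_affine[OF _ C_k_exp_recip]) (simp add: linear_iff algebra_simps)
  have "bump n a b = (\<lambda>x. exp_recip 1 (real n * x + (- real n * a)) * exp_recip 1 ((- real n) * x + (real n * b)))"
    by (simp add: bump_def fun_eq_iff algebra_simps)
  then show ?thesis using C_k_mult[OF 1 2] by simp
qed

lemma exp_recip_1_bounds: "0 \<le> exp_recip 1 x" "exp_recip 1 x \<le> 1"
  by (auto simp: exp_recip_def)

lemma bump_bounds: "0 \<le> bump n a b x" "bump n a b x \<le> 1"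
  unfolding bump_def by (auto intro!: mult_le_one mult_nonneg_nonneg exp_recip_1_bounds)

lemma bump_eq_0: "x \<le> a \<or> b \<le> x \<Longrightarrow> bump n a b x = 0"
  by (auto simp: bump_def exp_recip_def mult_nonneg_nonpos)

lemma bump_pos: "n > 0 \<Longrightarrow> a < x \<Longrightarrow> x < b \<Longrightarrow> bump n a b x > 0"
  by (auto simp: bump_def exp_recip_def mult_le_0_iff not_le)

lemma exp_recip_1_tendsto_1:
  assumes "(f \<longlongrightarrow> c) sequentially" "c > 0"
  shows "(\<lambda>n. exp_recip 1 (real n * f n)) \<longlonglongrightarrow> 1"
proof -
  have lim: "filterlim (\<lambda>n. real n * f n) at_top sequentially"
    using filterlim_tendsto_pos_mult_at_top[OF assms filterlim_real_sequentially]
    by (simp add: mult.commute)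
  have "((\<lambda>x. exp_recip 1 x) \<longlongrightarrow> 1) at_top"
  proof (rule Lim_transform_eventually)
    show "((\<lambda>x::real. exp (- (1 / x))) \<longlongrightarrow> 1) at_top" using tendsto_exp[OF tendsto_minus[OF tendsto_inverse_0_at_top[OF filterlim_ident]]] by (simp add: inverse_eq_divide)
    show "eventually (\<lambda>x. exp (- (1 / x)) = exp_recip 1 x) at_top"
      using eventually_gt_at_top[of 0] by eventually_elim (simp add: exp_recip_def)
  qed
  from filterlim_compose[OF this lim] show ?thesis .
qed

text \<open>The end points may move with \<open>n\<close>, so that rational end points suffice to reach
  an arbitrary interval.\<close>

lemma bump_tendsto_indicator:
  assumes "(\<lambda>n. a n) \<longlonglongrightarrow> c" "(\<lambda>n. b n) \<longlonglongrightarrow> d" "\<And>n. c \<le> a n" "\<And>n. b n \<le> d"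
  shows "(\<lambda>n. bump n (a n) (b n) x) \<longlonglongrightarrow> indicator {c<..<d} x"
proof (cases "c < x \<and> x < d")
  case True
  have "(\<lambda>n. exp_recip 1 (real n * (x - a n)) * exp_recip 1 (real n * (b n - x))) \<longlonglongrightarrow> 1 * 1"
    using True assms by (intro tendsto_mult exp_recip_1_tendsto_1[of _ "x - c"] exp_recip_1_tendsto_1[of _ "d - x"] tendsto_intros) auto
  then show ?thesis using True by (simp add: bump_def)
next
  case False
  then have "bump n (a n) (b n) x = 0" for n
    using assms(3,4)[of n] by (intro bump_eq_0) linarith
  then show ?thesis using False by simp
qed

section \<open>Functions orthogonal to all bumps\<close>

lemma bump_measurable [measurable]: "bump n a b \<in> borel_measurable borel"
  using C_k_continuous[OF C_k_bump] by (rule borel_measurable_continuous_onI)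

text \<open>The positive and the negative part of \<open>F\<close> are densities of two finite measures that
  agree on all half-lines, hence are equal.\<close>

lemma AE_zero_if_tails_zero:
  fixes F :: "real \<Rightarrow> real"
  assumes F[measurable]: "integrable lborel F"
    and tail: "\<And>x. (\<integral>t. F t * indicator {x<..} t \<partial>lborel) = 0"
  shows "AE t in lborel. F t = 0"
proof -
  let ?M = "density lborel (\<lambda>t. ennreal (F t))" and ?N = "density lborel (\<lambda>t. ennreal (- F t))"
  have pos: "emeasure ?M {x<..} = ennreal (\<integral>t. max 0 (F t) * indicator {x<..} t \<partial>lborel)"
    and neg: "emeasure ?N {x<..} = ennreal (\<integral>t. max 0 (- F t) * indicator {x<..} t \<partial>lborel)" for x
  proof -
    have "integrable lborel (\<lambda>t. max 0 (F t) * indicator {x<..} t)"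
      "integrable lborel (\<lambda>t. max 0 (- F t) * indicator {x<..} t)"
      using F by (auto intro!: integrable_real_mult_indicator integrable_max)
    then show "emeasure ?M {x<..} = ennreal (\<integral>t. max 0 (F t) * indicator {x<..} t \<partial>lborel)"
      "emeasure ?N {x<..} = ennreal (\<integral>t. max 0 (- F t) * indicator {x<..} t \<partial>lborel)"
      by (auto simp: emeasure_density nn_integral_eq_integral[symmetric] ennreal_mult' max_def
          ennreal_neg intro!: nn_integral_cong split: split_indicator)
  qed
  have "(\<integral>t. max 0 (F t) * indicator {x<..} t \<partial>lborel) = (\<integral>t. max 0 (- F t) * indicator {x<..} t \<partial>lborel)" for x
  proof -
    have i: "integrable lborel (\<lambda>t. max 0 (F t) * indicator {x<..} t)"
      "integrable lborel (\<lambda>t. max 0 (- F t) * indicator {x<..} t)"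
      using F by (auto intro!: integrable_real_mult_indicator integrable_max)
    have "(\<integral>t. max 0 (F t) * indicator {x<..} t \<partial>lborel) - (\<integral>t. max 0 (- F t) * indicator {x<..} t \<partial>lborel)
       = (\<integral>t. max 0 (F t) * indicator {x<..} t - max 0 (- F t) * indicator {x<..} t \<partial>lborel)"
      using i by simp
    also have "\<dots> = (\<integral>t. F t * indicator {x<..} t \<partial>lborel)"
      by (intro Bochner_Integration.integral_cong) (auto simp: max_def split: split_indicator)
    finally show ?thesis using tail by simp
  qed
  then have eq: "emeasure ?M {x<..} = emeasure ?N {x<..}" for x using pos neg by simp
  have fin: "emeasure ?M {x<..} < \<infinity>" for x by (simp add: pos)
  have "?M = ?N"
    by (rule measure_eqI_lessThan[OF _ _ fin eq]) auto
  moreover have "(\<integral>\<^sup>+t. ennreal (F t) \<partial>lborel) \<noteq> \<infinity>"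
    using F by (simp add: real_integrable_def)
  ultimately have "AE t in lborel. ennreal (F t) = ennreal (- F t)"
    using finite_density_unique[of "\<lambda>t. ennreal (F t)" lborel "\<lambda>t. ennreal (- F t)"] by simp
  then show ?thesis
  proof eventually_elim
    case (elim t) then show ?case
      by (cases "F t \<ge> 0") (auto simp: ennreal_neg ennreal_eq_0_iff)
  qed
qed

text \<open>Only countably many bumps are tested, so that the hypothesis can be verified
  on almost every line simultaneously.\<close>

lemma AE_zero_if_orthogonal_to_bumps:
  fixes F :: "real \<Rightarrow> real"
  assumes F[measurable]: "integrable lborel F" and pq: "p < q" and supp: "\<And>x. x \<notin> {p..q} \<Longrightarrow> F x = 0"
    and orth: "\<And>n a b. a \<in> \<rat> \<Longrightarrow> b \<in> \<rat> \<Longrightarrow> p < a \<Longrightarrow> a < b \<Longrightarrow> b < q \<Longrightarrow> (\<integral>x. F x * bump n a b x \<partial>lborel) = 0"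
  shows "AE x in lborel. F x = 0"
proof (rule AE_zero_if_tails_zero[OF F])
  fix x
  let ?c = "max x p"
  show "(\<integral>t. F t * indicator {x<..} t \<partial>lborel) = 0"
  proof (cases "?c < q")
    case False
    then have "F t * indicator {x<..} t = 0" for t
      using supp[of t] pq by (auto split: split_indicator)
    then show ?thesis by (intro integral_eq_zero_AE AE_I2)
  next
    case True
    \<comment> \<open>The half-line meets the support in an interval up to null sets; rational end points that shrink to it from inside are found within distance \<open>e n\<close>.\<close>
    define e where "e n = (q - ?c) / (real n + 3)" for n
    have e: "e n > 0" "2 * e n < q - ?c" for n
    proof -
      show pos: "e n > 0" unfolding e_def using True by (intro divide_pos_pos) auto
      have "q - ?c = e n * (real n + 3)" unfolding e_def by simp
      also have "\<dots> = e n * real n + 3 * e n" by (simp only: distrib_left mult.commute)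
      also have "\<dots> > 2 * e n" using mult_nonneg_nonneg[of "e n" "real n"] pos by linarith
      finally show "2 * e n < q - ?c" .
    qed
    have e0: "e \<longlonglongrightarrow> 0"
      using LIMSEQ_ignore_initial_segment[OF lim_const_over_n[of "q - ?c"], of 3]
      unfolding e_def by (simp only: of_nat_add of_nat_numeral)
    obtain a where a: "\<And>n. a n \<in> \<rat>" "\<And>n. ?c < a n" "\<And>n. a n < ?c + e n"
      using Rats_dense_in_real[of ?c "?c + e _"] e(1) by (metis less_add_same_cancel1)
    obtain b where b: "\<And>n. b n \<in> \<rat>" "\<And>n. q - e n < b n" "\<And>n. b n < q"
      using Rats_dense_in_real[of "q - e _" q] e(1) by (metis diff_less_eq less_add_same_cancel1)
    have "a \<longlonglongrightarrow> ?c"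
      by (rule tendsto_sandwich[of "\<lambda>_. ?c" _ _ "\<lambda>n. ?c + e n"])
         (use a in \<open>auto intro!: always_eventually less_imp_le tendsto_eq_intros e0\<close>)
    moreover have "b \<longlonglongrightarrow> q"
      by (rule tendsto_sandwich[of "\<lambda>n. q - e n" _ _ "\<lambda>n. q"])
         (use b in \<open>auto intro!: always_eventually less_imp_le tendsto_eq_intros e0\<close>)
    ultimately have lim: "(\<lambda>n. bump n (a n) (b n) t) \<longlonglongrightarrow> indicator {?c<..<q} t" for t
      using a b by (intro bump_tendsto_indicator) (auto simp: less_imp_le)
    have "(\<lambda>n. \<integral>t. F t * bump n (a n) (b n) t \<partial>lborel) \<longlonglongrightarrow> (\<integral>t. F t * indicator {?c<..<q} t \<partial>lborel)"
    proof (rule integral_dominated_convergence[where w="\<lambda>t. \<bar>F t\<bar>"])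
      show "AE t in lborel. (\<lambda>n. F t * bump n (a n) (b n) t) \<longlonglongrightarrow> F t * indicator {?c<..<q} t"
        by (intro AE_I2 tendsto_mult tendsto_const lim)
      show "AE t in lborel. norm (F t * bump n (a n) (b n) t) \<le> \<bar>F t\<bar>" for n
        using bump_bounds by (auto simp: abs_mult intro!: mult_left_le)
    qed (use F in auto)
    moreover have "(\<integral>t. F t * bump n (a n) (b n) t \<partial>lborel) = 0" for n
      using a[of n] b[of n] e(2)[of n] by (intro orth) (auto simp: )
    ultimately have "(\<integral>t. F t * indicator {?c<..<q} t \<partial>lborel) = 0"
      using LIMSEQ_unique[OF _ tendsto_const] by auto
    moreover have "(\<integral>t. F t * indicator {?c<..<q} t \<partial>lborel) = (\<integral>t. F t * indicator {x<..} t \<partial>lborel)"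
    proof (rule integral_cong_AE)
      show "AE t in lborel. F t * indicator {?c<..<q} t = F t * indicator {x<..} t"
        using AE_lborel_singleton[of p] AE_lborel_singleton[of q]
        by eventually_elim (use supp in \<open>force split: split_indicator\<close>)
    qed auto
    ultimately show ?thesis by simp
  qed
qed

lemma integrable_bump: "integrable lborel (bump n a b)"
proof -
  have "integrable lborel (\<lambda>x. indicator {a..b} x *\<^sub>R bump n a b x)"
    by (intro borel_integrable_compact continuous_on_subset[OF C_k_continuous[OF C_k_bump]]) auto
  also have "(\<lambda>x. indicator {a..b} x *\<^sub>R bump n a b x) = bump n a b"
    using bump_eq_0[of _ a b n] by (auto simp: fun_eq_iff split: split_indicator)
  finally show ?thesis .
qed

section \<open>Weak derivatives in one dimension\<close>

abbreviation ref_bump :: "real \<Rightarrow> real" where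
  "ref_bump \<equiv> bump 1 (1/4) (3/4)"

definition bump_mass :: "nat \<Rightarrow> real \<Rightarrow> real \<Rightarrow> real" where
  "bump_mass n a b = (\<integral>x. bump n a b x \<partial>lborel)"

lemma ref_bump_mass_nonzero: "bump_mass 1 (1/4) (3/4) \<noteq> 0"
proof
  assume "bump_mass 1 (1/4) (3/4) = 0"
  then have "AE x in lborel. ref_bump x = 0"
    unfolding bump_mass_def
    by (subst (asm) integral_nonneg_eq_0_iff_AE) (auto simp: integrable_bump bump_bounds)
  then have "AE x in lborel. x \<notin> {1/4<..<3/4::real}"
    by eventually_elim (use bump_pos[of 1 "1/4" _ "3/4"] in force)
  then have "emeasure lborel {1/4<..<3/4::real} = 0"
    by (subst (asm) AE_iff_measurable[of "{1/4<..<3/4::real}"]) auto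
  then show False by simp
qed

text \<open>The combination of a bump and the reference bump whose integral is \<open>0\<close>. It therefore has a
  primitive of compact support, which is a legitimate test function.\<close>

definition balanced_bump :: "nat \<Rightarrow> real \<Rightarrow> real \<Rightarrow> real \<Rightarrow> real" where
  "balanced_bump n a b x = bump_mass 1 (1/4) (3/4) * bump n a b x - bump_mass n a b * ref_bump x"

lemma C_k_balanced_bump: "C_k k (balanced_bump n a b)"
proof -
  have "C_k k (\<lambda>x. bump_mass 1 (1/4) (3/4) * bump n a b x + (- bump_mass n a b) * ref_bump x)"
    by (intro C_k_add C_k_cmult C_k_bump)
  moreover have "(\<lambda>x. bump_mass 1 (1/4) (3/4) * bump n a b x + (- bump_mass n a b) * ref_bump x) = balanced_bump n a b"
    by (simp add: balanced_bump_def fun_eq_iff)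
  ultimately show ?thesis by simp
qed

lemma integral_balanced_bump: "(\<integral>x. balanced_bump n a b x \<partial>lborel) = 0"
  unfolding balanced_bump_def using integrable_bump by (simp add: bump_mass_def)

lemma balanced_bump_primitive:
  assumes "c \<le> min a (1/4)" "max b (3/4) \<le> d"
  obtains \<beta> where "\<And>x. (\<beta> has_real_derivative balanced_bump n a b x) (at x)"
    "\<And>x. x \<notin> {c..d} \<Longrightarrow> \<beta> x = 0"
proof -
  let ?g = "balanced_bump n a b"
  have cont: "continuous_on UNIV ?g" using C_k_continuous[OF C_k_balanced_bump] .
  then have "\<And>x. isCont ?g x" by (simp add: continuous_on_eq_continuous_at)
  then obtain G0 where G0: "\<And>x. (G0 has_vector_derivative ?g x) (at x)"
    using einterval_antiderivative[of "-\<infinity>" "\<infinity>" ?g] by auto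
  define G where "G x = G0 x - G0 c" for x
  have G: "(G has_real_derivative ?g x) (at x)" for x
    unfolding G_def using G0[of x] by (auto intro!: derivative_eq_intros simp: has_real_derivative_iff_has_vector_derivative)
  have g0: "?g x = 0" if "x \<notin> {c<..<d}" for x
    using that assms bump_eq_0[of x a b n] bump_eq_0[of x "1/4" "3/4" 1] by (auto simp: balanced_bump_def)
  have cd: "c \<le> d" using assms by linarith
  have left: "G x = G c" if "x < c" for x
  proof -
    have "\<And>y. x \<le> y \<Longrightarrow> y \<le> c \<Longrightarrow> DERIV G y :> 0" using G g0 by (metis greaterThanLessThan_iff not_le)
    then show ?thesis using DERIV_isconst_end[of x c G] that G DERIV_isCont
      by (metis continuous_at_imp_continuous_on less_imp_le)
  qed
  have right: "G x = G d" if "d < x" for x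
  proof -
    have "\<And>y. d \<le> y \<Longrightarrow> y \<le> x \<Longrightarrow> DERIV G y :> 0" using G g0 by (metis greaterThanLessThan_iff not_le)
    then show ?thesis using DERIV_isconst_end[of d x G] that G DERIV_isCont
      by (metis continuous_at_imp_continuous_on less_imp_le)
  qed
  have "(\<integral>x. indicator {c..d} x *\<^sub>R ?g x \<partial>lborel) = G d - G c"
    using G cd by (intro integral_FTC_atLeastAtMost continuous_on_subset[OF cont])
      (auto simp: has_real_derivative_iff_has_vector_derivative intro: has_vector_derivative_at_within)
  moreover have "(\<lambda>x. indicator {c..d} x *\<^sub>R ?g x) = ?g"
    using g0 by (auto simp: fun_eq_iff split: split_indicator)
  ultimately have "G d = G c" using integral_balanced_bump by simp
  moreover have "G c = 0" by (simp add: G_def)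
  ultimately have "G x = 0" if "x \<notin> {c..d}" for x
    using left[of x] right[of x] that by force
  then show thesis using that G by blast
qed

lemma measurable_indefinite_integrand:
  fixes g :: "real \<Rightarrow> real"
  assumes [measurable]: "g \<in> borel_measurable borel"
  shows "(\<lambda>(y, t). g t * indicat_real {0..y} t) \<in> borel_measurable (borel \<Otimes>\<^sub>M borel)"
proof -
  have "(\<lambda>(y, t). g t * indicat_real {0..y} t) = (\<lambda>z. g (snd z) * (if 0 \<le> snd z \<and> snd z \<le> fst z then 1 else 0))"
    by (rule ext) (simp add: split_beta indicator_def)
  also have "\<dots> \<in> borel_measurable (borel \<Otimes>\<^sub>M borel)" by measurable
  finally show ?thesis .
qed

text \<open>Fubini on the triangle \<open>0 \<le> t \<le> y \<le> 1\<close>, because \<open>g\<close> is merely integrable and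
  its indefinite integral need not be differentiable everywhere.\<close>

lemma integral_by_parts_indefinite:
  fixes g \<beta> \<beta>' :: "real \<Rightarrow> real"
  assumes g: "integrable lborel g" and supp: "\<And>y. y \<notin> {0..1} \<Longrightarrow> g y = 0"
    and \<beta>: "\<And>y. (\<beta> has_real_derivative \<beta>' y) (at y)" and cont: "continuous_on UNIV \<beta>'" and \<beta>1: "\<beta> 1 = 0"
    and \<beta>'0: "\<And>y. y \<notin> {0..1} \<Longrightarrow> \<beta>' y = 0"
  shows "(\<integral>y. (\<integral>t. g t * indicator {0..y} t \<partial>lborel) * \<beta>' y \<partial>lborel) = - (\<integral>y. g y * \<beta> y \<partial>lborel)"
proof -
  have [measurable]: "g \<in> borel_measurable borel" using g by auto
  have [measurable]: "\<beta>' \<in> borel_measurable borel" using cont by (rule borel_measurable_continuous_onI)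
  have "integrable lborel (\<lambda>x. indicator {0..1} x *\<^sub>R \<beta>' x)"
    by (intro borel_integrable_compact continuous_on_subset[OF cont]) auto
  moreover have "(\<lambda>x. indicator {0..1} x *\<^sub>R \<beta>' x) = \<beta>'"
    using \<beta>'0 by (auto simp: fun_eq_iff split: split_indicator)
  ultimately have b': "integrable lborel \<beta>'" by simp
  let ?h = "\<lambda>y t. g t * indicator {0..y} t * \<beta>' y"
  have "integrable (lborel \<Otimes>\<^sub>M lborel) (\<lambda>(y, t). \<beta>' y * g t)"
    using b' g by (intro lborel_pair.Fubini_integrable) (auto simp: abs_mult)
  then have int: "integrable (lborel \<Otimes>\<^sub>M lborel) (\<lambda>(y, t). ?h y t)"
  proof (rule Bochner_Integration.integrable_bound)
    have "(\<lambda>z. (case z of (y, t) \<Rightarrow> g t * indicat_real {0..y} t) * \<beta>' (fst z)) \<in> borel_measurable (borel \<Otimes>\<^sub>M borel)"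
      by (intro borel_measurable_times measurable_indefinite_integrand) measurable
    then show "(\<lambda>(y, t). ?h y t) \<in> borel_measurable (lborel \<Otimes>\<^sub>M lborel)"
      by (simp add: split_beta)
  qed (auto simp: abs_mult split: split_indicator)
  have "(\<integral>y. (\<integral>t. g t * indicator {0..y} t \<partial>lborel) * \<beta>' y \<partial>lborel) = (\<integral>y. (\<integral>t. ?h y t \<partial>lborel) \<partial>lborel)"
    by simp
  also have "\<dots> = (\<integral>t. (\<integral>y. ?h y t \<partial>lborel) \<partial>lborel)"
    using lborel_pair.Fubini_integral[OF int] by simp
  also have "\<dots> = (\<integral>t. g t * (- \<beta> t) \<partial>lborel)"
  proof (rule Bochner_Integration.integral_cong)
    fix t :: real
    show "(\<integral>y. ?h y t \<partial>lborel) = g t * - \<beta> t"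
    proof (cases "t \<in> {0..1}")
      case True
      have "(\<integral>y. ?h y t \<partial>lborel) = g t * (\<integral>y. indicator {t..1} y *\<^sub>R \<beta>' y \<partial>lborel)"
        unfolding integral_mult_right_zero[symmetric] using True \<beta>'0
        by (intro Bochner_Integration.integral_cong) (auto split: split_indicator)
      also have "(\<integral>y. indicator {t..1} y *\<^sub>R \<beta>' y \<partial>lborel) = \<beta> 1 - \<beta> t"
        using \<beta> True by (intro integral_FTC_atLeastAtMost continuous_on_subset[OF cont])
          (auto simp: has_real_derivative_iff_has_vector_derivative intro: has_vector_derivative_at_within)
      finally show ?thesis using \<beta>1 by simp
    qed (simp add: supp)
  qed simp
  finally show ?thesis by simp
qed

text \<open>Subtracting the indefinite integral of \<open>g\<close> leaves a function \<open>r\<close> with weak derivative \<open>0\<close>,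
  that is, orthogonal to all balanced bumps. Taking \<open>c\<close> to be the mean of \<open>r\<close> against the reference
  bump, \<open>r - c\<close> is orthogonal to all bumps, hence null.\<close>

lemma slice_primitive:
  fixes f g :: "real \<Rightarrow> real"
  assumes f: "integrable lborel f" and g: "integrable lborel g"
    and supp: "\<And>y. y \<notin> {0..1} \<Longrightarrow> f y = 0" "\<And>y. y \<notin> {0..1} \<Longrightarrow> g y = 0"
    and weak: "\<And>n a b. a \<in> \<rat> \<Longrightarrow> b \<in> \<rat> \<Longrightarrow> 0 < a \<Longrightarrow> a < b \<Longrightarrow> b < 1 \<Longrightarrow>
       \<exists>\<beta>. (\<forall>x. (\<beta> has_real_derivative balanced_bump n a b x) (at x)) \<and> \<beta> 1 = 0 \<and>
       (\<integral>y. f y * balanced_bump n a b y + g y * \<beta> y \<partial>lborel) = 0"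
  shows "\<exists>c. AE y in lborel. y \<in> {0..1} \<longrightarrow> f y = c + (\<integral>t. g t * indicator {0..y} t \<partial>lborel)"
proof -
  have [measurable]: "g \<in> borel_measurable borel" "f \<in> borel_measurable borel" using f g by auto
  define G where "G y = (\<integral>t. g t * indicator {0..y} t \<partial>lborel)" for y
  have [measurable]: "G \<in> borel_measurable borel"
  proof -
    have "(\<lambda>(y, t). g t * indicat_real {0..y} t) \<in> borel_measurable (borel \<Otimes>\<^sub>M borel)"
      by (rule measurable_indefinite_integrand) measurable
    then have "(\<lambda>(y, t). g t * indicat_real {0..y} t) \<in> borel_measurable (borel \<Otimes>\<^sub>M lborel)" by simp
    then show ?thesis unfolding G_def by (rule lborel.borel_measurable_lebesgue_integral)
  qed
  have Gb: "\<bar>G y\<bar> \<le> (\<integral>t. \<bar>g t\<bar> \<partial>lborel)" for y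
    unfolding G_def using g
    by (intro order_trans[OF integral_abs_bound] integral_mono)
      (auto intro!: integrable_real_mult_indicator integrable_abs simp: abs_mult split: split_indicator)
  define r where "r y = indicator {0..1} y * (f y - G y)" for y
  have [measurable]: "r \<in> borel_measurable borel" unfolding r_def by measurable
  have iG: "integrable lborel (\<lambda>y. indicator {0..1} y * G y)"
    by (rule Bochner_Integration.integrable_bound[of _ "\<lambda>y. indicator {0..1} y * (\<integral>t. \<bar>g t\<bar> \<partial>lborel)"])
       (use Gb in \<open>auto simp: abs_mult split: split_indicator intro!: order_trans[OF Gb]\<close>)
  have r: "integrable lborel r"
  proof -
    have "r = (\<lambda>y. f y - indicator {0..1} y * G y)" using supp by (auto simp: r_def fun_eq_iff split: split_indicator)
    then show ?thesis using f iG by simp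
  qed
  have ib: "integrable lborel (\<lambda>y. h y * bump n a b y)" if h: "integrable lborel h" for h n a b
    by (rule Bochner_Integration.integrable_bound[OF h])
       (use h bump_bounds in \<open>auto simp: abs_mult intro!: mult_left_le\<close>)
  define m where "m = bump_mass 1 (1/4) (3/4)"
  define c where "c = (\<integral>y. r y * ref_bump y \<partial>lborel) / m"
  have m0: "m \<noteq> 0" using ref_bump_mass_nonzero m_def by simp
  have "AE y in lborel. indicator {0..1} y * (r y - c) = 0"
  proof (rule AE_zero_if_orthogonal_to_bumps[where p=0 and q=1])
    show int: "integrable lborel (\<lambda>y. indicator {0..1} y * (r y - c))"
      using r by (simp add: right_diff_distrib integrable_mult_indicator[where 'b=real, simplified])
    fix n and a b :: real assume ab: "a \<in> \<rat>" "b \<in> \<rat>" "0 < a" "a < b" "b < 1"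
    obtain \<beta> where \<beta>: "\<And>x. (\<beta> has_real_derivative balanced_bump n a b x) (at x)" "\<beta> 1 = 0"
      and w: "(\<integral>y. f y * balanced_bump n a b y + g y * \<beta> y \<partial>lborel) = 0"
      using weak[OF ab, of n] by blast
    have bb0: "balanced_bump n a b y = 0" if "y \<notin> {0..1}" for y
      using that ab bump_eq_0[of y a b n] bump_eq_0[of y "1/4" "3/4" 1] by (auto simp: balanced_bump_def)
    have parts: "(\<integral>y. G y * balanced_bump n a b y \<partial>lborel) = - (\<integral>y. g y * \<beta> y \<partial>lborel)"
      unfolding G_def using C_k_continuous[OF C_k_balanced_bump]
      by (intro integral_by_parts_indefinite g supp \<beta> bb0)
    have ifb: "integrable lborel (\<lambda>y. h y * balanced_bump n a b y)" if h: "integrable lborel h" for h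
    proof -
      have "integrable lborel (\<lambda>y. m * (h y * bump n a b y) - bump_mass n a b * (h y * ref_bump y))"
        using ib[OF h] by simp
      then show ?thesis by (simp add: balanced_bump_def m_def algebra_simps)
    qed
    have igb: "integrable lborel (\<lambda>y. g y * \<beta> y)"
    proof -
      have "continuous_on {0..1} \<beta>" using \<beta>(1) by (meson DERIV_isCont continuous_at_imp_continuous_on)
      then have "compact (\<beta> ` {0..1})" by (intro compact_continuous_image) auto
      then obtain B where B: "\<And>y. y \<in> {0..1} \<Longrightarrow> \<bar>\<beta> y\<bar> \<le> B"
        using compact_imp_bounded bounded_iff by (metis (no_types, lifting) image_eqI real_norm_def)
      have [measurable]: "\<beta> \<in> borel_measurable borel"
        using \<beta>(1) by (intro borel_measurable_continuous_onI) (meson DERIV_isCont continuous_at_imp_continuous_on)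
      show ?thesis
        by (rule Bochner_Integration.integrable_bound[OF integrable_mult_left[OF g, of B]])
           (measurable, intro AE_I2, use B supp(2) in \<open>case_tac "x \<in> {0..1}"; force simp: abs_mult intro!: mult_left_mono\<close>)
    qed
    have "(\<integral>y. r y * balanced_bump n a b y \<partial>lborel) = (\<integral>y. f y * balanced_bump n a b y - (indicator {0..1} y * G y) * balanced_bump n a b y \<partial>lborel)"
      by (intro Bochner_Integration.integral_cong) (auto simp: r_def supp bb0 algebra_simps split: split_indicator)
    also have "\<dots> = (\<integral>y. f y * balanced_bump n a b y \<partial>lborel) - (\<integral>y. (indicator {0..1} y * G y) * balanced_bump n a b y \<partial>lborel)"
      using ifb[OF f] ifb[OF iG] by simp
    also have "(\<integral>y. (indicator {0..1} y * G y) * balanced_bump n a b y \<partial>lborel) = (\<integral>y. G y * balanced_bump n a b y \<partial>lborel)"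
      by (intro Bochner_Integration.integral_cong) (auto simp: bb0 split: split_indicator)
    finally have "(\<integral>y. r y * balanced_bump n a b y \<partial>lborel) = 0"
      using parts w ifb[OF f] igb by simp
    moreover have "(\<integral>y. r y * balanced_bump n a b y \<partial>lborel) = m * (\<integral>y. r y * bump n a b y \<partial>lborel) - bump_mass n a b * (\<integral>y. r y * ref_bump y \<partial>lborel)"
    proof -
      have "(\<lambda>y. r y * balanced_bump n a b y) = (\<lambda>y. m * (r y * bump n a b y) - bump_mass n a b * (r y * ref_bump y))"
        by (simp add: fun_eq_iff balanced_bump_def m_def algebra_simps)
      then show ?thesis using ib[OF r] by simp
    qed
    moreover have "(\<integral>y. r y * ref_bump y \<partial>lborel) = c * m" using m0 by (simp add: c_def)
    ultimately have key: "(\<integral>y. r y * bump n a b y \<partial>lborel) = c * bump_mass n a b" using m0 by simp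
    have "(\<integral>y. indicator {0..1} y * (r y - c) * bump n a b y \<partial>lborel) = (\<integral>y. r y * bump n a b y - c * bump n a b y \<partial>lborel)"
      using ab bump_eq_0[of _ a b n] by (intro Bochner_Integration.integral_cong) (auto simp: algebra_simps split: split_indicator)
    also have "\<dots> = 0" using ib[OF r] integrable_bump key by (simp add: bump_mass_def)
    finally show "(\<integral>y. indicator {0..1} y * (r y - c) * bump n a b y \<partial>lborel) = 0" .
  qed auto
  then have "AE y in lborel. y \<in> {0..1} \<longrightarrow> f y = c + G y"
    by eventually_elim (auto simp: r_def)
  then show ?thesis unfolding G_def by blast
qed

section \<open>Weak derivatives on vertical lines\<close>

lemma interior_Omega: "interior (Omega L) = {0<..<L} \<times> {0<..<1}"
  unfolding Omega_def by (simp add: interior_Times)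

lemma smooth_real_deriv:
  fixes \<beta> :: "real \<Rightarrow> real"
  assumes "\<And>x. (\<beta> has_real_derivative \<beta>' x) (at x)" "\<And>k. C_k k \<beta>'"
  shows "C_k k \<beta>"
  using C_k_Suc_imp[of k \<beta>] C_k_Suc_real[of \<beta> \<beta>' k] assms by blast

lemma smooth_product:
  fixes \<alpha> \<beta> :: "real \<Rightarrow> real"
  assumes "\<And>k. C_k k \<alpha>" "\<And>k. C_k k \<beta>"
  shows "smooth (\<lambda>z::real \<times> real. \<alpha> (fst z) * \<beta> (snd z))"
proof -
  have "C_k k (\<lambda>z::real \<times> real. \<alpha> (fst z + 0))" "C_k k (\<lambda>z::real \<times> real. \<beta> (snd z + 0))" for k
    using assms by (auto intro!: C_k_compose_affine linear_fst linear_snd simp del: add_0_right)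
  then show ?thesis unfolding smooth_def by (auto intro: C_k_mult)
qed

lemma test_function_product:
  fixes \<alpha> \<beta> :: "real \<Rightarrow> real"
  assumes "\<And>k. C_k k \<alpha>" "\<And>k. C_k k \<beta>"
    and "\<And>x. x \<notin> {a..b} \<Longrightarrow> \<alpha> x = 0" "\<And>y. y \<notin> {c..d} \<Longrightarrow> \<beta> y = 0"
    and "0 < a" "b < L" "0 < c" "d < 1"
  shows "test_function (Omega L) (\<lambda>z. \<alpha> (fst z) * \<beta> (snd z))"
proof -
  let ?S = "closure {z. \<alpha> (fst z) * \<beta> (snd z) \<noteq> 0}"
  have sub: "?S \<subseteq> {a..b} \<times> {c..d}"
    using assms(3,4) by (intro closure_minimal closed_Times) (auto, (metis mem_Times_iff atLeastAtMost_iff fst_conv snd_conv)+)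
  moreover have "compact ({a..b} \<times> {c..d})" by (intro compact_Times) auto
  then have "compact (({a..b} \<times> {c..d}) \<inter> ?S)" by (rule compact_Int_closed) simp
  ultimately have "compact ?S" by (simp add: inf.absorb_iff2)
  moreover have "?S \<subseteq> interior (Omega L)"
    using sub assms(5-8) unfolding interior_Omega by force
  ultimately show ?thesis using smooth_product[OF assms(1,2)] by (simp add: test_function_def)
qed

lemma pderiv_product:
  fixes \<alpha> \<beta> :: "real \<Rightarrow> real"
  assumes "(\<alpha> has_real_derivative a') (at (fst z))" "(\<beta> has_real_derivative b') (at (snd z))"
  shows "pderiv_at ex (\<lambda>z. \<alpha> (fst z) * \<beta> (snd z)) z = a' * \<beta> (snd z)"
    and "pderiv_at ey (\<lambda>z. \<alpha> (fst z) * \<beta> (snd z)) z = \<alpha> (fst z) * b'"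
proof -
  have 1: "((\<lambda>z. \<alpha> (fst z)) has_derivative (\<lambda>h. a' * fst h)) (at z)"
    using has_derivative_compose[OF has_derivative_fst[OF has_derivative_ident] assms(1)[unfolded has_field_derivative_def]] by simp
  have 2: "((\<lambda>z. \<beta> (snd z)) has_derivative (\<lambda>h. b' * snd h)) (at z)"
    using has_derivative_compose[OF has_derivative_snd[OF has_derivative_ident] assms(2)[unfolded has_field_derivative_def]] by simp
  note frechet_derivative_at[OF has_derivative_mult[OF 1 2], symmetric]
  then show "pderiv_at ex (\<lambda>z. \<alpha> (fst z) * \<beta> (snd z)) z = a' * \<beta> (snd z)"
    "pderiv_at ey (\<lambda>z. \<alpha> (fst z) * \<beta> (snd z)) z = \<alpha> (fst z) * b'" by simp_all
qed

lemma integrable_times_bounded: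
  fixes f h :: "'a \<Rightarrow> real"
  assumes f: "integrable M f" and [measurable]: "h \<in> borel_measurable M" and B: "\<And>z. \<bar>h z\<bar> \<le> B"
  shows "integrable M (\<lambda>z. f z * h z)"
proof (rule Bochner_Integration.integrable_bound[OF integrable_mult_left[OF f, of B]])
  have "0 \<le> B" using B abs_ge_zero order_trans by blast
  then show "AE z in M. norm (f z * h z) \<le> norm (f z * B)"
    using B by (auto simp: abs_mult intro!: mult_left_mono)
qed (use f in measurable)

lemma bounded_if_compact_support:
  fixes \<beta> :: "real \<Rightarrow> real"
  assumes "continuous_on UNIV \<beta>" "\<And>y. y \<notin> {c..d} \<Longrightarrow> \<beta> y = 0"
  obtains B where "\<And>y. \<bar>\<beta> y\<bar> \<le> B"
proof -
  have "compact (\<beta> ` {c..d})"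
    using continuous_on_subset[OF assms(1)] by (intro compact_continuous_image) auto
  then obtain B where B: "\<And>y. y \<in> {c..d} \<Longrightarrow> \<bar>\<beta> y\<bar> \<le> B"
    using compact_imp_bounded bounded_iff by (metis (no_types, lifting) image_eqI real_norm_def)
  have "\<bar>\<beta> y\<bar> \<le> max B 0" for y
    using B[of y] assms(2)[of y] by (cases "y \<in> {c..d}") auto
  then show thesis using that by blast
qed

text \<open>The function \<open>x \<mapsto> \<integral> H (x, y) dy\<close> is orthogonal to all bumps by Fubini.\<close>

lemma AE_slice_zero:
  fixes H :: "real \<times> real \<Rightarrow> real"
  assumes H: "integrable lborel H" and pq: "p < q" and supp: "\<And>x y. x \<notin> {p..q} \<Longrightarrow> H (x, y) = 0"
    and orth: "\<And>n a b. p < a \<Longrightarrow> a < b \<Longrightarrow> b < q \<Longrightarrow> (\<integral>z. H z * bump n a b (fst z) \<partial>lborel) = 0"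
  shows "AE x in lborel. (\<integral>y. H (x, y) \<partial>lborel) = 0"
proof (rule AE_zero_if_orthogonal_to_bumps[OF _ pq])
  have H': "integrable (lborel \<Otimes>\<^sub>M lborel) (\<lambda>(x, y). H (x, y))" using H by (simp add: lborel_prod)
  show "integrable lborel (\<lambda>x. \<integral>y. H (x, y) \<partial>lborel)"
    using lborel_pair.integrable_fst[OF H'] .
  show "(\<integral>y. H (x, y) \<partial>lborel) = 0" if "x \<notin> {p..q}" for x using supp[OF that] by simp
  fix n and a b :: real assume ab: "p < a" "a < b" "b < q"
  have "integrable lborel (\<lambda>z. H z * bump n a b (fst z))"
    by (rule integrable_times_bounded[OF H, of _ 1])
       (use bump_bounds in \<open>auto simp: borel_prod[symmetric]\<close>)
  then have "integrable (lborel \<Otimes>\<^sub>M lborel) (\<lambda>(x, y). H (x, y) * bump n a b x)"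
    unfolding lborel_prod by (simp add: case_prod_unfold)
  from lborel_pair.integral_fst[OF this]
  have "(\<integral>x. (\<integral>y. H (x, y) * bump n a b x \<partial>lborel) \<partial>lborel) = (\<integral>z. H z * bump n a b (fst z) \<partial>lborel)"
    by (simp add: lborel_prod case_prod_unfold)
  then show "(\<integral>x. (\<integral>y. H (x, y) \<partial>lborel) * bump n a b x \<partial>lborel) = 0"
    using orth[OF ab] by simp
qed

text \<open>Testing with products \<open>\<alpha>(x) \<beta>(y)\<close> and removing \<open>\<alpha>\<close> by orthogonality shows that almost
  every vertical slice of \<open>f\<close> has the slice of \<open>g\<close> as its one-dimensional weak derivative, for all
  \<open>\<beta>\<close> in a countable family that determines the slice up to a constant.\<close>

lemma weak_deriv_ey_slices:
  fixes f g :: "real \<times> real \<Rightarrow> real"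
  assumes L: "L > 0" and f: "integrable lborel f" and g: "integrable lborel g"
    and supp: "\<And>z. z \<notin> Omega L \<Longrightarrow> f z = 0" "\<And>z. z \<notin> Omega L \<Longrightarrow> g z = 0"
    and weak: "\<And>\<phi>. test_function (Omega L) \<phi> \<Longrightarrow>
      (\<integral>z. f z * pderiv_at ey \<phi> z \<partial>lborel) = - (\<integral>z. g z * \<phi> z \<partial>lborel)"
  shows "AE x in lborel. \<exists>c. AE y in lborel. y \<in> {0..1} \<longrightarrow>
    f (x, y) = c + (\<integral>t. g (x, t) * indicator {0..y} t \<partial>lborel)"
proof -
  define prim where "prim n a b = (SOME \<beta>. (\<forall>y. (\<beta> has_real_derivative balanced_bump n a b y) (at y)) \<and>
      (\<forall>y. y \<notin> {min a (1/4)..max b (3/4)} \<longrightarrow> \<beta> y = 0))" for n a b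
  have prim: "(prim n a b has_real_derivative balanced_bump n a b y) (at y)"
    "y \<notin> {min a (1/4)..max b (3/4)} \<Longrightarrow> prim n a b y = 0" for n a b y
  proof -
    obtain \<beta> where "(\<forall>y. (\<beta> has_real_derivative balanced_bump n a b y) (at y)) \<and>
      (\<forall>y. y \<notin> {min a (1/4)..max b (3/4)} \<longrightarrow> \<beta> y = 0)"
      using balanced_bump_primitive[OF order_refl order_refl, of n a b] by blast
    from someI[of "\<lambda>\<beta>. (\<forall>y. (\<beta> has_real_derivative balanced_bump n a b y) (at y)) \<and>
      (\<forall>y. y \<notin> {min a (1/4)..max b (3/4)} \<longrightarrow> \<beta> y = 0)", OF this]
    show "(prim n a b has_real_derivative balanced_bump n a b y) (at y)"
      "y \<notin> {min a (1/4)..max b (3/4)} \<Longrightarrow> prim n a b y = 0"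
      unfolding prim_def by blast+
  qed
  have Ck_prim: "C_k k (prim n a b)" for k n a b
    using smooth_real_deriv[OF prim(1) C_k_balanced_bump] .
  have [measurable]: "prim n a b \<in> borel_measurable borel" "balanced_bump n a b \<in> borel_measurable borel" for n a b
    using C_k_continuous[OF Ck_prim] C_k_continuous[OF C_k_balanced_bump] by (auto intro: borel_measurable_continuous_onI)
  have [measurable]: "f \<in> borel_measurable (borel \<Otimes>\<^sub>M borel)" "g \<in> borel_measurable (borel \<Otimes>\<^sub>M borel)"
    using f g by (auto simp: borel_prod)
  have intprod: "integrable lborel (\<lambda>z. h z * (\<alpha> (fst z) * \<beta> (snd z)))"
    if h: "integrable lborel h" and B: "\<And>x. \<bar>\<alpha> x\<bar> \<le> 1" "\<And>y. \<bar>\<beta> y\<bar> \<le> B" and [measurable]: "\<alpha> \<in> borel_measurable borel" "\<beta> \<in> borel_measurable borel"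
    for h :: "real \<times> real \<Rightarrow> real" and \<alpha> \<beta> B
  proof (rule integrable_times_bounded[OF h, of _ "1 * B"])
    show "(\<lambda>z. \<alpha> (fst z) * \<beta> (snd z)) \<in> borel_measurable lborel"
      by (simp add: borel_prod[symmetric])
    show "\<bar>\<alpha> (fst z) * \<beta> (snd z)\<bar> \<le> 1 * B" for z :: "real \<times> real"
      unfolding abs_mult using B by (intro mult_mono) auto
  qed
  have bb_supp: "balanced_bump n a b y = 0" if "y \<notin> {min a (1/4)..max b (3/4)}" for n a b y
    using that bump_eq_0[of y a b n] bump_eq_0[of y "1/4" "3/4" 1] by (auto simp: balanced_bump_def min_def max_def split: if_splits)
  have zero: "AE x in lborel. (\<integral>y. f (x, y) * balanced_bump m c d y + g (x, y) * prim m c d y \<partial>lborel) = 0"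
    if cd: "0 < c" "c < d" "d < 1" for m c d
  proof -
    obtain B where B: "\<And>y. \<bar>prim m c d y\<bar> \<le> B"
      using bounded_if_compact_support[OF C_k_continuous[OF Ck_prim] prim(2)] by blast
    obtain B' where B': "\<And>y. \<bar>balanced_bump m c d y\<bar> \<le> B'"
      using bounded_if_compact_support[OF C_k_continuous[OF C_k_balanced_bump] bb_supp] by blast
    let ?H = "\<lambda>z. f z * balanced_bump m c d (snd z) + g z * prim m c d (snd z)"
    have "AE x in lborel. (\<integral>y. ?H (x, y) \<partial>lborel) = 0"
    proof (rule AE_slice_zero[OF _ L])
      show "integrable lborel ?H"
        using intprod[where \<alpha>="\<lambda>_. 1" and \<beta>="balanced_bump m c d", OF f _ B']
          intprod[where \<alpha>="\<lambda>_. 1" and \<beta>="prim m c d", OF g _ B] by simp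
      show "?H (x, y) = 0" if "x \<notin> {0..L}" for x y
        using supp[of "(x, y)"] that by (auto simp: Omega_def)
      fix n and a b :: real assume ab: "0 < a" "a < b" "b < L"
      have tf: "test_function (Omega L) (\<lambda>z. bump n a b (fst z) * prim m c d (snd z))"
        using ab cd bump_eq_0[of _ a b n]
          by (intro test_function_product[where a=a and b=b and c="min c (1/4)" and d="max d (3/4)", OF C_k_bump Ck_prim _ prim(2)]) auto
      have pd: "pderiv_at ey (\<lambda>z. bump n a b (fst z) * prim m c d (snd z)) z = bump n a b (fst z) * balanced_bump m c d (snd z)"
        for z :: "real \<times> real"
      proof -
        have "bump n a b differentiable (at (fst z))" using C_k_bump[of "Suc 0" n a b] by simp
        then obtain a' where "(bump n a b has_real_derivative a') (at (fst z))"
          by (auto simp: real_differentiable_def)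
        from pderiv_product(2)[OF this prim(1)] show ?thesis .
      qed
      have b1: "\<bar>bump n a b x\<bar> \<le> 1" for x using bump_bounds[of n a b x] by simp
      have "(\<integral>z. ?H z * bump n a b (fst z) \<partial>lborel) =
        (\<integral>z. f z * (bump n a b (fst z) * balanced_bump m c d (snd z)) + g z * (bump n a b (fst z) * prim m c d (snd z)) \<partial>lborel)"
        by (intro Bochner_Integration.integral_cong) (auto simp: algebra_simps)
      also have "\<dots> = (\<integral>z. f z * (bump n a b (fst z) * balanced_bump m c d (snd z)) \<partial>lborel) + (\<integral>z. g z * (bump n a b (fst z) * prim m c d (snd z)) \<partial>lborel)"
        by (intro Bochner_Integration.integral_add intprod[OF f b1 B'] intprod[OF g b1 B]) auto
      also have "\<dots> = 0" using weak[OF tf] unfolding pd by simp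
      finally show "(\<integral>z. ?H z * bump n a b (fst z) \<partial>lborel) = 0" .
    qed
    then show ?thesis by simp
  qed
  have "AE x in lborel. \<forall>m. \<forall>c\<in>\<rat>. \<forall>d\<in>\<rat>. 0 < c \<and> c < d \<and> d < 1 \<longrightarrow>
     (\<integral>y. f (x, y) * balanced_bump m c d y + g (x, y) * prim m c d y \<partial>lborel) = 0"
    unfolding AE_all_countable AE_ball_countable[OF countable_rat]
    using zero by (auto intro: AE_I2)
  moreover have "AE x in lborel. integrable lborel (\<lambda>y. f (x, y))" "AE x in lborel. integrable lborel (\<lambda>y. g (x, y))"
    using lborel_pair.AE_integrable_fst'[of f] lborel_pair.AE_integrable_fst'[of g] f g by (auto simp: lborel_prod)
  ultimately show ?thesis
  proof eventually_elim
    case (elim x)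
    show ?case
    proof (rule slice_primitive[OF elim(2,3)])
      show "f (x, y) = 0" "g (x, y) = 0" if "y \<notin> {0..1}" for y
        using supp[of "(x, y)"] that by (auto simp: Omega_def)
      fix n and a b :: real assume "a \<in> \<rat>" "b \<in> \<rat>" "0 < a" "a < b" "b < 1"
      moreover from this have "prim n a b 1 = 0" by (intro prim(2)) auto
      ultimately show "\<exists>\<beta>. (\<forall>x. (\<beta> has_real_derivative balanced_bump n a b x) (at x)) \<and> \<beta> 1 = 0 \<and>
        (\<integral>y. f (x, y) * balanced_bump n a b y + g (x, y) * \<beta> y \<partial>lborel) = 0"
        using elim(1) prim(1) by (intro exI[of _ "prim n a b"]) auto
    qed
  qed
qed

text \<open>Apply the one-dimensional statement first in \<open>x\<close> and then in \<open>y\<close>.\<close>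

lemma AE_zero_if_orthogonal_to_bumps_2d:
  fixes g :: "real \<times> real \<Rightarrow> real"
  assumes g: "integrable lborel g" and box: "p < q" "r < s"
    and supp: "\<And>z. z \<notin> {p..q} \<times> {r..s} \<Longrightarrow> g z = 0"
    and orth: "\<And>n a b m c d. p < a \<Longrightarrow> a < b \<Longrightarrow> b < q \<Longrightarrow> r < c \<Longrightarrow> c < d \<Longrightarrow> d < s \<Longrightarrow>
      (\<integral>z. g z * (bump n a b (fst z) * bump m c d (snd z)) \<partial>lborel) = 0"
  shows "AE z in lborel. g z = 0"
proof -
  have [measurable]: "g \<in> borel_measurable (borel \<Otimes>\<^sub>M borel)"
    using g by (auto simp: borel_prod)
  have "AE x in lborel. (\<integral>y. g (x, y) * bump m c d y \<partial>lborel) = 0" if cd: "r < c" "c < d" "d < s" for m c d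
  proof -
    have "AE x in lborel. (\<integral>y. (\<lambda>z. g z * bump m c d (snd z)) (x, y) \<partial>lborel) = 0"
    proof (rule AE_slice_zero[OF _ box(1)])
      show "integrable lborel (\<lambda>z. g z * bump m c d (snd z))"
        by (rule integrable_times_bounded[OF g, of _ 1])
           (use bump_bounds in \<open>auto simp: borel_prod[symmetric]\<close>)
      show "g (x, y) * bump m c d (snd (x, y)) = 0" if "x \<notin> {p..q}" for x y
        using supp[of "(x, y)"] that by auto
      show "(\<integral>z. g z * bump m c d (snd z) * bump n a b (fst z) \<partial>lborel) = 0" if "p < a" "a < b" "b < q" for n a b
        using orth[OF that cd, of n m] by (simp add: mult_ac)
    qed
    then show ?thesis by simp
  qed
  then have "AE x in lborel. \<forall>m. \<forall>c\<in>\<rat>. \<forall>d\<in>\<rat>. r < c \<and> c < d \<and> d < s \<longrightarrow> (\<integral>y. g (x, y) * bump m c d y \<partial>lborel) = 0"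
    unfolding AE_all_countable AE_ball_countable[OF countable_rat] by (auto intro: AE_I2)
  moreover have "AE x in lborel. integrable lborel (\<lambda>y. g (x, y))"
    using lborel_pair.AE_integrable_fst'[of g] g by (auto simp: lborel_prod)
  ultimately have "AE x in lborel. AE y in lborel. g (x, y) = 0"
  proof eventually_elim
    case (elim x)
    show ?case
      by (rule AE_zero_if_orthogonal_to_bumps[OF elim(2) box(2)]) (use supp elim(1) in auto)
  qed
  then have "AE z in lborel \<Otimes>\<^sub>M lborel. g z = 0"
    by (intro lborel_pair.AE_pair_measure) measurable
  then show ?thesis unfolding lborel_prod .
qed

section \<open>Interpolation on a single line\<close>

text \<open>Expand the integral over \<open>{s..t}\<close> of \<open>(q - a)\<^sup>2 \<ge> 0\<close>, where \<open>a\<close> is the mean of \<open>q\<close> there.\<close>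

lemma Cauchy_Schwarz_interval:
  fixes q :: "real \<Rightarrow> real"
  assumes q: "integrable lborel q" and q2: "integrable lborel (\<lambda>x. (q x)\<^sup>2)" and st: "s \<le> t"
  shows "(\<integral>x. q x * indicator {s..t} x \<partial>lborel)\<^sup>2 \<le> (t - s) * (\<integral>x. (q x)\<^sup>2 \<partial>lborel)"
proof (cases "s = t")
  case True
  have "(\<integral>x. q x * indicator {s..t} x \<partial>lborel) = 0"
  proof (rule integral_eq_zero_AE)
    show "AE x in lborel. q x * indicator {s..t} x = 0"
      using AE_lborel_singleton[of s] by eventually_elim (use True in \<open>auto split: split_indicator\<close>)
  qed
  then show ?thesis using True by simp
next
  case False
  define l where "l = t - s"
  define I where "I = (\<integral>x. q x * indicator {s..t} x \<partial>lborel)"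
  have l: "l > 0" using False st by (simp add: l_def)
  note ii = integrable_real_mult_indicator[of "{s..t}" lborel]
  have i1: "integrable lborel (\<lambda>x. (q x)\<^sup>2 * indicator {s..t} x)" using ii[OF _ q2] by simp
  have i2: "integrable lborel (\<lambda>x. q x * indicator {s..t} x)" using ii[OF _ q] by simp
  have i3: "integrable lborel (indicat_real {s..t})"
    by (intro integrable_real_indicator) (auto simp: emeasure_lborel_Icc_eq)
  have "0 \<le> (\<integral>x. (q x - I / l)\<^sup>2 * indicator {s..t} x \<partial>lborel)"
    by (intro Bochner_Integration.integral_nonneg) auto
  also have "\<dots> = (\<integral>x. (q x)\<^sup>2 * indicator {s..t} x - 2 * (I / l) * (q x * indicator {s..t} x) + (I / l)\<^sup>2 * indicator {s..t} x \<partial>lborel)"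
    by (intro Bochner_Integration.integral_cong) (auto simp: power2_eq_square algebra_simps)
  also have "\<dots> = (\<integral>x. (q x)\<^sup>2 * indicator {s..t} x \<partial>lborel) - 2 * (I / l) * I + (I / l)\<^sup>2 * l"
    using i1 i2 i3 st by (simp add: I_def l_def)
  also have "\<dots> = (\<integral>x. (q x)\<^sup>2 * indicator {s..t} x \<partial>lborel) - I\<^sup>2 / l"
    using l by (simp add: field_simps power2_eq_square)
  finally have "I\<^sup>2 \<le> l * (\<integral>x. (q x)\<^sup>2 * indicator {s..t} x \<partial>lborel)"
    using l by (simp add: field_simps)
  also have "\<dots> \<le> l * (\<integral>x. (q x)\<^sup>2 \<partial>lborel)"
    using l i1 q2 by (intro mult_left_mono integral_mono) (auto split: split_indicator)
  finally show ?thesis by (simp add: I_def l_def)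
qed

lemma indefinite_integral_diff:
  fixes q :: "real \<Rightarrow> real"
  assumes q: "integrable lborel q" and st: "0 \<le> s" "s \<le> t"
  shows "(\<integral>x. q x * indicator {0..t} x \<partial>lborel) - (\<integral>x. q x * indicator {0..s} x \<partial>lborel)
    = (\<integral>x. q x * indicator {s..t} x \<partial>lborel)"
proof -
  note ii = integrable_real_mult_indicator[OF _ q]
  have "(\<integral>x. q x * indicator {0..t} x \<partial>lborel) - (\<integral>x. q x * indicator {0..s} x \<partial>lborel)
    = (\<integral>x. q x * indicator {0..t} x - q x * indicator {0..s} x \<partial>lborel)"
    using ii by simp
  also have "\<dots> = (\<integral>x. q x * indicator {s..t} x \<partial>lborel)"
  proof (rule integral_cong_AE)
    show "AE x in lborel. q x * indicator {0..t} x - q x * indicator {0..s} x = q x * indicator {s..t} x"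
      using AE_lborel_singleton[of s] by eventually_elim (use st in \<open>auto split: split_indicator\<close>)
  qed (use q in auto)
  finally show ?thesis .
qed

text \<open>The analysis on one vertical line: \<open>w = f'\<close> has mean zero and \<open>q = w'\<close>. With \<open>K = \<integral>q\<^sup>2\<close>, the
  function \<open>w\<close> satisfies \<open>\<bar>w t - w s\<bar>\<^sup>2 \<le> \<bar>t - s\<bar> * K\<close>. Mean zero bounds \<open>w\<close> by \<open>sqrt K\<close>, so the set
  \<open>{\<bar>w\<bar> \<ge> 1}\<close> is null for \<open>K < 1\<close>. For \<open>K \<ge> 1\<close> and a point \<open>y\<close> of this set, \<open>w\<close> keeps distance at least
  \<open>1/2\<close> from zero over the length \<open>h = 1 / (4 K)\<close> on one side of \<open>y\<close>, so that \<open>f\<close> changes by at least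
  \<open>h/2\<close>; integrating the square of this in \<open>y\<close> costs at most the square integral of \<open>f\<close> over \<open>h\<^sup>2\<close>.
  The bound is linear in \<open>\<integral>f\<^sup>2\<close>, which is what allows its integration over all lines.\<close>

lemma slice_bounds:
  fixes f w q :: "real \<Rightarrow> real"
  assumes w: "integrable lborel w" and q: "integrable lborel q"
    and f2: "integrable lborel (\<lambda>y. (f y)\<^sup>2)" and q2: "integrable lborel (\<lambda>y. (q y)\<^sup>2)"
    and [measurable]: "f \<in> borel_measurable borel"
    and supp: "\<And>y. y \<notin> {0..1} \<Longrightarrow> f y = 0" "\<And>y. y \<notin> {0..1} \<Longrightarrow> w y = 0"
    and wrep: "AE y in lborel. y \<in> {0..1} \<longrightarrow> w y = c + (\<integral>t. q t * indicator {0..y} t \<partial>lborel)"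
    and frep: "AE y in lborel. y \<in> {0..1} \<longrightarrow> f y = d + (\<integral>t. w t * indicator {0..y} t \<partial>lborel)"
    and mean: "(\<integral>y. w y \<partial>lborel) = 0"
  shows "measure lborel {y\<in>{0..1}. 1 \<le> \<bar>w y\<bar>} \<le> (\<integral>y. (q y)\<^sup>2 \<partial>lborel)"
    and "measure lborel {y\<in>{0..1}. 1 \<le> \<bar>w y\<bar>} \<le> 384 * (\<integral>y. (f y)\<^sup>2 \<partial>lborel) * (\<integral>y. (q y)\<^sup>2 \<partial>lborel)\<^sup>2"
    and "measure lborel {y\<in>{0..1}. 1 \<le> \<bar>w y\<bar>} \<le> 1"
proof -
  define K where "K = (\<integral>y. (q y)\<^sup>2 \<partial>lborel)"
  define m where "m = (\<integral>y. (f y)\<^sup>2 \<partial>lborel)"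
  define B where "B = {y\<in>{0..1}. 1 \<le> \<bar>w y\<bar>}"
  define W where "W y = c + (\<integral>t. q t * indicator {0..y} t \<partial>lborel)" for y
  define F where "F y = d + (\<integral>t. w t * indicator {0..y} t \<partial>lborel)" for y
  have [measurable]: "w \<in> borel_measurable borel" "q \<in> borel_measurable borel" using w q by auto
  have indef_meas: "(\<lambda>y. \<integral>t. g t * indicator {0..y} t \<partial>lborel) \<in> borel_measurable borel"
    if "g \<in> borel_measurable borel" for g :: "real \<Rightarrow> real"
  proof -
    have "(\<lambda>(y, t). g t * indicat_real {0..y} t) \<in> borel_measurable (borel \<Otimes>\<^sub>M lborel)"
      using measurable_indefinite_integrand[OF that] by simp
    then show ?thesis by (rule lborel.borel_measurable_lebesgue_integral)
  qed
  have [measurable]: "W \<in> borel_measurable borel" "F \<in> borel_measurable borel"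
    unfolding W_def F_def using indef_meas[of q] indef_meas[of w] by auto
  have K0: "0 \<le> K" unfolding K_def by (intro Bochner_Integration.integral_nonneg) auto
  have m0: "0 \<le> m" unfolding m_def by (intro Bochner_Integration.integral_nonneg) auto
  have Bset [measurable]: "B \<in> sets borel" unfolding B_def by measurable
  have B1: "measure lborel B \<le> 1"
  proof -
    have "measure lborel B \<le> measure lborel {0..1::real}"
      by (intro measure_mono_fmeasurable fmeasurableI) (auto simp: B_def)
    then show ?thesis by simp
  qed
  have holder: "(W t - W s)\<^sup>2 \<le> \<bar>t - s\<bar> * K" if "0 \<le> s" "0 \<le> t" for s t
  proof -
    have *: "(W t - W s)\<^sup>2 \<le> (t - s) * K" if "0 \<le> s" "s \<le> t" for s t
      using Cauchy_Schwarz_interval[OF q q2 that(2)] indefinite_integral_diff[OF q that]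
      by (simp add: W_def K_def)
    show ?thesis using *[of s t] *[of t s] that by (cases "s \<le> t") (auto simp: power2_commute)
  qed
  have wW: "AE y in lborel. w y = indicator {0..1} y * W y"
    using wrep by eventually_elim (auto simp: W_def supp split: split_indicator)
  have intW: "integrable lborel (\<lambda>y. indicator {0..1} y * W y)"
    using w by (rule integrable_cong_AE_imp) (use wW in \<open>auto elim: eventually_mono\<close>)
  have meanW: "(\<integral>y. indicator {0..1} y * W y \<partial>lborel) = 0"
    using mean integral_cong_AE[OF _ _ wW] by simp
  have Wsup: "\<bar>W y\<bar> \<le> sqrt K" if "y \<in> {0..1}" for y
  proof -
    have "W y = (\<integral>t. W y * indicator {0..1} t - indicator {0..1} t * W t \<partial>lborel)"
      using intW meanW by simp
    also have "\<bar>\<dots>\<bar> \<le> (\<integral>t. \<bar>W y * indicator {0..1} t - indicator {0..1} t * W t\<bar> \<partial>lborel)"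
      by (rule integral_abs_bound)
    also have "\<dots> \<le> (\<integral>t. sqrt K * indicator {0..1::real} t \<partial>lborel)"
    proof (rule integral_mono_AE)
      have i01: "integrable lborel (indicat_real {0..1::real})"
        by (intro integrable_real_indicator) (auto simp: emeasure_lborel_Icc_eq)
      show "integrable lborel (\<lambda>t. \<bar>W y * indicator {0..1} t - indicator {0..1} t * W t\<bar>)"
        "integrable lborel (\<lambda>t. sqrt K * indicator {0..1::real} t)"
        using intW i01 by auto
      have "\<bar>W y - W t\<bar> \<le> sqrt K" if "t \<in> {0..1}" for t
      proof (rule real_le_rsqrt)
        have "(W y - W t)\<^sup>2 \<le> \<bar>y - t\<bar> * K" using holder that \<open>y \<in> {0..1}\<close> by auto
        also have "\<dots> \<le> 1 * K" using that \<open>y \<in> {0..1}\<close> K0 by (intro mult_right_mono) auto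
        finally show "\<bar>W y - W t\<bar>\<^sup>2 \<le> K" by simp
      qed
      then show "AE t in lborel. \<bar>W y * indicator {0..1} t - indicator {0..1} t * W t\<bar> \<le> sqrt K * indicator {0..1} t"
        by (auto split: split_indicator)
    qed
    also have "\<dots> = sqrt K" by simp
    finally show ?thesis .
  qed
  have small: "measure lborel B = 0" if "K < 1"
  proof -
    have "AE y in lborel. y \<notin> B"
      using wW
    proof eventually_elim
      case (elim y)
      have "sqrt K < 1" using \<open>K < 1\<close> by (metis real_sqrt_less_iff real_sqrt_one)
      show ?case
      proof
        assume "y \<in> B"
        then have y: "y \<in> {0..1}" "1 \<le> \<bar>w y\<bar>" by (auto simp: B_def)
        moreover have "w y = W y" using elim y(1) by simp
        ultimately show False using Wsup[OF y(1)] \<open>sqrt K < 1\<close> by simp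
      qed
    qed
    then have "emeasure lborel B = 0" by (subst (asm) AE_iff_measurable[of B]) auto
    then show ?thesis by (simp add: measure_def)
  qed
  show "measure lborel {y\<in>{0..1}. 1 \<le> \<bar>w y\<bar>} \<le> 1" using B1 by (simp add: B_def)
  show "measure lborel {y\<in>{0..1}. 1 \<le> \<bar>w y\<bar>} \<le> (\<integral>y. (q y)\<^sup>2 \<partial>lborel)"
    using B1 small K0 by (cases "K < 1") (auto simp: B_def K_def)
  have "measure lborel B \<le> 384 * m * K\<^sup>2"
  proof (cases "K < 1")
    case True then show ?thesis using small m0 by simp
  next
    case False
    \<comment> \<open>Chosen so that \<open>h * K = (1/2)\<^sup>2\<close> and \<open>h \<le> 1/4\<close>: from each point of the unit interval one can move by \<open>h\<close> to the right or to the left.\<close>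
    define h where "h = 1 / (4 * K)"
    have h: "0 < h" "h \<le> 1/4" "h * K = 1/4" using False by (auto simp: h_def field_simps)
    have inc: "1 \<le> 8 / h\<^sup>2 * ((F s)\<^sup>2 + (F t)\<^sup>2)"
      if "0 \<le> s" "t \<le> 1" "t = s + h" "u = s \<or> u = t" "1 \<le> \<bar>W u\<bar>" for s t u
    proof -
      have dist: "\<bar>W x - W u\<bar> \<le> 1/2" if "x \<in> {s..t}" for x
      proof (rule power2_le_imp_le)
        have "(W x - W u)\<^sup>2 \<le> \<bar>x - u\<bar> * K" using holder[of u x] \<open>0 \<le> s\<close> that \<open>t = s + h\<close> \<open>u = s \<or> u = t\<close> h(1) by auto
        also have "\<dots> \<le> h * K" using that \<open>t = s + h\<close> \<open>u = s \<or> u = t\<close> K0 by (intro mult_right_mono) auto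
        finally show "\<bar>W x - W u\<bar>\<^sup>2 \<le> (1/2)\<^sup>2" using h(3) by (simp add: power2_eq_square)
      qed simp
      have near: "W u - 1/2 \<le> W x" "W x \<le> W u + 1/2" if "x \<in> {s..t}" for x
        using dist[OF that] unfolding abs_le_iff by linarith+
      have st: "s \<le> t" using that h by simp
      have Fd: "F t - F s = (\<integral>x. w x * indicator {s..t} x \<partial>lborel)"
        using indefinite_integral_diff[OF w \<open>0 \<le> s\<close> st] by (simp add: F_def)
      have iw: "integrable lborel (\<lambda>x. w x * indicator {s..t} x)"
        using w by (intro integrable_real_mult_indicator) auto
      have ist: "integrable lborel (indicat_real {s..t})"
        by (intro integrable_real_indicator) (auto simp: emeasure_lborel_Icc_eq)
      have "h / 2 \<le> \<bar>F t - F s\<bar>"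
      proof (cases "W u \<ge> 1")
        case True
        have "(\<integral>x. 1/2 * indicator {s..t} x \<partial>lborel) \<le> (\<integral>x. w x * indicator {s..t} x \<partial>lborel)"
        proof (rule integral_mono_AE)
          show "AE x in lborel. 1/2 * indicator {s..t} x \<le> w x * indicator {s..t} x"
            using wW
          proof eventually_elim
            case (elim x)
            show ?case
            proof (cases "x \<in> {s..t}")
              case x: True
              then have "w x = W x" using elim \<open>0 \<le> s\<close> \<open>t \<le> 1\<close> by simp
              then show ?thesis using near(1)[OF x] x True by simp
            qed simp
          qed
        qed (use iw ist in auto)
        then show ?thesis using Fd st \<open>t = s + h\<close> by simp
      next
        case False
        then have Wu: "W u \<le> -1" using \<open>1 \<le> \<bar>W u\<bar>\<close> by linarith
        have "(\<integral>x. w x * indicator {s..t} x \<partial>lborel) \<le> (\<integral>x. (-1/2) * indicator {s..t} x \<partial>lborel)"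
        proof (rule integral_mono_AE)
          show "AE x in lborel. w x * indicator {s..t} x \<le> (-1/2) * indicator {s..t} x"
            using wW
          proof eventually_elim
            case (elim x)
            show ?case
            proof (cases "x \<in> {s..t}")
              case x: True
              then have "w x = W x" using elim \<open>0 \<le> s\<close> \<open>t \<le> 1\<close> by simp
              then show ?thesis using near(2)[OF x] x Wu by simp
            qed simp
          qed
        qed (use iw ist in auto)
        then show ?thesis using Fd st \<open>t = s + h\<close> by simp
      qed
      then have "(h / 2)\<^sup>2 \<le> (F t - F s)\<^sup>2" using h(1) by (metis abs_le_square_iff abs_of_pos half_gt_zero)
      also have "\<dots> \<le> 2 * ((F s)\<^sup>2 + (F t)\<^sup>2)"
        using zero_le_power2[of "F t + F s"] by (simp add: power2_eq_square algebra_simps)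
      finally have "h\<^sup>2 \<le> 8 * ((F s)\<^sup>2 + (F t)\<^sup>2)" by (simp add: power_divide)
      then show ?thesis using h(1) by (simp add: field_simps)
    qed
    \<comment> \<open>Working with the continuous version \<open>F\<close>, cut off to the unit interval, makes the estimate hold at every point, so that translations may be integrated directly.\<close>
    define P where "P y = indicator {0..1} y * (F y)\<^sup>2" for y
    have [measurable]: "P \<in> borel_measurable borel" unfolding P_def by measurable
    have Pf: "AE y in lborel. (f y)\<^sup>2 = P y"
      using frep by eventually_elim (auto simp: F_def P_def supp split: split_indicator)
    have iP: "integrable lborel P"
      using f2 by (rule integrable_cong_AE_imp) (use Pf in \<open>auto elim: eventually_mono\<close>)
    have mP: "(\<integral>y. P y \<partial>lborel) = m"
      unfolding m_def using integral_cong_AE[OF _ _ Pf] by simp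
    have shift: "integrable lborel (\<lambda>y. P (a + y))" "(\<integral>y. P (a + y) \<partial>lborel) = m" for a
      using lborel_integrable_real_affine[OF iP, of 1 a] lborel_integral_real_affine[of 1 P a] mP by auto
    have P0: "0 \<le> P y" for y by (simp add: P_def)
    have "measure lborel B = (\<integral>y. indicator B y \<partial>lborel)" by simp
    also have "\<dots> \<le> (\<integral>y. 8 / h\<^sup>2 * (P (0 + y) + P (h + y) + P (- h + y)) \<partial>lborel)"
    proof (rule integral_mono_AE)
      have "emeasure lborel B \<le> emeasure lborel {0..1::real}" by (intro emeasure_mono) (auto simp: B_def)
      then show "integrable lborel (indicat_real B)"
        by (intro integrable_real_indicator) (auto simp: less_top[symmetric] top_unique)
      show "AE y in lborel. indicator B y \<le> 8 / h\<^sup>2 * (P (0 + y) + P (h + y) + P (- h + y))"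
        using wW
      proof eventually_elim
        case (elim y)
        show ?case
        proof (cases "y \<in> B")
          case False then show ?thesis using P0 by (auto intro!: mult_nonneg_nonneg add_nonneg_nonneg)
        next
          case True
          then have y: "y \<in> {0..1}" "1 \<le> \<bar>W y\<bar>" using elim by (auto simp: B_def)
          have "1 \<le> 8 / h\<^sup>2 * (P y + P (h + y)) \<or> 1 \<le> 8 / h\<^sup>2 * (P y + P (- h + y))"
          proof (cases "y \<le> 1/2")
            case True then show ?thesis using inc[of y "y + h" y] y h by (auto simp: P_def add.commute)
          next
            case False then show ?thesis using inc[of "y - h" y y] y h by (auto simp: P_def add.commute)
          qed
          moreover have "8 / h\<^sup>2 * (P y + P (h + y)) \<le> 8 / h\<^sup>2 * (P (0 + y) + P (h + y) + P (- h + y))"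
            "8 / h\<^sup>2 * (P y + P (- h + y)) \<le> 8 / h\<^sup>2 * (P (0 + y) + P (h + y) + P (- h + y))"
            using P0[of "h + y"] P0[of "- h + y"] by (intro mult_left_mono; simp)+
          ultimately show ?thesis using True by simp linarith
        qed
      qed
    qed (intro integrable_mult_right Bochner_Integration.integrable_add shift)
    also have "\<dots> = 8 / h\<^sup>2 * ((\<integral>y. P (0 + y) \<partial>lborel) + (\<integral>y. P (h + y) \<partial>lborel) + (\<integral>y. P (- h + y) \<partial>lborel))"
      by (simp only: integral_mult_right_zero Bochner_Integration.integral_add Bochner_Integration.integrable_add shift(1))
    also have "\<dots> = 8 / h\<^sup>2 * (3 * m)" unfolding shift(2) by simp
    also have "\<dots> = 384 * m * K\<^sup>2" using False by (simp add: h_def power_divide power_mult_distrib)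
    finally show ?thesis .
  qed
  then show "measure lborel {y\<in>{0..1}. 1 \<le> \<bar>w y\<bar>} \<le> 384 * (\<integral>y. (f y)\<^sup>2 \<partial>lborel) * (\<integral>y. (q y)\<^sup>2 \<partial>lborel)\<^sup>2"
    by (simp add: B_def m_def K_def)
qed

section \<open>Integration over all lines\<close>

text \<open>Since \<open>\<beta> \<le> 1\<close>, the pointwise bound gives \<open>\<beta>\<^sup>2 \<le> 384 M K\<^sup>2\<close>, and the square root of this is linear
  in \<open>K\<close>. For the last claim put \<open>t = K / l\<close>: the elementary inequality \<open>3 \<le> 1 / t\<^sup>2 + 2 t\<close> linearises
  the dependence on \<open>K\<close> at the value \<open>l\<close>, which is the largest average of \<open>K\<close> per unit of \<open>\<beta>\<close> that the
  last hypothesis permits.\<close>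

lemma integrate_slices:
  fixes \<beta> m K :: "real \<Rightarrow> real"
  assumes int: "integrable lborel \<beta>" "integrable lborel m" "integrable lborel K"
    and bounds: "AE x in lborel. \<beta> x \<le> 1 \<and> \<beta> x \<le> K x \<and> \<beta> x \<le> 384 * m x * (K x)\<^sup>2 \<and> m x \<le> M"
    and nonneg: "\<And>x. 0 \<le> \<beta> x" "\<And>x. 0 \<le> m x" "\<And>x. 0 \<le> K x"
    and b: "0 < (\<integral>x. \<beta> x \<partial>lborel)"
    and K: "(\<integral>x. K x \<partial>lborel) \<le> l * (\<integral>x. \<beta> x \<partial>lborel)"
  shows "1 \<le> l" and "1 \<le> 384 * M * l\<^sup>2" and "(\<integral>x. \<beta> x \<partial>lborel) \<le> 384 * l\<^sup>2 * (\<integral>x. m x \<partial>lborel)"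
proof -
  let ?b = "\<integral>x. \<beta> x \<partial>lborel"
  have "?b \<le> (\<integral>x. K x \<partial>lborel)"
    using int bounds by (intro integral_mono_AE) (auto elim: eventually_mono)
  with K have "?b * 1 \<le> ?b * l" by (simp add: mult.commute)
  then show lam: "1 \<le> l" using b by (rule mult_left_le_imp_le)
  have M0: "0 \<le> M"
  proof (rule ccontr)
    assume "\<not> 0 \<le> M"
    have "AE x in lborel. \<beta> x = 0"
      using bounds
    proof eventually_elim
      case (elim x) then show ?case using nonneg(2)[of x] \<open>\<not> 0 \<le> M\<close> by linarith
    qed
    then have "?b = 0" by (rule integral_eq_zero_AE)
    then show False using b by simp
  qed
  have "?b \<le> (\<integral>x. sqrt (384 * M) * K x \<partial>lborel)"
  proof (rule integral_mono_AE)
    show "AE x in lborel. \<beta> x \<le> sqrt (384 * M) * K x"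
      using bounds
    proof eventually_elim
      case (elim x)
      have "(\<beta> x)\<^sup>2 \<le> \<beta> x" using elim nonneg(1)[of x] by (simp add: power2_eq_square mult_left_le)
      also have "\<dots> \<le> 384 * m x * (K x)\<^sup>2" using elim by simp
      also have "\<dots> \<le> 384 * M * (K x)\<^sup>2" using elim by (intro mult_right_mono) auto
      also have "\<dots> = (sqrt (384 * M) * K x)\<^sup>2" using M0 by (simp add: power_mult_distrib)
      finally show ?case using nonneg(3)[of x] M0 by (intro power2_le_imp_le[of "\<beta> x"]) auto
    qed
  qed (use int in auto)
  also have "\<dots> \<le> sqrt (384 * M) * (l * ?b)" using K M0 by (simp add: mult_left_mono)
  finally have "?b * 1 \<le> ?b * (sqrt (384 * M) * l)" by (simp add: mult_ac)
  then have "1 \<le> sqrt (384 * M) * l" using b by (rule mult_left_le_imp_le)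
  then have "1\<^sup>2 \<le> (sqrt (384 * M) * l)\<^sup>2" by (intro power_mono) auto
  then show "1 \<le> 384 * M * l\<^sup>2" using M0 by (simp add: power_mult_distrib)
  have "(\<integral>x. 3 * \<beta> x \<partial>lborel) \<le> (\<integral>x. 384 * l\<^sup>2 * m x + 2 / l * K x \<partial>lborel)"
  proof (rule integral_mono_AE)
    show "AE x in lborel. 3 * \<beta> x \<le> 384 * l\<^sup>2 * m x + 2 / l * K x"
      using bounds
    proof eventually_elim
      case (elim x)
      define t where "t = K x / l"
      show ?case
      proof (cases "K x = 0")
        case True
        then have "\<beta> x = 0" using elim nonneg(1)[of x] by linarith
        then show ?thesis using nonneg(2)[of x] True by simp
      next
        case False
        then have t: "t > 0" using lam nonneg(3)[of x] by (simp add: t_def less_le)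
        have Kt: "K x = l * t" using lam by (simp add: t_def)
        have "\<beta> x / t\<^sup>2 \<le> 384 * l\<^sup>2 * m x"
          using elim t by (simp add: Kt power_mult_distrib divide_le_eq mult_ac)
        moreover have "\<beta> x * t \<le> t" using elim t by simp
        moreover have "3 \<le> 1 / t\<^sup>2 + 2 * t"
        proof -
          have "0 \<le> (t - 1)\<^sup>2 * (2 * t + 1)" using t by simp
          also have "\<dots> = 1 + 2 * t ^ 3 - 3 * t\<^sup>2" by (simp add: power2_eq_square power3_eq_cube algebra_simps)
          finally have "3 * t\<^sup>2 \<le> 1 + 2 * t ^ 3" by simp
          also have "\<dots> = (1 / t\<^sup>2 + 2 * t) * t\<^sup>2"
            using t by (simp add: distrib_right power2_eq_square power3_eq_cube)
          finally have "3 * t\<^sup>2 \<le> (1 / t\<^sup>2 + 2 * t) * t\<^sup>2" .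
          then show ?thesis using t by (intro mult_right_le_imp_le[of 3 "t\<^sup>2"]) auto
        qed
        then have "\<beta> x * 3 \<le> \<beta> x * (1 / t\<^sup>2 + 2 * t)" using nonneg(1) by (rule mult_left_mono)
        moreover have "2 / l * K x = 2 * t" by (simp add: t_def)
        ultimately show ?thesis by (simp add: distrib_left)
      qed
    qed
  qed (use int in auto)
  also have "\<dots> = 384 * l\<^sup>2 * (\<integral>x. m x \<partial>lborel) + 2 / l * (\<integral>x. K x \<partial>lborel)" using int by simp
  also have "2 / l * (\<integral>x. K x \<partial>lborel) \<le> 2 / l * (l * ?b)" using K lam by (intro mult_left_mono) auto
  also have "2 / l * (l * ?b) = 2 * ?b" using lam by simp
  finally show "?b \<le> 384 * l\<^sup>2 * (\<integral>x. m x \<partial>lborel)" using int by simp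
qed

section \<open>Approximation by smooth functions\<close>

lemma square_sum_le: "(a + b)\<^sup>2 \<le> 2 * a\<^sup>2 + 2 * (b::real)\<^sup>2"
  using zero_le_power2[of "a - b"] by (simp add: power2_eq_square algebra_simps)

lemma Fubini_lborel:
  fixes H :: "real \<times> real \<Rightarrow> real"
  assumes "integrable lborel H"
  shows "AE x in lborel. integrable lborel (\<lambda>y. H (x, y))"
    and "integrable lborel (\<lambda>x. \<integral>y. H (x, y) \<partial>lborel)"
    and "(\<integral>x. (\<integral>y. H (x, y) \<partial>lborel) \<partial>lborel) = (\<integral>z. H z \<partial>lborel)"
    and "integrable lborel (\<lambda>y. \<integral>x. H (x, y) \<partial>lborel)"
    and "(\<integral>y. (\<integral>x. H (x, y) \<partial>lborel) \<partial>lborel) = (\<integral>z. H z \<partial>lborel)"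
proof -
  have *: "integrable (lborel \<Otimes>\<^sub>M lborel) (\<lambda>(x, y). H (x, y))" using assms by (simp add: lborel_prod)
  show "AE x in lborel. integrable lborel (\<lambda>y. H (x, y))"
    using lborel_pair.AE_integrable_fst[OF *] .
  show "integrable lborel (\<lambda>x. \<integral>y. H (x, y) \<partial>lborel)" using lborel_pair.integrable_fst[OF *] .
  show "(\<integral>x. (\<integral>y. H (x, y) \<partial>lborel) \<partial>lborel) = (\<integral>z. H z \<partial>lborel)"
    using lborel_pair.integral_fst[OF *] by (simp add: lborel_prod)
  show "integrable lborel (\<lambda>y. \<integral>x. H (x, y) \<partial>lborel)" using lborel_pair.integrable_snd[OF *] .
  show "(\<integral>y. (\<integral>x. H (x, y) \<partial>lborel) \<partial>lborel) = (\<integral>z. H z \<partial>lborel)"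
    using lborel_pair.integral_snd[OF *] by (simp add: lborel_prod)
qed

lemma compact_Omega: "compact (Omega L)"
  unfolding Omega_def by (intro compact_Times) auto

lemma Omega_borel [measurable]: "Omega L \<in> sets borel"
  using compact_Omega by (intro borel_closed compact_imp_closed)

lemma integrable_indicator_compact:
  fixes \<phi> :: "'a::euclidean_space \<Rightarrow> real"
  assumes "continuous_on UNIV \<phi>" "compact S"
  shows "integrable lborel (\<lambda>z. indicator S z * \<phi> z)"
  using borel_integrable_compact[OF assms(2) continuous_on_subset[OF assms(1)]] by simp

lemma integrable_square_diff:
  fixes u v :: "'a::euclidean_space \<Rightarrow> real"
  assumes [measurable]: "u \<in> borel_measurable borel" "v \<in> borel_measurable borel"
    and "integrable lborel (\<lambda>z. (u z)\<^sup>2)" "integrable lborel (\<lambda>z. (v z)\<^sup>2)"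
  shows "integrable lborel (\<lambda>z. (u z - v z)\<^sup>2)"
proof (rule Bochner_Integration.integrable_bound)
  show "integrable lborel (\<lambda>z. 2 * (u z)\<^sup>2 + 2 * (v z)\<^sup>2)" using assms by auto
  show "AE z in lborel. norm ((u z - v z)\<^sup>2) \<le> norm (2 * (u z)\<^sup>2 + 2 * (v z)\<^sup>2)"
    using square_sum_le[of "u _" "- v _"] by (intro AE_I2) simp
qed simp

lemma integrable_indicator_square_diff:
  fixes \<phi> v :: "'a::euclidean_space \<Rightarrow> real"
  assumes \<phi>: "continuous_on UNIV \<phi>" and S: "compact S"
    and [measurable]: "v \<in> borel_measurable borel" and v2: "integrable lborel (\<lambda>z. (v z)\<^sup>2)"
    and supp: "\<And>z. z \<notin> S \<Longrightarrow> v z = 0"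
  shows "integrable lborel (\<lambda>z. indicator S z * (\<phi> z - v z)\<^sup>2)"
proof -
  have [measurable]: "\<phi> \<in> borel_measurable borel" using \<phi> by (rule borel_measurable_continuous_onI)
  have [measurable]: "S \<in> sets borel" using S by (intro borel_closed compact_imp_closed)
  have "integrable lborel (\<lambda>z. indicator S z * (\<phi> z)\<^sup>2)"
    by (rule integrable_indicator_compact[OF _ S]) (intro continuous_intros \<phi>)
  also have "(\<lambda>z. indicator S z * (\<phi> z)\<^sup>2) = (\<lambda>z. (indicator S z * \<phi> z)\<^sup>2)"
    by (auto simp: fun_eq_iff split: split_indicator)
  finally have "integrable lborel (\<lambda>z. (indicator S z * \<phi> z - v z)\<^sup>2)"
    using v2 by (intro integrable_square_diff) auto
  also have "(\<lambda>z. (indicator S z * \<phi> z - v z)\<^sup>2) = (\<lambda>z. indicator S z * (\<phi> z - v z)\<^sup>2)"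
    using supp by (auto simp: fun_eq_iff split: split_indicator)
  finally show ?thesis .
qed

lemma smooth_continuous: "smooth \<phi> \<Longrightarrow> continuous_on UNIV \<phi>"
  using C_k_continuous by (auto simp: smooth_def)

lemma smooth_pderiv_continuous: "smooth \<phi> \<Longrightarrow> b \<in> Basis \<Longrightarrow> continuous_on UNIV (pderiv_at b \<phi>)"
  unfolding smooth_def by (metis C_k.simps(2) C_k_continuous)

lemma smooth_line_derivs:
  fixes \<phi> :: "real \<times> real \<Rightarrow> real"
  assumes "smooth \<phi>"
  shows "((\<lambda>t. \<phi> (t, y)) has_real_derivative pderiv_at ex \<phi> (x, y)) (at x)"
    and "((\<lambda>t. \<phi> (x, t)) has_real_derivative pderiv_at ey \<phi> (x, y)) (at y)"
proof -
  have "\<phi> differentiable (at (x, y))" using assms by (auto simp: smooth_def dest!: spec[of _ "Suc 0"])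
  then have D: "(\<phi> has_derivative frechet_derivative \<phi> (at (x, y))) (at (x, y))"
    by (simp add: frechet_derivative_works[symmetric])
  then have lin: "linear (frechet_derivative \<phi> (at (x, y)))"
    using has_derivative_linear by blast
  have 1: "((\<lambda>t. (t, y)) has_derivative (\<lambda>h. (h, 0))) (at x)"
    by (auto intro!: derivative_eq_intros)
  have 2: "((\<lambda>t. (x, t)) has_derivative (\<lambda>h. (0, h))) (at y)"
    by (auto intro!: derivative_eq_intros)
  have "(\<lambda>h. frechet_derivative \<phi> (at (x, y)) (h, 0)) = (*) (pderiv_at ex \<phi> (x, y))"
  proof
    fix h show "frechet_derivative \<phi> (at (x, y)) (h, 0) = pderiv_at ex \<phi> (x, y) * h"
      using linear_scale[OF lin, of h "(1, 0)"] by (simp add: mult.commute)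
  qed
  then show "((\<lambda>t. \<phi> (t, y)) has_real_derivative pderiv_at ex \<phi> (x, y)) (at x)"
    using has_derivative_compose[OF 1 D] by (simp only: has_field_derivative_def)
  have "(\<lambda>h. frechet_derivative \<phi> (at (x, y)) (0, h)) = (*) (pderiv_at ey \<phi> (x, y))"
  proof
    fix h show "frechet_derivative \<phi> (at (x, y)) (0, h) = pderiv_at ey \<phi> (x, y) * h"
      using linear_scale[OF lin, of h "(0, 1)"] by (simp add: mult.commute)
  qed
  then show "((\<lambda>t. \<phi> (x, t)) has_real_derivative pderiv_at ey \<phi> (x, y)) (at y)"
    using has_derivative_compose[OF 2 D] by (simp only: has_field_derivative_def)
qed

lemma Basis_real_prod: "(Basis :: (real \<times> real) set) = {ex, ey}"
  by (auto simp: Basis_prod_def)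

section \<open>Consequences of the boundary conditions\<close>

text \<open>The fundamental theorem of calculus along horizontal lines, followed by Cauchy-Schwarz.\<close>

lemma smooth_slice_bound:
  fixes \<phi> :: "real \<times> real \<Rightarrow> real"
  assumes sm: "smooth \<phi>" and xs: "x \<in> {0..L}" "s \<in> {0..L}"
  shows "(\<integral>y. indicator {0..1} y * (\<phi> (x, y))\<^sup>2 \<partial>lborel) \<le>
    2 * (\<integral>y. indicator {0..1} y * (\<phi> (s, y))\<^sup>2 \<partial>lborel) +
    2 * \<bar>x - s\<bar> * (\<integral>z. indicator (Omega L) z * (pderiv_at ex \<phi> z)\<^sup>2 \<partial>lborel)"
proof -
  define \<psi> where "\<psi> = pderiv_at ex \<phi>"
  have c\<phi>: "continuous_on UNIV \<phi>" using sm by (rule smooth_continuous)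
  have c\<psi>: "continuous_on UNIV \<psi>" unfolding \<psi>_def by (rule smooth_pderiv_continuous[OF sm]) (simp add: Basis_real_prod)
  define k where "k y = (\<integral>t. indicator {0..L} t * (\<psi> (t, y))\<^sup>2 \<partial>lborel)" for y
  have pt: "(\<phi> (x, y))\<^sup>2 \<le> 2 * (\<phi> (s, y))\<^sup>2 + 2 * (\<bar>x - s\<bar> * k y)" for y
  proof -
    have cl: "continuous_on A (\<lambda>t. \<psi> (t, y))" for A
      by (rule continuous_on_compose2[OF c\<psi>]) (auto intro!: continuous_intros)
    have i1: "integrable lborel (\<lambda>t. indicator {0..L} t * \<psi> (t, y))"
      by (rule integrable_indicator_compact[OF cl]) auto
    have "integrable lborel (\<lambda>t. indicator {0..L} t * (\<psi> (t, y))\<^sup>2)"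
      by (rule integrable_indicator_compact) (auto intro!: continuous_intros cl)
    moreover have sq: "(\<lambda>t. indicator {0..L} t * (\<psi> (t, y))\<^sup>2) = (\<lambda>t. (indicator {0..L} t * \<psi> (t, y))\<^sup>2)"
      by (auto simp: fun_eq_iff split: split_indicator)
    ultimately have i2: "integrable lborel (\<lambda>t. (indicator {0..L} t * \<psi> (t, y))\<^sup>2)" by simp
    have diff: "(\<phi> (b, y) - \<phi> (a, y))\<^sup>2 \<le> (b - a) * k y" if "a \<le> b" "0 \<le> a" "b \<le> L" for a b
    proof -
      have "(\<integral>t. indicator {a..b} t *\<^sub>R \<psi> (t, y) \<partial>lborel) = \<phi> (b, y) - \<phi> (a, y)"
        using smooth_line_derivs(1)[OF sm] \<open>a \<le> b\<close> cl unfolding \<psi>_def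
        by (intro integral_FTC_atLeastAtMost)
           (auto simp: has_real_derivative_iff_has_vector_derivative intro: has_vector_derivative_at_within)
      moreover have "(\<lambda>t. indicator {a..b} t *\<^sub>R \<psi> (t, y)) = (\<lambda>t. indicator {0..L} t * \<psi> (t, y) * indicator {a..b} t)"
        using that by (auto simp: fun_eq_iff split: split_indicator)
      ultimately show ?thesis
        using Cauchy_Schwarz_interval[OF i1 i2 \<open>a \<le> b\<close>] by (simp add: k_def sq)
    qed
    have "(\<phi> (x, y) - \<phi> (s, y))\<^sup>2 \<le> \<bar>x - s\<bar> * k y"
      using diff[of s x] diff[of x s] xs by (cases "s \<le> x") (auto simp: power2_commute)
    then show ?thesis using square_sum_le[of "\<phi> (s, y)" "\<phi> (x, y) - \<phi> (s, y)"] by simp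
  qed
  have iQ: "integrable lborel (\<lambda>z. indicator (Omega L) z * (\<psi> z)\<^sup>2)"
    by (rule integrable_indicator_compact[OF _ compact_Omega]) (intro continuous_intros c\<psi>)
  have ind: "indicator (Omega L) (t, y) = indicator {0..L} t * (indicator {0..1} y :: real)" for t y
    by (auto simp: Omega_def split: split_indicator)
  have kQ: "(\<integral>t. indicator (Omega L) (t, y) * (\<psi> (t, y))\<^sup>2 \<partial>lborel) = indicator {0..1} y * k y" for y
    unfolding k_def ind by (subst integral_mult_right_zero[symmetric]) (simp add: mult_ac)
  have ik: "integrable lborel (\<lambda>y. indicator {0..1} y * k y)"
    and Q: "(\<integral>y. indicator {0..1} y * k y \<partial>lborel) = (\<integral>z. indicator (Omega L) z * (\<psi> z)\<^sup>2 \<partial>lborel)"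
    using Fubini_lborel(4,5)[OF iQ] unfolding kQ by auto
  have im: "integrable lborel (\<lambda>y. indicator {0..1} y * (\<phi> (a, y))\<^sup>2)" for a
    by (rule integrable_indicator_compact)
       (auto intro!: continuous_intros continuous_on_compose2[OF c\<phi>])
  have a1: "integrable lborel (\<lambda>y. 2 * (indicator {0..1} y * (\<phi> (s, y))\<^sup>2))"
    using im by (rule integrable_mult_right)
  have a2: "integrable lborel (\<lambda>y. 2 * \<bar>x - s\<bar> * (indicator {0..1} y * k y))"
    using ik by (rule integrable_mult_right)
  have "(\<integral>y. indicator {0..1} y * (\<phi> (x, y))\<^sup>2 \<partial>lborel)
     \<le> (\<integral>y. 2 * (indicator {0..1} y * (\<phi> (s, y))\<^sup>2) + 2 * \<bar>x - s\<bar> * (indicator {0..1} y * k y) \<partial>lborel)"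
  proof (rule integral_mono_AE[OF im Bochner_Integration.integrable_add[OF a1 a2]], rule AE_I2)
    fix y
    show "indicator {0..1} y * (\<phi> (x, y))\<^sup>2 \<le>
       2 * (indicator {0..1} y * (\<phi> (s, y))\<^sup>2) + 2 * \<bar>x - s\<bar> * (indicator {0..1} y * k y)"
      using pt[of y] by (cases "y \<in> {0..1}") (simp_all add: mult.assoc)
  qed
  also have "\<dots> = (\<integral>y. 2 * (indicator {0..1} y * (\<phi> (s, y))\<^sup>2) \<partial>lborel) + (\<integral>y. 2 * \<bar>x - s\<bar> * (indicator {0..1} y * k y) \<partial>lborel)"
    by (rule Bochner_Integration.integral_add[OF a1 a2])
  also have "\<dots> = 2 * (\<integral>y. indicator {0..1} y * (\<phi> (s, y))\<^sup>2 \<partial>lborel) + 2 * \<bar>x - s\<bar> * (\<integral>y. indicator {0..1} y * k y \<partial>lborel)"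
    by (simp only: integral_mult_right_zero)
  finally show ?thesis unfolding Q \<psi>_def .
qed

text \<open>Integrating in \<open>x\<close> the excess of the slice norm over the limiting bound, the \<open>L\<^sup>2\<close>
  approximation shows that this nonnegative function has integral zero. The factor \<open>2\<close> comes from
  \<open>(a + b)\<^sup>2 \<le> 2 a\<^sup>2 + 2 b\<^sup>2\<close>.\<close>

lemma AE_slice_norm_le:
  fixes v :: "real \<times> real \<Rightarrow> real" and \<phi> :: "nat \<Rightarrow> real \<times> real \<Rightarrow> real"
  assumes v[measurable]: "v \<in> borel_measurable borel" and v2: "integrable lborel (\<lambda>z. (v z)\<^sup>2)"
    and supp: "\<And>z. z \<notin> Omega L \<Longrightarrow> v z = 0" and L: "0 < L"
    and \<phi>: "\<And>n. continuous_on UNIV (\<phi> n)"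
    and lim: "(\<lambda>n. \<integral>z. indicator (Omega L) z * (\<phi> n z - v z)\<^sup>2 \<partial>lborel) \<longlonglongrightarrow> 0"
    and bound: "\<And>n x. x \<in> {0..L} \<Longrightarrow> (\<integral>y. indicator {0..1} y * (\<phi> n (x, y))\<^sup>2 \<partial>lborel) \<le> R n"
    and R: "R \<longlonglongrightarrow> R0" and R0: "0 \<le> R0"
  shows "AE x in lborel. (\<integral>y. (v (x, y))\<^sup>2 \<partial>lborel) \<le> 2 * R0"
proof -
  define m where "m x = (\<integral>y. (v (x, y))\<^sup>2 \<partial>lborel)" for x
  define d where "d n x = (\<integral>y. indicator (Omega L) (x, y) * (\<phi> n (x, y) - v (x, y))\<^sup>2 \<partial>lborel)" for n x
  have ii: "integrable lborel (\<lambda>z. indicator (Omega L) z * (\<phi> n z - v z)\<^sup>2)" for n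
    by (rule integrable_indicator_square_diff[OF \<phi> compact_Omega v v2 supp])
  have m: "integrable lborel m" unfolding m_def using Fubini_lborel(2)[OF v2] .
  have d: "integrable lborel (d n)" "(\<integral>x. d n x \<partial>lborel) = (\<integral>z. indicator (Omega L) z * (\<phi> n z - v z)\<^sup>2 \<partial>lborel)" for n
    unfolding d_def using Fubini_lborel(2,3)[OF ii] by auto
  have d0: "0 \<le> d n x" for n x unfolding d_def by (intro Bochner_Integration.integral_nonneg) auto
  have aux: "a \<le> 2 * r + 2 * e \<Longrightarrow> a - 2 * r0 \<le> 2 * \<bar>r - r0\<bar> + 2 * e" for a r e r0 :: real
    using abs_ge_self[of "r - r0"] by argo
  have iL: "integrable lborel (indicat_real {0..L})"
    by (intro integrable_real_indicator) (auto simp: emeasure_lborel_Icc_eq)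
  have le: "(\<integral>x. max 0 (m x - 2 * R0) \<partial>lborel) \<le> 2 * \<bar>R n - R0\<bar> * L + 2 * (\<integral>z. indicator (Omega L) z * (\<phi> n z - v z)\<^sup>2 \<partial>lborel)" for n
  proof -
    have "(\<integral>x. max 0 (m x - 2 * R0) \<partial>lborel) \<le> (\<integral>x. 2 * \<bar>R n - R0\<bar> * indicator {0..L} x + 2 * d n x \<partial>lborel)"
    proof (rule integral_mono_AE')
      show "integrable lborel (\<lambda>x. 2 * \<bar>R n - R0\<bar> * indicator {0..L} x + 2 * d n x)"
        using iL d by (intro Bochner_Integration.integrable_add integrable_mult_right)
      show "AE x in lborel. max 0 (m x - 2 * R0) \<le> 2 * \<bar>R n - R0\<bar> * indicator {0..L} x + 2 * d n x"
        using Fubini_lborel(1)[OF v2] Fubini_lborel(1)[OF ii[of n]]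
      proof eventually_elim
        case (elim x)
        show ?case
        proof (cases "x \<in> {0..L}")
          case False
          then have "v (x, y) = 0" for y using supp[of "(x, y)"] by (auto simp: Omega_def)
          then show ?thesis using R0 d0[of n x] False by (simp add: m_def)
        next
          case True
          have i: "integrable lborel (\<lambda>y. indicator {0..1} y * (\<phi> n (x, y))\<^sup>2)"
            by (rule integrable_indicator_compact)
               (auto intro!: continuous_intros continuous_on_compose2[OF \<phi>])
          have a1: "integrable lborel (\<lambda>y. 2 * (indicator {0..1} y * (\<phi> n (x, y))\<^sup>2))"
            using i by (rule integrable_mult_right)
          have a2: "integrable lborel (\<lambda>y. 2 * (indicator (Omega L) (x, y) * (\<phi> n (x, y) - v (x, y))\<^sup>2))"
            using elim(2) by (rule integrable_mult_right)
          have "m x \<le> (\<integral>y. 2 * (indicator {0..1} y * (\<phi> n (x, y))\<^sup>2) + 2 * (indicator (Omega L) (x, y) * (\<phi> n (x, y) - v (x, y))\<^sup>2) \<partial>lborel)"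
            unfolding m_def
          proof (rule integral_mono_AE[OF elim(1) Bochner_Integration.integrable_add[OF a1 a2]], rule AE_I2)
            fix y
            show "(v (x, y))\<^sup>2 \<le> 2 * (indicator {0..1} y * (\<phi> n (x, y))\<^sup>2) + 2 * (indicator (Omega L) (x, y) * (\<phi> n (x, y) - v (x, y))\<^sup>2)"
              using square_sum_le[of "\<phi> n (x, y)" "v (x, y) - \<phi> n (x, y)"] supp[of "(x, y)"] True
              by (cases "y \<in> {0..1}") (simp_all add: Omega_def power2_commute[of "v (x, y)"])
          qed
          also have "\<dots> = (\<integral>y. 2 * (indicator {0..1} y * (\<phi> n (x, y))\<^sup>2) \<partial>lborel) + (\<integral>y. 2 * (indicator (Omega L) (x, y) * (\<phi> n (x, y) - v (x, y))\<^sup>2) \<partial>lborel)"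
            by (rule Bochner_Integration.integral_add[OF a1 a2])
          also have "\<dots> = 2 * (\<integral>y. indicator {0..1} y * (\<phi> n (x, y))\<^sup>2 \<partial>lborel) + 2 * d n x"
            by (simp only: integral_mult_right_zero d_def)
          also have "\<dots> \<le> 2 * R n + 2 * d n x" using bound[OF True, of n] by simp
          finally have "m x - 2 * R0 \<le> 2 * \<bar>R n - R0\<bar> + 2 * d n x"
            by (rule aux)
          then show ?thesis using True d0[of n x] by simp
        qed
      qed
      show "AE x in lborel. 0 \<le> 2 * \<bar>R n - R0\<bar> * indicator {0..L} x + 2 * d n x"
        using d0 by (intro AE_I2 add_nonneg_nonneg mult_nonneg_nonneg) auto
    qed
    also have "\<dots> = 2 * \<bar>R n - R0\<bar> * L + 2 * (\<integral>x. d n x \<partial>lborel)"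
      using iL d(1) L by simp
    finally show ?thesis using d(2) by simp
  qed
  have "(\<lambda>n. 2 * \<bar>R n - R0\<bar> * L + 2 * (\<integral>z. indicator (Omega L) z * (\<phi> n z - v z)\<^sup>2 \<partial>lborel)) \<longlonglongrightarrow> 2 * \<bar>R0 - R0\<bar> * L + 2 * 0"
    by (intro tendsto_intros R lim)
  then have "(\<integral>x. max 0 (m x - 2 * R0) \<partial>lborel) \<le> 0"
    using le by (intro LIMSEQ_le_const[of _ 0]) auto
  moreover have "integrable lborel (\<lambda>x. max 0 (m x - 2 * R0))"
  proof (rule Bochner_Integration.integrable_bound[OF m])
    show "AE x in lborel. norm (max 0 (m x - 2 * R0)) \<le> norm (m x)" using R0 by (intro AE_I2) auto
  qed (use m in auto)
  ultimately have "AE x in lborel. max 0 (m x - 2 * R0) = 0"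
    by (subst integral_nonneg_eq_0_iff_AE[symmetric]) (auto intro!: antisym Bochner_Integration.integral_nonneg)
  then show ?thesis by eventually_elim (simp add: m_def max_def split: if_splits)
qed

lemma integral_square_le_approx:
  fixes \<phi> v :: "'a::euclidean_space \<Rightarrow> real"
  assumes \<phi>: "continuous_on UNIV \<phi>" and S: "compact S"
    and v: "v \<in> borel_measurable borel" and v2: "integrable lborel (\<lambda>z. (v z)\<^sup>2)"
    and supp: "\<And>z. z \<notin> S \<Longrightarrow> v z = 0"
  shows "(\<integral>z. indicator S z * (\<phi> z)\<^sup>2 \<partial>lborel) \<le>
    2 * (\<integral>z. (v z)\<^sup>2 \<partial>lborel) + 2 * (\<integral>z. indicator S z * (\<phi> z - v z)\<^sup>2 \<partial>lborel)"
proof -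
  note d = integrable_indicator_square_diff[OF assms]
  have a1: "integrable lborel (\<lambda>z. 2 * (v z)\<^sup>2)" using v2 by (rule integrable_mult_right)
  have a2: "integrable lborel (\<lambda>z. 2 * (indicator S z * (\<phi> z - v z)\<^sup>2))" using d by (rule integrable_mult_right)
  have i: "integrable lborel (\<lambda>z. indicator S z * (\<phi> z)\<^sup>2)"
    by (rule integrable_indicator_compact[OF _ S]) (intro continuous_intros \<phi>)
  have "(\<integral>z. indicator S z * (\<phi> z)\<^sup>2 \<partial>lborel) \<le> (\<integral>z. 2 * (v z)\<^sup>2 + 2 * (indicator S z * (\<phi> z - v z)\<^sup>2) \<partial>lborel)"
  proof (rule integral_mono_AE[OF i Bochner_Integration.integrable_add[OF a1 a2]], rule AE_I2)
    fix z
    show "indicator S z * (\<phi> z)\<^sup>2 \<le> 2 * (v z)\<^sup>2 + 2 * (indicator S z * (\<phi> z - v z)\<^sup>2)"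
      using square_sum_le[of "v z" "\<phi> z - v z"] by (cases "z \<in> S") simp_all
  qed
  also have "\<dots> = (\<integral>z. 2 * (v z)\<^sup>2 \<partial>lborel) + (\<integral>z. 2 * (indicator S z * (\<phi> z - v z)\<^sup>2) \<partial>lborel)"
    by (rule Bochner_Integration.integral_add[OF a1 a2])
  finally show ?thesis by (simp only: integral_mult_right_zero)
qed

text \<open>Two ways to bound the \<open>L\<^sup>2\<close> norm of \<open>v\<close> on a vertical line through \<open>v\<^sub>x\<close>: compare the line with the
  left edge, where \<open>v\<close> vanishes, or with the average over a strip of width \<open>h\<close> that contains it. Both are
  proved for the smooth approximations \<open>\<phi>\<close> of \<open>v\<close>.\<close>

lemma trace_slice_bounds:
  fixes v p :: "real \<times> real \<Rightarrow> real" and \<phi> :: "nat \<Rightarrow> real \<times> real \<Rightarrow> real"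
  assumes L: "0 < L" and sm: "\<And>n. smooth (\<phi> n)"
    and v: "v \<in> borel_measurable borel" "integrable lborel (\<lambda>z. (v z)\<^sup>2)" "\<And>z. z \<notin> Omega L \<Longrightarrow> v z = 0"
    and p: "p \<in> borel_measurable borel" "integrable lborel (\<lambda>z. (p z)\<^sup>2)" "\<And>z. z \<notin> Omega L \<Longrightarrow> p z = 0"
    and lim_v: "(\<lambda>n. \<integral>z. indicator (Omega L) z * (\<phi> n z - v z)\<^sup>2 \<partial>lborel) \<longlonglongrightarrow> 0"
    and lim_p: "(\<lambda>n. \<integral>z. indicator (Omega L) z * (pderiv_at ex (\<phi> n) z - p z)\<^sup>2 \<partial>lborel) \<longlonglongrightarrow> 0"
    and lim_0: "(\<lambda>n. \<integral>y. indicator {0..1} y * (\<phi> n (0, y))\<^sup>2 \<partial>lborel) \<longlonglongrightarrow> 0"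
  shows "AE x in lborel. (\<integral>y. (v (x, y))\<^sup>2 \<partial>lborel) \<le> 8 * L * (\<integral>z. (p z)\<^sup>2 \<partial>lborel)"
    and "\<And>h. 0 < h \<Longrightarrow> h \<le> L \<Longrightarrow> AE x in lborel. (\<integral>y. (v (x, y))\<^sup>2 \<partial>lborel) \<le>
      8 / h * (\<integral>z. (v z)\<^sup>2 \<partial>lborel) + 8 * h * (\<integral>z. (p z)\<^sup>2 \<partial>lborel)"
proof -
  define V where "V = (\<integral>z. (v z)\<^sup>2 \<partial>lborel)"
  define P where "P = (\<integral>z. (p z)\<^sup>2 \<partial>lborel)"
  define e where "e n = (\<integral>z. indicator (Omega L) z * (\<phi> n z - v z)\<^sup>2 \<partial>lborel)" for n
  define e' where "e' n = (\<integral>z. indicator (Omega L) z * (pderiv_at ex (\<phi> n) z - p z)\<^sup>2 \<partial>lborel)" for n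
  define t where "t n = (\<integral>y. indicator {0..1} y * (\<phi> n (0, y))\<^sup>2 \<partial>lborel)" for n
  define \<Phi> where "\<Phi> n = (\<integral>z. indicator (Omega L) z * (\<phi> n z)\<^sup>2 \<partial>lborel)" for n
  define Q where "Q n = (\<integral>z. indicator (Omega L) z * (pderiv_at ex (\<phi> n) z)\<^sup>2 \<partial>lborel)" for n
  define m where "m n x = (\<integral>y. indicator {0..1} y * (\<phi> n (x, y))\<^sup>2 \<partial>lborel)" for n x
  note c = smooth_continuous[OF sm]
  have V0: "0 \<le> V" "0 \<le> P" unfolding V_def P_def by auto
  have Q0: "0 \<le> Q n" for n unfolding Q_def by (intro Bochner_Integration.integral_nonneg) auto
  have \<Phi>V: "\<Phi> n \<le> 2 * V + 2 * e n" for n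
    unfolding \<Phi>_def V_def e_def by (rule integral_square_le_approx[OF c compact_Omega v])
  have QP: "Q n \<le> 2 * P + 2 * e' n" for n
    unfolding Q_def P_def e'_def
    by (rule integral_square_le_approx[OF smooth_pderiv_continuous[OF sm] compact_Omega p]) (simp add: Basis_real_prod)
  have base: "m n x \<le> 2 * m n s + 2 * \<bar>x - s\<bar> * Q n" if "x \<in> {0..L}" "s \<in> {0..L}" for n x s
    unfolding m_def Q_def by (rule smooth_slice_bound[OF sm that])
  have limits: "e \<longlonglongrightarrow> 0" "e' \<longlonglongrightarrow> 0" "t \<longlonglongrightarrow> 0"
    using lim_v lim_p lim_0 unfolding e_def e'_def t_def by auto
  have "AE x in lborel. (\<integral>y. (v (x, y))\<^sup>2 \<partial>lborel) \<le> 2 * (4 * L * P)"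
  proof (rule AE_slice_norm_le[OF v L c lim_v])
    fix n x assume x: "x \<in> {0..L}"
    have "m n x \<le> 2 * t n + 2 * \<bar>x\<bar> * Q n" using base[OF x, of 0 n] L by (simp add: t_def m_def)
    also have "\<dots> \<le> 2 * t n + 2 * L * (2 * P + 2 * e' n)"
      using x QP[of n] Q0[of n] by (intro add_left_mono mult_mono) auto
    finally show "(\<integral>y. indicator {0..1} y * (\<phi> n (x, y))\<^sup>2 \<partial>lborel) \<le> 2 * t n + 2 * L * (2 * P + 2 * e' n)"
      by (simp add: m_def)
  next
    have "(\<lambda>n. 2 * t n + 2 * L * (2 * P + 2 * e' n)) \<longlonglongrightarrow> 2 * 0 + 2 * L * (2 * P + 2 * 0)"
      by (intro tendsto_intros limits)
    then show "(\<lambda>n. 2 * t n + 2 * L * (2 * P + 2 * e' n)) \<longlonglongrightarrow> 4 * L * P" by (simp add: mult.assoc)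
  qed (use L V0 in auto)
  then show "AE x in lborel. (\<integral>y. (v (x, y))\<^sup>2 \<partial>lborel) \<le> 8 * L * (\<integral>z. (p z)\<^sup>2 \<partial>lborel)"
    by (simp add: P_def mult.assoc)
  fix h assume h: "0 < h" "h \<le> L"
  have "AE x in lborel. (\<integral>y. (v (x, y))\<^sup>2 \<partial>lborel) \<le> 2 * (4 / h * V + 4 * h * P)"
  proof (rule AE_slice_norm_le[OF v L c lim_v])
    fix n x assume x: "x \<in> {0..L}"
    have iO: "integrable lborel (\<lambda>z. indicator (Omega L) z * (\<phi> n z)\<^sup>2)"
      by (rule integrable_indicator_compact[OF _ compact_Omega]) (intro continuous_intros c)
    have ind: "indicator (Omega L) (s, y) = indicator {0..L} s * (indicator {0..1} y :: real)" for s y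
      by (auto simp: Omega_def split: split_indicator)
    have slice: "(\<integral>y. indicator (Omega L) (s, y) * (\<phi> n (s, y))\<^sup>2 \<partial>lborel) = indicator {0..L} s * m n s" for s
      unfolding m_def ind by (simp only: mult.assoc integral_mult_right_zero)
    have im: "integrable lborel (\<lambda>s. indicator {0..L} s * m n s)"
      and \<Phi>m: "(\<integral>s. indicator {0..L} s * m n s \<partial>lborel) = \<Phi> n"
      using Fubini_lborel(2,3)[OF iO] unfolding slice \<Phi>_def by auto
    have m0: "0 \<le> m n s" for s unfolding m_def by (intro Bochner_Integration.integral_nonneg) auto
    \<comment> \<open>A strip of width \<open>h\<close> that contains \<open>x\<close> and stays inside the rectangle.\<close>
    obtain a where a: "0 \<le> a" "a + h \<le> L" "a \<le> x" "x \<le> a + h"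
      using h x by (cases "h \<le> x") (force intro: that[of "x - h"], force intro: that[of 0])
    have iJ: "integrable lborel (indicat_real {a..a + h})"
      by (intro integrable_real_indicator) (auto simp: emeasure_lborel_Icc_eq)
    have a1: "integrable lborel (\<lambda>s. m n x * indicator {a..a + h} s)" using iJ by (rule integrable_mult_right)
    have a2: "integrable lborel (\<lambda>s. 2 * (indicator {0..L} s * m n s))" using im by (rule integrable_mult_right)
    have a3: "integrable lborel (\<lambda>s. 2 * h * Q n * indicator {a..a + h} s)" using iJ by (rule integrable_mult_right)
    have "(\<integral>s. m n x * indicator {a..a + h} s \<partial>lborel) \<le>
      (\<integral>s. 2 * (indicator {0..L} s * m n s) + 2 * h * Q n * indicator {a..a + h} s \<partial>lborel)"
    proof (rule integral_mono_AE[OF a1 Bochner_Integration.integrable_add[OF a2 a3]], rule AE_I2)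
      fix s
      show "m n x * indicator {a..a + h} s \<le> 2 * (indicator {0..L} s * m n s) + 2 * h * Q n * indicator {a..a + h} s"
      proof (cases "s \<in> {a..a + h}")
        case False
        have "0 \<le> 2 * (indicator {0..L} s * m n s)" using m0[of s] by simp
        then show ?thesis using False by simp
      next
        case True
        then have s: "s \<in> {0..L}" using a by auto
        have "2 * \<bar>x - s\<bar> * Q n \<le> 2 * h * Q n" using True a Q0[of n] by (intro mult_right_mono) auto
        then show ?thesis using base[OF x s, of n] True s by simp
      qed
    qed
    also have "\<dots> = (\<integral>s. 2 * (indicator {0..L} s * m n s) \<partial>lborel) + (\<integral>s. 2 * h * Q n * indicator {a..a + h} s \<partial>lborel)"
      by (rule Bochner_Integration.integral_add[OF a2 a3])
    also have "\<dots> = 2 * \<Phi> n + 2 * h * Q n * h" using h \<Phi>m by (simp only: integral_mult_right_zero) simp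
    finally have "m n x * h \<le> 2 * \<Phi> n + 2 * h * Q n * h" using h by simp
    also have "\<dots> = (2 / h * \<Phi> n + 2 * h * Q n) * h" using h by (simp add: field_simps)
    finally have "m n x \<le> 2 / h * \<Phi> n + 2 * h * Q n" using h(1) by (rule mult_right_le_imp_le)
    also have "\<dots> \<le> 2 / h * (2 * V + 2 * e n) + 2 * h * (2 * P + 2 * e' n)"
      using \<Phi>V[of n] QP[of n] h by (intro add_mono mult_left_mono) auto
    finally show "(\<integral>y. indicator {0..1} y * (\<phi> n (x, y))\<^sup>2 \<partial>lborel) \<le> 2 / h * (2 * V + 2 * e n) + 2 * h * (2 * P + 2 * e' n)"
      by (simp add: m_def)
  next
    have "(\<lambda>n. 2 / h * (2 * V + 2 * e n) + 2 * h * (2 * P + 2 * e' n)) \<longlonglongrightarrow> 2 / h * (2 * V + 2 * 0) + 2 * h * (2 * P + 2 * 0)"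
      by (intro tendsto_intros limits)
    then show "(\<lambda>n. 2 / h * (2 * V + 2 * e n) + 2 * h * (2 * P + 2 * e' n)) \<longlonglongrightarrow> 4 / h * V + 4 * h * P" by (simp add: mult.assoc)
  qed (use h V0 in auto)
  then show "AE x in lborel. (\<integral>y. (v (x, y))\<^sup>2 \<partial>lborel) \<le>
      8 / h * (\<integral>z. (v z)\<^sup>2 \<partial>lborel) + 8 * h * (\<integral>z. (p z)\<^sup>2 \<partial>lborel)"
    by (simp add: V_def P_def distrib_left mult.assoc)
qed

text \<open>On a vertical line the integral of \<open>\<phi>\<^sub>y\<close> is the difference of the two end values of \<open>\<phi>\<close>, and
  these have the same limits.\<close>

lemma slice_mean_zero:
  fixes w :: "real \<times> real \<Rightarrow> real" and \<phi> :: "nat \<Rightarrow> real \<times> real \<Rightarrow> real"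
  assumes sm: "\<And>n. smooth (\<phi> n)"
    and w: "w \<in> borel_measurable borel" "integrable lborel (\<lambda>z. (w z)\<^sup>2)" "\<And>z. z \<notin> Omega L \<Longrightarrow> w z = 0"
    and iw: "integrable lborel w"
    and g1: "g1 \<in> borel_measurable borel" "integrable lborel (\<lambda>x. (g1 x)\<^sup>2)" "\<And>x. x \<notin> {0..L} \<Longrightarrow> g1 x = 0"
    and g0: "g0 \<in> borel_measurable borel" "integrable lborel (\<lambda>x. (g0 x)\<^sup>2)" "\<And>x. x \<notin> {0..L} \<Longrightarrow> g0 x = 0"
    and eq: "AE x in lborel. g1 x = g0 x"
    and lim_w: "(\<lambda>n. \<integral>z. indicator (Omega L) z * (pderiv_at ey (\<phi> n) z - w z)\<^sup>2 \<partial>lborel) \<longlonglongrightarrow> 0"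
    and lim_1: "(\<lambda>n. \<integral>x. indicator {0..L} x * (\<phi> n (x, 1) - g1 x)\<^sup>2 \<partial>lborel) \<longlonglongrightarrow> 0"
    and lim_0: "(\<lambda>n. \<integral>x. indicator {0..L} x * (\<phi> n (x, 0) - g0 x)\<^sup>2 \<partial>lborel) \<longlonglongrightarrow> 0"
  shows "AE x in lborel. (\<integral>y. w (x, y) \<partial>lborel) = 0"
proof -
  define N where "N x = (\<integral>y. w (x, y) \<partial>lborel)" for x
  define d where "d n z = indicator (Omega L) z * (pderiv_at ey (\<phi> n) z - w z)\<^sup>2" for n z
  define r where "r n x = 2 * (\<integral>y. d n (x, y) \<partial>lborel) + 4 * (indicator {0..L} x * (\<phi> n (x, 1) - g1 x)\<^sup>2)
    + 4 * (indicator {0..L} x * (\<phi> n (x, 0) - g0 x)\<^sup>2)" for n x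
  note c = smooth_continuous[OF sm]
  have cd: "continuous_on UNIV (pderiv_at ey (\<phi> n))" for n
    using sm by (rule smooth_pderiv_continuous) (simp add: Basis_real_prod)
  have id: "integrable lborel (d n)" for n
    unfolding d_def by (rule integrable_indicator_square_diff[OF cd compact_Omega w])
  have cl: "continuous_on UNIV (\<lambda>x. \<phi> n (x, a))" for n a
    by (rule continuous_on_compose2[OF c]) (auto intro!: continuous_intros)
  have i1: "integrable lborel (\<lambda>x. indicator {0..L} x * (\<phi> n (x, 1) - g1 x)\<^sup>2)" for n
    by (rule integrable_indicator_square_diff[OF cl compact_Icc g1])
  have i0: "integrable lborel (\<lambda>x. indicator {0..L} x * (\<phi> n (x, 0) - g0 x)\<^sup>2)" for n
    by (rule integrable_indicator_square_diff[OF cl compact_Icc g0])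
  have ir: "integrable lborel (r n)" for n
    unfolding r_def by (intro Bochner_Integration.integrable_add integrable_mult_right i1 i0 Fubini_lborel(2)[OF id])
  have le: "AE x in lborel. (N x)\<^sup>2 \<le> r n x" for n
    using Fubini_lborel(1)[OF iw] Fubini_lborel(1)[OF id[of n]] eq
  proof eventually_elim
    case (elim x)
    show ?case
    proof (cases "x \<in> {0..L}")
      case False
      then have "w (x, y) = 0" for y using w(3)[of "(x, y)"] by (auto simp: Omega_def)
      moreover have "0 \<le> (\<integral>y. d n (x, y) \<partial>lborel)"
        by (intro Bochner_Integration.integral_nonneg) (simp add: d_def)
      ultimately show ?thesis using False by (simp add: N_def r_def)
    next
      case True
      define \<psi> where "\<psi> y = pderiv_at ey (\<phi> n) (x, y)" for y
      have c\<psi>: "continuous_on A \<psi>" for A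
        unfolding \<psi>_def by (rule continuous_on_compose2[OF cd]) (auto intro!: continuous_intros)
      have i\<psi>: "integrable lborel (\<lambda>y. indicator {0..1} y * \<psi> y)"
        by (rule integrable_indicator_compact[OF c\<psi>]) auto
      have FTC: "(\<integral>y. indicator {0..1} y * \<psi> y \<partial>lborel) = \<phi> n (x, 1) - \<phi> n (x, 0)"
        using smooth_line_derivs(2)[OF sm] c\<psi> unfolding \<psi>_def real_scaleR_def[symmetric]
        by (intro integral_FTC_atLeastAtMost)
           (auto simp: has_real_derivative_iff_has_vector_derivative intro: has_vector_derivative_at_within)
      define k where "k y = indicator {0..1} y * \<psi> y - w (x, y)" for y
      have ik: "integrable lborel k" unfolding k_def using i\<psi> elim(1) by (rule Bochner_Integration.integrable_diff)
      have k2: "(k y)\<^sup>2 = d n (x, y)" for y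
        using w(3)[of "(x, y)"] True by (cases "y \<in> {0..1}") (auto simp: k_def d_def \<psi>_def Omega_def)
      have k0: "k y = k y * indicator {0..1} y" for y
        using w(3)[of "(x, y)"] by (cases "y \<in> {0..1}") (auto simp: k_def Omega_def)
      have "(\<integral>y. k y \<partial>lborel)\<^sup>2 \<le> (\<integral>y. d n (x, y) \<partial>lborel)"
        using Cauchy_Schwarz_interval[OF ik, of 0 1] elim(2) by (simp add: k2 k0[symmetric])
      moreover have "N x = - (\<integral>y. k y \<partial>lborel) + ((\<phi> n (x, 1) - g1 x) + (g0 x - \<phi> n (x, 0)))"
        using FTC elim(3) Bochner_Integration.integral_diff[OF i\<psi> elim(1)] by (simp add: k_def N_def)
      ultimately show ?thesis
        using square_sum_le[of "- (\<integral>y. k y \<partial>lborel)" "(\<phi> n (x, 1) - g1 x) + (g0 x - \<phi> n (x, 0))"]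
          square_sum_le[of "\<phi> n (x, 1) - g1 x" "g0 x - \<phi> n (x, 0)"] True
        by (simp add: r_def power2_commute[of "g0 x"])
    qed
  qed
  have iN: "integrable lborel (\<lambda>x. (N x)\<^sup>2)"
  proof (rule Bochner_Integration.integrable_bound[OF ir[of 0]])
    have "N \<in> borel_measurable lborel" unfolding N_def using Fubini_lborel(2)[OF iw] by auto
    then show "(\<lambda>x. (N x)\<^sup>2) \<in> borel_measurable lborel" by measurable
    show "AE x in lborel. norm ((N x)\<^sup>2) \<le> norm (r 0 x)" using le[of 0] by eventually_elim auto
  qed
  have "(\<integral>x. (N x)\<^sup>2 \<partial>lborel) \<le> 2 * (\<integral>z. d n z \<partial>lborel) + 4 * (\<integral>x. indicator {0..L} x * (\<phi> n (x, 1) - g1 x)\<^sup>2 \<partial>lborel)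
    + 4 * (\<integral>x. indicator {0..L} x * (\<phi> n (x, 0) - g0 x)\<^sup>2 \<partial>lborel)" for n
  proof -
    have "(\<integral>x. (N x)\<^sup>2 \<partial>lborel) \<le> (\<integral>x. r n x \<partial>lborel)" by (rule integral_mono_AE[OF iN ir le])
    also have "\<dots> = 2 * (\<integral>z. d n z \<partial>lborel) + 4 * (\<integral>x. indicator {0..L} x * (\<phi> n (x, 1) - g1 x)\<^sup>2 \<partial>lborel)
    + 4 * (\<integral>x. indicator {0..L} x * (\<phi> n (x, 0) - g0 x)\<^sup>2 \<partial>lborel)"
      unfolding r_def by (simp only: Bochner_Integration.integral_add Bochner_Integration.integrable_add integrable_mult_right
        i1 i0 Fubini_lborel(2,3)[OF id] integral_mult_right_zero)
    finally show ?thesis .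
  qed
  moreover have "(\<lambda>n. 2 * (\<integral>z. d n z \<partial>lborel) + 4 * (\<integral>x. indicator {0..L} x * (\<phi> n (x, 1) - g1 x)\<^sup>2 \<partial>lborel)
    + 4 * (\<integral>x. indicator {0..L} x * (\<phi> n (x, 0) - g0 x)\<^sup>2 \<partial>lborel)) \<longlonglongrightarrow> 2 * 0 + 4 * 0 + 4 * 0"
    using lim_w unfolding d_def by (intro tendsto_intros lim_1 lim_0)
  ultimately have "(\<integral>x. (N x)\<^sup>2 \<partial>lborel) \<le> 0"
    by (intro LIMSEQ_le_const[of _ 0]) auto
  then have "AE x in lborel. (N x)\<^sup>2 = 0"
    using iN by (subst integral_nonneg_eq_0_iff_AE[symmetric]) (auto intro!: antisym)
  then show ?thesis by eventually_elim (simp add: N_def)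
qed

section \<open>Borel representatives\<close>

lemma AE_lebesgue_iff: "(AE z in lebesgue. Q z) \<longleftrightarrow> (AE z in lborel. Q z)"
  by (rule AE_completion_iff)

text \<open>The definitions refer to Lebesgue measurable functions on a set, while Fubini's theorem is
  applied to Borel functions on the whole plane. This lemma and the existence of representatives
  allow passing from one to the other.\<close>

lemma set_lebesgue_transfer:
  fixes H h :: "'a::euclidean_space \<Rightarrow> real"
  assumes h: "h \<in> borel_measurable borel" "\<And>z. z \<notin> S \<Longrightarrow> h z = 0"
    and ae: "AE z in lebesgue. z \<in> S \<longrightarrow> H z = h z"
  shows "set_integrable lebesgue S H \<longleftrightarrow> integrable lborel h"
    and "(LINT z:S|lebesgue. H z) = (\<integral>z. h z \<partial>lborel)"
proof -
  have ae': "AE z in lebesgue. h z = indicator S z *\<^sub>R H z"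
    using ae by eventually_elim (auto simp: h(2) split: split_indicator)
  have hm: "h \<in> borel_measurable lebesgue" using h(1) by (simp add: measurable_completion)
  have Hm: "(\<lambda>z. indicator S z *\<^sub>R H z) \<in> borel_measurable lebesgue"
    using hm ae' by (rule borel_measurable_AE)
  have "integrable lebesgue h \<longleftrightarrow> integrable lebesgue (\<lambda>z. indicator S z *\<^sub>R H z)"
    by (rule integrable_cong_AE[OF hm Hm ae'])
  then show "set_integrable lebesgue S H \<longleftrightarrow> integrable lborel h"
    using h(1) by (simp add: set_integrable_def integrable_completion)
  have "integral\<^sup>L lebesgue h = (\<integral>z. indicator S z *\<^sub>R H z \<partial>lebesgue)"
    by (rule integral_cong_AE[OF hm Hm ae'])
  then show "(LINT z:S|lebesgue. H z) = (\<integral>z. h z \<partial>lborel)"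
    using h(1) by (simp add: set_lebesgue_integral_def integral_completion)
qed

lemma borel_representative:
  fixes f :: "'a::euclidean_space \<Rightarrow> real"
  assumes "set_borel_measurable lebesgue S f" "S \<in> sets borel"
  obtains f' where "f' \<in> borel_measurable borel" "\<And>z. z \<notin> S \<Longrightarrow> f' z = 0"
    "AE z in lebesgue. z \<in> S \<longrightarrow> f z = f' z"
proof -
  obtain g where g: "g \<in> borel_measurable lborel" "AE x in lborel. indicator S x *\<^sub>R f x = g x"
    using assms(1) completion_ex_borel_measurable_real unfolding set_borel_measurable_def by blast
  show thesis
  proof (rule that[of "\<lambda>z. indicator S z * g z"])
    show "(\<lambda>z. indicator S z * g z) \<in> borel_measurable borel" using g(1) assms(2) by simp
    show "AE z in lebesgue. z \<in> S \<longrightarrow> f z = indicator S z * g z"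
      unfolding AE_lebesgue_iff using g(2) by eventually_elim auto
  qed simp
qed

lemma square_integrable_representative:
  fixes f :: "'a::euclidean_space \<Rightarrow> real"
  assumes f: "square_integrable S f" and S: "S \<in> sets borel"
  obtains f' where "f' \<in> borel_measurable borel" "integrable lborel (\<lambda>z. (f' z)\<^sup>2)" "\<And>z. z \<notin> S \<Longrightarrow> f' z = 0"
    "AE z in lebesgue. z \<in> S \<longrightarrow> f z = f' z"
proof -
  obtain f' where f': "f' \<in> borel_measurable borel" "\<And>z. z \<notin> S \<Longrightarrow> f' z = 0"
    "AE z in lebesgue. z \<in> S \<longrightarrow> f z = f' z"
    using borel_representative[OF _ S, of f] f by (auto simp: square_integrable_def)
  have "set_integrable lebesgue S (\<lambda>z. (f z)\<^sup>2) \<longleftrightarrow> integrable lborel (\<lambda>z. (f' z)\<^sup>2)"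
  proof (rule set_lebesgue_transfer(1))
    show "AE z in lebesgue. z \<in> S \<longrightarrow> (f z)\<^sup>2 = (f' z)\<^sup>2" using f'(3) by eventually_elim auto
  qed (use f' in auto)
  then show thesis using that[OF f'(1) _ f'(2,3)] f by (simp add: square_integrable_def)
qed

lemma L2norm_square_transfer:
  fixes \<phi> f f' :: "'a::euclidean_space \<Rightarrow> real"
  assumes "continuous_on UNIV \<phi>" "S \<in> sets borel"
    and f': "f' \<in> borel_measurable borel" "AE z in lebesgue. z \<in> S \<longrightarrow> f z = f' z"
  shows "(L2norm S (\<lambda>z. \<phi> z - f z))\<^sup>2 = (\<integral>z. indicator S z * (\<phi> z - f' z)\<^sup>2 \<partial>lborel)"
proof -
  have [measurable]: "\<phi> \<in> borel_measurable borel" using assms(1) by (rule borel_measurable_continuous_onI)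
  note [measurable] = f'(1) assms(2)
  have "(LINT z:S|lebesgue. (\<phi> z - f z)\<^sup>2) = (\<integral>z. indicator S z * (\<phi> z - f' z)\<^sup>2 \<partial>lborel)"
  proof (rule set_lebesgue_transfer(2))
    show "AE z in lebesgue. z \<in> S \<longrightarrow> (\<phi> z - f z)\<^sup>2 = indicator S z * (\<phi> z - f' z)\<^sup>2"
      using f'(2) by eventually_elim auto
  qed auto
  moreover have "0 \<le> (\<integral>z. indicator S z * (\<phi> z - f' z)\<^sup>2 \<partial>lborel)"
    by (intro Bochner_Integration.integral_nonneg) auto
  ultimately show ?thesis by (simp add: L2norm_def)
qed

lemma L2norm_tendsto_transfer:
  fixes \<phi> :: "nat \<Rightarrow> 'a::euclidean_space \<Rightarrow> real"
  assumes "\<And>n. continuous_on UNIV (\<phi> n)" "S \<in> sets borel"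
    and "f' \<in> borel_measurable borel" "AE z in lebesgue. z \<in> S \<longrightarrow> f z = f' z"
    and "(\<lambda>n. L2norm S (\<lambda>z. \<phi> n z - f z)) \<longlonglongrightarrow> 0"
  shows "(\<lambda>n. \<integral>z. indicator S z * (\<phi> n z - f' z)\<^sup>2 \<partial>lborel) \<longlonglongrightarrow> 0"
  using tendsto_power[OF assms(5), of 2] L2norm_square_transfer[OF assms(1-4)] by simp

section \<open>Energy of the zero function and comparison of the energies\<close>

lemma AE_interior_Omega: "AE z in lebesgue. z \<in> Omega L \<longrightarrow> z \<in> interior (Omega L)"
proof -
  have "convex (Omega L)" unfolding Omega_def by (intro convex_Times convex_real_interval)
  then have "negligible (frontier (Omega L))" by (rule negligible_convex_frontier)
  then have "frontier (Omega L) \<in> null_sets lebesgue" by (simp add: negligible_iff_null_sets)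
  from AE_not_in[OF this] show ?thesis
    by eventually_elim (use closure_subset in \<open>auto simp: frontier_def\<close>)
qed

text \<open>A weak derivative is only locally integrable, so the fundamental lemma is applied on
  rectangles \<open>K k\<close> that exhaust the interior; the boundary is null by convexity.\<close>

lemma weak_deriv_of_null:
  assumes L: "0 < L" and weak: "has_weak_deriv (Omega L) b f g"
    and f: "AE z in lebesgue. z \<in> Omega L \<longrightarrow> f z = 0"
  shows "AE z in lebesgue. z \<in> Omega L \<longrightarrow> g z = 0"
proof -
  define e where "e k = min L 1 / (real k + 3)" for k
  define K where "K k = {e k..L - e k} \<times> {e k..1 - e k}" for k
  have e: "0 < e k" "2 * e k < L" "2 * e k < 1" for k
  proof -
    show e0: "0 < e k" unfolding e_def using L by (intro divide_pos_pos) auto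
    have "min L 1 = e k * (real k + 3)" unfolding e_def by simp
    also have "\<dots> = e k * real k + 3 * e k" by (simp only: distrib_left mult.commute)
    also have "\<dots> > 2 * e k" using mult_nonneg_nonneg[of "e k" "real k"] e0 by linarith
    finally have "2 * e k < min L 1" .
    then show "2 * e k < L" "2 * e k < 1" by auto
  qed
  have "AE z in lebesgue. z \<in> K k \<longrightarrow> g z = 0" for k
  proof -
    have Kc: "compact (K k)" unfolding K_def by (intro compact_Times) auto
    then have Kb: "K k \<in> sets borel" by (intro borel_closed compact_imp_closed)
    have KO: "K k \<subseteq> interior (Omega L)" using e(1)[of k] unfolding interior_Omega K_def by auto
    then have KO': "K k \<subseteq> Omega L" using interior_subset by blast
    have gi: "set_integrable lebesgue (K k) g"
      using weak Kc KO by (auto simp: has_weak_deriv_def locally_integrable_def)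
    then have "set_borel_measurable lebesgue (K k) g"
      by (auto simp: set_integrable_def set_borel_measurable_def)
    then obtain g' where g': "g' \<in> borel_measurable borel" "\<And>z. z \<notin> K k \<Longrightarrow> g' z = 0"
      "AE z in lebesgue. z \<in> K k \<longrightarrow> g z = g' z"
      using borel_representative[OF _ Kb] by blast
    have ig': "integrable lborel g'" using set_lebesgue_transfer(1)[OF g'] gi by simp
    have "AE z in lborel. g' z = 0"
    proof (rule AE_zero_if_orthogonal_to_bumps_2d[OF ig'])
      show "e k < L - e k" "e k < 1 - e k" using e(2,3)[of k] by auto
      show "g' z = 0" if "z \<notin> {e k..L - e k} \<times> {e k..1 - e k}" for z using g'(2) that by (simp add: K_def)
      fix n m and a b' c d :: real
      assume ab: "e k < a" "a < b'" "b' < L - e k" and cd: "e k < c" "c < d" "d < 1 - e k"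
      let ?\<phi> = "\<lambda>z::real \<times> real. bump n a b' (fst z) * bump m c d (snd z)"
      have tf: "test_function (Omega L) ?\<phi>"
        using ab cd e(1)[of k] bump_eq_0[of _ a b' n] bump_eq_0[of _ c d m]
        by (intro test_function_product[where a=a and b=b' and c=c and d=d, OF C_k_bump C_k_bump]) auto
      have \<phi>K: "?\<phi> z = 0" if "z \<notin> K k" for z
        using that ab cd bump_eq_0[of "fst z" a b' n] bump_eq_0[of "snd z" c d m] by (cases z) (auto simp: K_def)
      have "(LINT z:Omega L|lebesgue. g z * ?\<phi> z) = (\<integral>z. g' z * ?\<phi> z \<partial>lborel)"
      proof (rule set_lebesgue_transfer(2))
        show "(\<lambda>z. g' z * ?\<phi> z) \<in> borel_measurable borel"
          using g'(1) by (simp add: borel_prod[symmetric])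
        show "g' z * ?\<phi> z = 0" if "z \<notin> Omega L" for z
        proof -
          have "z \<notin> K k" using that KO' by blast
          then show ?thesis using g'(2) by simp
        qed
        show "AE z in lebesgue. z \<in> Omega L \<longrightarrow> g z * ?\<phi> z = g' z * ?\<phi> z"
          using g'(3)
        proof eventually_elim
          case (elim z) then show ?case using \<phi>K[of z] by (cases "z \<in> K k") auto
        qed
      qed
      moreover have "(LINT z:Omega L|lebesgue. f z * pderiv_at b ?\<phi> z) = integral\<^sup>L (lborel :: (real \<times> real) measure) (\<lambda>_. 0)"
      proof (rule set_lebesgue_transfer(2))
        show "AE z in lebesgue. z \<in> Omega L \<longrightarrow> f z * pderiv_at b ?\<phi> z = 0"
          using f by eventually_elim auto
      qed auto
      moreover have "(LINT z:Omega L|lebesgue. f z * pderiv_at b ?\<phi> z) = - (LINT z:Omega L|lebesgue. g z * ?\<phi> z)"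
        using weak tf by (simp add: has_weak_deriv_def)
      ultimately show "(\<integral>z. g' z * ?\<phi> z \<partial>lborel) = 0" by simp
    qed
    then have "AE z in lebesgue. g' z = 0" by (simp add: AE_lebesgue_iff)
    then show ?thesis using g'(3) by eventually_elim auto
  qed
  then have "AE z in lebesgue. \<forall>k. z \<in> K k \<longrightarrow> g z = 0" unfolding AE_all_countable by blast
  then show ?thesis using AE_interior_Omega[of L]
  proof eventually_elim
    case (elim z)
    show ?case
    proof
      assume "z \<in> Omega L"
      then have z: "0 < fst z" "fst z < L" "0 < snd z" "snd z < 1" using elim(2) by (auto simp: interior_Omega)
      define r where "r = min (min (fst z) (L - fst z)) (min (snd z) (1 - snd z))"
      have "0 < r" using z by (simp add: r_def)
      moreover have "e \<longlonglongrightarrow> 0"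
        using LIMSEQ_ignore_initial_segment[OF lim_const_over_n[of "min L 1"], of 3]
        unfolding e_def by (simp only: of_nat_add of_nat_numeral)
      ultimately have "eventually (\<lambda>k. e k < r) sequentially" by (rule order_tendstoD(2)[rotated])
      then obtain k where "e k < r" by (auto simp: eventually_sequentially)
      then have "z \<in> K k" by (cases z) (auto simp: K_def r_def)
      then show "g z = 0" using elim(1) by blast
    qed
  qed
qed

lemma wD_of_null:
  assumes L: "0 < L" and f: "AE z in lebesgue. z \<in> Omega L \<longrightarrow> f z = 0"
  shows "AE z in lebesgue. z \<in> Omega L \<longrightarrow> wD L b f z = 0"
proof -
  have "has_weak_deriv (Omega L) b f (\<lambda>_. 0)"
    unfolding has_weak_deriv_def
  proof (intro conjI allI impI)
    show "locally_integrable (Omega L) f" unfolding locally_integrable_def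
    proof (intro allI impI)
      fix K assume "compact K \<and> K \<subseteq> interior (Omega L)"
      then have K: "K \<subseteq> Omega L" using interior_subset by blast
      have "set_integrable lebesgue K f \<longleftrightarrow> integrable lborel (\<lambda>_::real \<times> real. 0::real)"
      proof (rule set_lebesgue_transfer(1))
        show "AE z in lebesgue. z \<in> K \<longrightarrow> f z = 0" using f by eventually_elim (use K in auto)
      qed auto
      then show "set_integrable lebesgue K f" by simp
    qed
    show "locally_integrable (Omega L) (\<lambda>_. 0)" by (simp add: locally_integrable_def set_integrable_def)
    fix \<phi>
    have "(LINT z:Omega L|lebesgue. f z * pderiv_at b \<phi> z) = integral\<^sup>L (lborel :: (real \<times> real) measure) (\<lambda>_. 0)"
    proof (rule set_lebesgue_transfer(2))
      show "AE z in lebesgue. z \<in> Omega L \<longrightarrow> f z * pderiv_at b \<phi> z = 0" using f by eventually_elim auto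
    qed auto
    then show "(LINT z:Omega L|lebesgue. f z * pderiv_at b \<phi> z) = - (LINT z:Omega L|lebesgue. 0 * \<phi> z)"
      by (simp add: set_lebesgue_integral_def)
  qed
  then have "has_weak_deriv (Omega L) b f (wD L b f)" unfolding weak_deriv_def
    by (rule someI[where P="has_weak_deriv (Omega L) b f"])
  from weak_deriv_of_null[OF L this f] show ?thesis .
qed

lemma measure_Omega: "0 < L \<Longrightarrow> measure lebesgue (Omega L) = L"
proof -
  assume "0 < L"
  have "Omega L = cbox (0, 0) (L, 1)" by (simp add: Omega_def cbox_Pair_eq)
  then show ?thesis using \<open>0 < L\<close> by (simp add: content_Pair measure_completion)
qed

lemma emeasure_Omega_finite: "emeasure lebesgue (Omega L) < \<infinity>"
  using compact_Omega[of L] emeasure_compact_finite[of "Omega L"] by (simp add: less_top)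

lemma measure_setA_le: "0 < L \<Longrightarrow> measure lebesgue (setA L u) \<le> L"
proof -
  assume L: "0 < L"
  have "emeasure lebesgue (setA L u) \<le> emeasure lebesgue (Omega L)"
    by (rule emeasure_mono) (auto simp: setA_def)
  then have "measure lebesgue (setA L u) \<le> measure lebesgue (Omega L)"
    unfolding measure_def using emeasure_Omega_finite by (intro enn2real_mono) auto
  then show ?thesis using measure_Omega[OF L] by simp
qed

text \<open>The zero function pays the penalty on at most the whole rectangle, and its weak
  derivatives of both orders vanish almost everywhere.\<close>

lemma zero_energy_le:
  assumes L: "0 < L" and D: "0 < \<Delta>"
  shows "E1 L (\<lambda>_. 0) \<epsilon> \<Delta> \<le> \<Delta> * L" "E2 L (\<lambda>_. 0) \<epsilon> \<Delta> \<le> \<Delta> * L" "E3 L (\<lambda>_. 0) \<epsilon> \<Delta> \<le> \<Delta> * L"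
proof -
  have d1: "AE z in lebesgue. z \<in> Omega L \<longrightarrow> wD L b (\<lambda>_. 0) z = 0" for b
    by (rule wD_of_null[OF L]) auto
  have d2: "AE z in lebesgue. z \<in> Omega L \<longrightarrow> wD L b (wD L c (\<lambda>_. 0)) z = 0" for b c
    by (rule wD_of_null[OF L d1])
  have zero: "(LINT z:Omega L|lebesgue. H z) = 0" if "AE z in lebesgue. z \<in> Omega L \<longrightarrow> H z = 0" for H :: "real \<times> real \<Rightarrow> real"
  proof -
    have "(LINT z:Omega L|lebesgue. H z) = integral\<^sup>L (lborel :: (real \<times> real) measure) (\<lambda>_. 0)"
    proof (rule set_lebesgue_transfer(2))
      show "AE z in lebesgue. z \<in> Omega L \<longrightarrow> H z = 0" by (rule that)
    qed auto
    then show ?thesis by simp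
  qed
  have A: "\<Delta> * measure lebesgue (setA L (\<lambda>_. 0)) \<le> \<Delta> * L"
    using measure_setA_le[OF L] D by (intro mult_left_mono) auto
  have "(LINT z:Omega L|lebesgue. \<epsilon>\<^sup>2 * (wD L ey (wD L ey (\<lambda>_. 0)) z)\<^sup>2 + (wD L ex (\<lambda>_. 0) z)\<^sup>2) = 0"
    by (rule zero) (use d1[of ex] d2[of ey ey] in \<open>eventually_elim, auto\<close>)
  then show "E1 L (\<lambda>_. 0) \<epsilon> \<Delta> \<le> \<Delta> * L" unfolding E1_def using A by simp
  have "(LINT z:Omega L|lebesgue. \<epsilon>\<^sup>2 * (\<Sum>b\<in>Basis. (wD L b (wD L ey (\<lambda>_. 0)) z)\<^sup>2) + (wD L ex (\<lambda>_. 0) z)\<^sup>2) = 0"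
    by (rule zero) (use d1[of ex] d2[of ex ey] d2[of ey ey] in \<open>eventually_elim, auto simp: Basis_real_prod\<close>)
  then show "E2 L (\<lambda>_. 0) \<epsilon> \<Delta> \<le> \<Delta> * L" unfolding E2_def using A by simp
  have "(LINT z:Omega L|lebesgue. \<epsilon>\<^sup>2 * (\<Sum>b\<in>Basis. \<Sum>c\<in>Basis. (wD L b (wD L c (\<lambda>_. 0)) z)\<^sup>2) + (wD L ex (\<lambda>_. 0) z)\<^sup>2) = 0"
    by (rule zero) (use d1[of ex] d2[of ex ey] d2[of ey ey] d2[of ey ex] d2[of ex ex] in \<open>eventually_elim, auto simp: Basis_real_prod\<close>)
  then show "E3 L (\<lambda>_. 0) \<epsilon> \<Delta> \<le> \<Delta> * L" unfolding E3_def using A by simp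
qed

lemma admissible_nested: "A3 L \<subseteq> A2 L" "A2 L \<subseteq> A1 L"
  unfolding A1_def A2_def A3_def W12_def by (auto simp: Basis_real_prod)

lemma energy_mono:
  shows "u \<in> A2 L \<Longrightarrow> E1 L u \<epsilon> \<Delta> \<le> E2 L u \<epsilon> \<Delta>"
    and "u \<in> A3 L \<Longrightarrow> E1 L u \<epsilon> \<Delta> \<le> E3 L u \<epsilon> \<Delta>"
proof -
  have sq: "set_integrable lebesgue (Omega L) (\<lambda>z. (h z)\<^sup>2)" if "square_integrable (Omega L) h" for h
    using that by (simp add: square_integrable_def)
  have p: "square_integrable (Omega L) (wD L ex u)" if "u \<in> A1 L"
    using that by (auto simp: A1_def W12p_def W12_def Basis_real_prod)
  show "E1 L u \<epsilon> \<Delta> \<le> E2 L u \<epsilon> \<Delta>" if u: "u \<in> A2 L"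
  proof -
    have "square_integrable (Omega L) (wD L b (wD L ey u))" if "b \<in> Basis" for b
      using u that by (auto simp: A2_def W12_def)
    then have i: "set_integrable lebesgue (Omega L) (\<lambda>z. (wD L ex (wD L ey u) z)\<^sup>2)"
      "set_integrable lebesgue (Omega L) (\<lambda>z. (wD L ey (wD L ey u) z)\<^sup>2)" by (auto intro!: sq simp: Basis_real_prod)
    have i': "set_integrable lebesgue (Omega L) (\<lambda>z. (wD L ex u z)\<^sup>2)"
      using p u admissible_nested by (intro sq) auto
    have "(LINT z:Omega L|lebesgue. \<epsilon>\<^sup>2 * (wD L ey (wD L ey u) z)\<^sup>2 + (wD L ex u z)\<^sup>2) \<le>
      (LINT z:Omega L|lebesgue. \<epsilon>\<^sup>2 * ((wD L ex (wD L ey u) z)\<^sup>2 + (wD L ey (wD L ey u) z)\<^sup>2) + (wD L ex u z)\<^sup>2)"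
      by (intro set_integral_mono set_integral_add(1) set_integrable_mult_right i i' add_right_mono mult_left_mono) auto
    then show ?thesis by (simp add: E1_def E2_def Basis_real_prod)
  qed
  show "E1 L u \<epsilon> \<Delta> \<le> E3 L u \<epsilon> \<Delta>" if u: "u \<in> A3 L"
  proof -
    have "square_integrable (Omega L) (wD L b (wD L c u))" if "b \<in> Basis" "c \<in> Basis" for b c
      using u that by (auto simp: A3_def W12_def)
    then have i: "set_integrable lebesgue (Omega L) (\<lambda>z. (wD L ex (wD L ey u) z)\<^sup>2)"
      "set_integrable lebesgue (Omega L) (\<lambda>z. (wD L ey (wD L ey u) z)\<^sup>2)"
      "set_integrable lebesgue (Omega L) (\<lambda>z. (wD L ey (wD L ex u) z)\<^sup>2)"
      "set_integrable lebesgue (Omega L) (\<lambda>z. (wD L ex (wD L ex u) z)\<^sup>2)" by (auto intro!: sq simp: Basis_real_prod)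
    have i': "set_integrable lebesgue (Omega L) (\<lambda>z. (wD L ex u z)\<^sup>2)"
      using p u admissible_nested by (intro sq) auto
    have "(LINT z:Omega L|lebesgue. \<epsilon>\<^sup>2 * (wD L ey (wD L ey u) z)\<^sup>2 + (wD L ex u z)\<^sup>2) \<le>
      (LINT z:Omega L|lebesgue. \<epsilon>\<^sup>2 * ((wD L ex (wD L ex u) z)\<^sup>2 + (wD L ex (wD L ey u) z)\<^sup>2 +
        ((wD L ey (wD L ex u) z)\<^sup>2 + (wD L ey (wD L ey u) z)\<^sup>2)) + (wD L ex u z)\<^sup>2)"
      by (intro set_integral_mono set_integral_add(1) set_integrable_mult_right i i' add_right_mono mult_left_mono) auto
    then show ?thesis by (simp add: E1_def E3_def Basis_real_prod)
  qed
qed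

section \<open>Functions of low energy are not small\<close>

lemma integrable_if_square_integrable:
  fixes f :: "'a::euclidean_space \<Rightarrow> real"
  assumes [measurable]: "f \<in> borel_measurable borel" and f2: "integrable lborel (\<lambda>z. (f z)\<^sup>2)"
    and S: "compact S" and supp: "\<And>z. z \<notin> S \<Longrightarrow> f z = 0"
  shows "integrable lborel f"
proof (rule Bochner_Integration.integrable_bound)
  have "integrable lborel (\<lambda>z. indicator S z * (1::real))"
    by (rule integrable_indicator_compact[OF _ S]) auto
  then show "integrable lborel (\<lambda>z. indicator S z * 1 + (f z)\<^sup>2)"
    using f2 by (rule Bochner_Integration.integrable_add)
  show "AE z in lborel. norm (f z) \<le> norm (indicator S z * 1 + (f z)\<^sup>2)"
  proof (rule AE_I2)
    fix z
    have "\<bar>f z\<bar> \<le> 1 + (f z)\<^sup>2" using zero_le_power2[of "\<bar>f z\<bar> - 1"] abs_ge_zero[of "f z"]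
      by (simp add: power2_diff)
    then show "norm (f z) \<le> norm (indicator S z * 1 + (f z)\<^sup>2)"
      using supp[of z] by (cases "z \<in> S") auto
  qed
qed simp

lemma weak_identity_transfer:
  assumes weak: "has_weak_deriv (Omega L) ey u g"
    and u': "u' \<in> borel_measurable borel" "\<And>z. z \<notin> Omega L \<Longrightarrow> u' z = 0" "AE z in lebesgue. z \<in> Omega L \<longrightarrow> u z = u' z"
    and g': "g' \<in> borel_measurable borel" "\<And>z. z \<notin> Omega L \<Longrightarrow> g' z = 0" "AE z in lebesgue. z \<in> Omega L \<longrightarrow> g z = g' z"
    and tf: "test_function (Omega L) \<phi>"
  shows "(\<integral>z. u' z * pderiv_at ey \<phi> z \<partial>lborel) = - (\<integral>z. g' z * \<phi> z \<partial>lborel)"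
proof -
  have sm: "smooth \<phi>" using tf by (simp add: test_function_def)
  have [measurable]: "\<phi> \<in> borel_measurable borel" "pderiv_at ey \<phi> \<in> borel_measurable borel"
    using smooth_continuous[OF sm] smooth_pderiv_continuous[OF sm, of ey]
    by (auto intro: borel_measurable_continuous_onI simp: Basis_real_prod)
  note [measurable] = u'(1) g'(1)
  have "(LINT z:Omega L|lebesgue. u z * pderiv_at ey \<phi> z) = (\<integral>z. u' z * pderiv_at ey \<phi> z \<partial>lborel)"
  proof (rule set_lebesgue_transfer(2))
    show "AE z in lebesgue. z \<in> Omega L \<longrightarrow> u z * pderiv_at ey \<phi> z = u' z * pderiv_at ey \<phi> z"
      using u'(3) by eventually_elim auto
  qed (use u'(2) in auto)
  moreover have "(LINT z:Omega L|lebesgue. g z * \<phi> z) = (\<integral>z. g' z * \<phi> z \<partial>lborel)"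
  proof (rule set_lebesgue_transfer(2))
    show "AE z in lebesgue. z \<in> Omega L \<longrightarrow> g z * \<phi> z = g' z * \<phi> z"
      using g'(3) by eventually_elim auto
  qed (use g'(2) in auto)
  ultimately show ?thesis using weak tf by (simp add: has_weak_deriv_def)
qed

text \<open>Both claims hold with one power of \<open>\<epsilon>\<^sup>2 / \<Delta> = 1 / l\<close> to spare, because \<open>1 \<le> l\<close>. For the first
  claim the inequality \<open>near\<close> is squared to remove the roots, and then \<open>b\<close> is eliminated; here \<open>V\<close>
  stands for the squared norm of \<open>v\<close>, so this is the fourth power of a bound by \<open>\<epsilon>\<close> to the \<open>7/2\<close>.\<close>

lemma scaling_bounds:
  fixes L \<epsilon> \<Delta> V b :: real
  assumes pos: "0 < L" "0 < \<epsilon>" "0 < \<Delta>" "0 < V" "0 < b"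
    and l: "l = \<Delta> / \<epsilon>\<^sup>2" "1 \<le> l"
    and far: "1 \<le> 384 * (8 * L * (\<Delta> * b)) * l\<^sup>2"
    and near: "1 \<le> 384 * (16 * (sqrt V * sqrt (\<Delta> * b))) * l\<^sup>2"
    and b: "b \<le> 384 * l\<^sup>2 * V"
  shows "\<epsilon> ^ 14 \<le> 4000 ^ 4 * V\<^sup>2 * \<Delta> ^ 8" and "\<epsilon> ^ 6 \<le> 4000 * b * L * \<Delta> ^ 4"
proof -
  have le: "\<epsilon>\<^sup>2 \<le> \<Delta>" using l pos by (simp add: le_divide_eq)
  have \<Delta>: "\<Delta> = l * \<epsilon>\<^sup>2" using l pos by simp
  have "\<epsilon> ^ 4 * 1 \<le> \<epsilon> ^ 4 * (384 * (8 * L * (\<Delta> * b)) * l\<^sup>2)" using far pos by (intro mult_left_mono) auto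
  also have "\<dots> = 3072 * L * \<Delta> ^ 3 * b" unfolding l(1) using pos
    by (simp add: power_divide power2_eq_square power3_eq_cube power4_eq_xxxx)
  finally have 1: "\<epsilon> ^ 4 \<le> 3072 * L * \<Delta> ^ 3 * b" by simp
  have "\<epsilon> ^ 6 = \<epsilon> ^ 4 * \<epsilon>\<^sup>2" by (simp flip: power_add)
  also have "\<dots> \<le> (3072 * L * \<Delta> ^ 3 * b) * \<Delta>" using 1 le pos by (intro mult_mono) auto
  also have "\<dots> = 3072 * (b * L * \<Delta> ^ 4)" by (simp add: power3_eq_cube power4_eq_xxxx)
  also have "\<dots> \<le> 4000 * (b * L * \<Delta> ^ 4)" using pos by (intro mult_right_mono) auto
  finally show "\<epsilon> ^ 6 \<le> 4000 * b * L * \<Delta> ^ 4" by (simp add: mult.assoc)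
  have "1\<^sup>2 \<le> (384 * (16 * (sqrt V * sqrt (\<Delta> * b))) * l\<^sup>2)\<^sup>2" using near by (intro power_mono) auto
  also have "\<dots> = 6144\<^sup>2 * (V * (\<Delta> * b)) * l ^ 4"
    using pos by (simp add: power_mult_distrib flip: power_mult)
  also have "\<dots> \<le> 6144\<^sup>2 * (V * (\<Delta> * (384 * l\<^sup>2 * V))) * l ^ 4"
    using b pos l(2) by (intro mult_right_mono mult_left_mono) auto
  \<comment> \<open>\<open>14495514624 = 6144\<^sup>2 * 384\<close> and \<open>6144 = 384 * 16\<close>.\<close>
  also have "\<dots> = 14495514624 * (\<Delta> * V\<^sup>2 * l ^ 6)"
    by (simp add: power2_eq_square power4_eq_xxxx power_numeral_reduce)
  finally have "\<epsilon> ^ 12 * 1 \<le> \<epsilon> ^ 12 * (14495514624 * (\<Delta> * V\<^sup>2 * l ^ 6))"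
    using pos by (intro mult_left_mono) auto
  also have "\<dots> = 14495514624 * (\<Delta> * V\<^sup>2 * (l * \<epsilon>\<^sup>2) ^ 6)"
    by (simp add: power_mult_distrib flip: power_mult)
  also have "\<dots> = 14495514624 * (V\<^sup>2 * \<Delta> ^ 7)" unfolding \<Delta>[symmetric] by (simp add: power_numeral_reduce)
  finally have 2: "\<epsilon> ^ 12 \<le> 14495514624 * (V\<^sup>2 * \<Delta> ^ 7)" by simp
  have "\<epsilon> ^ 14 = \<epsilon> ^ 12 * \<epsilon>\<^sup>2" by (simp flip: power_add)
  also have "\<dots> \<le> 14495514624 * (V\<^sup>2 * \<Delta> ^ 7) * \<Delta>" using 2 le pos by (intro mult_mono) auto
  also have "\<dots> = 14495514624 * (V\<^sup>2 * \<Delta> ^ 8)" by (simp add: power_numeral_reduce)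
  also have "\<dots> \<le> 4000 ^ 4 * (V\<^sup>2 * \<Delta> ^ 8)" using pos by (intro mult_right_mono) auto
  finally show "\<epsilon> ^ 14 \<le> 4000 ^ 4 * V\<^sup>2 * \<Delta> ^ 8" by (simp add: mult.assoc)
qed

text \<open>The core of the argument, for Borel functions \<open>v\<close>, \<open>w = v\<^sub>y\<close>, \<open>q = v\<^sub>y\<^sub>y\<close> and the number
  \<open>P = \<integral>v\<^sub>x\<^sup>2\<close>.\<close>

lemma low_energy_bounds:
  fixes v w q :: "real \<times> real \<Rightarrow> real"
  assumes pos: "0 < L" "0 < \<epsilon>" "0 < \<Delta>"
    and v: "v \<in> borel_measurable borel" "integrable lborel (\<lambda>z. (v z)\<^sup>2)" "\<And>z. z \<notin> Omega L \<Longrightarrow> v z = 0"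
    and w: "w \<in> borel_measurable borel" "integrable lborel (\<lambda>z. (w z)\<^sup>2)" "\<And>z. z \<notin> Omega L \<Longrightarrow> w z = 0"
    and q: "q \<in> borel_measurable borel" "integrable lborel (\<lambda>z. (q z)\<^sup>2)" "\<And>z. z \<notin> Omega L \<Longrightarrow> q z = 0"
    and slice_w: "AE x in lborel. \<exists>c. AE y in lborel. y \<in> {0..1} \<longrightarrow> w (x, y) = c + (\<integral>t. q (x, t) * indicator {0..y} t \<partial>lborel)"
    and slice_v: "AE x in lborel. \<exists>c. AE y in lborel. y \<in> {0..1} \<longrightarrow> v (x, y) = c + (\<integral>t. w (x, t) * indicator {0..y} t \<partial>lborel)"
    and mean: "AE x in lborel. (\<integral>y. w (x, y) \<partial>lborel) = 0"
    and far: "AE x in lborel. (\<integral>y. (v (x, y))\<^sup>2 \<partial>lborel) \<le> 8 * L * P"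
    and near: "\<And>h. 0 < h \<Longrightarrow> h \<le> L \<Longrightarrow> AE x in lborel. (\<integral>y. (v (x, y))\<^sup>2 \<partial>lborel) \<le>
      8 / h * (\<integral>z. (v z)\<^sup>2 \<partial>lborel) + 8 * h * P"
    and P: "0 \<le> P"
    and energy: "\<epsilon>\<^sup>2 * (\<integral>z. (q z)\<^sup>2 \<partial>lborel) + P \<le> \<Delta> * measure lborel {z \<in> Omega L. 1 \<le> \<bar>w z\<bar>}"
    and V: "0 < (\<integral>z. (v z)\<^sup>2 \<partial>lborel)"
  shows "\<epsilon> ^ 14 \<le> 4000 ^ 4 * (\<integral>z. (v z)\<^sup>2 \<partial>lborel)\<^sup>2 * \<Delta> ^ 8"
    and "\<epsilon> ^ 6 \<le> 4000 * measure lborel {z \<in> Omega L. 1 \<le> \<bar>w z\<bar>} * L * \<Delta> ^ 4"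
proof -
  define B where "B = {z \<in> Omega L. 1 \<le> \<bar>w z\<bar>}"
  define b where "b = measure lborel B"
  define V where "V = (\<integral>z. (v z)\<^sup>2 \<partial>lborel)"
  define \<beta> where "\<beta> x = measure lborel {y\<in>{0..1}. 1 \<le> \<bar>w (x, y)\<bar>}" for x
  define m where "m x = (\<integral>y. (v (x, y))\<^sup>2 \<partial>lborel)" for x
  define K where "K x = (\<integral>y. (q (x, y))\<^sup>2 \<partial>lborel)" for x
  have V0: "0 < V" using V by (simp add: V_def)
  have [measurable]: "v \<in> borel_measurable (borel \<Otimes>\<^sub>M borel)" "w \<in> borel_measurable (borel \<Otimes>\<^sub>M borel)"
    using v(1) w(1) by (auto simp: borel_prod)
  have iw: "integrable lborel w" by (rule integrable_if_square_integrable[OF w(1,2) compact_Omega w(3)])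
  have iq: "integrable lborel q" by (rule integrable_if_square_integrable[OF q(1,2) compact_Omega q(3)])
  have Bset: "B \<in> sets borel" unfolding B_def using w(1) Omega_borel[of L] by measurable
  have "emeasure lborel B \<le> emeasure lborel (Omega L)" using Bset by (intro emeasure_mono) (auto simp: B_def)
  also have "\<dots> < \<infinity>" using emeasure_compact_finite[OF compact_Omega] .
  finally have iB: "integrable lborel (indicat_real B)"
    using Bset by (intro integrable_real_indicator) auto
  have slB: "(\<integral>y. indicat_real B (x, y) \<partial>lborel) = \<beta> x" for x
  proof -
    have "(\<lambda>y. indicat_real B (x, y)) = indicat_real {y\<in>{0..1}. 1 \<le> \<bar>w (x, y)\<bar>}"
    proof
      fix y show "indicat_real B (x, y) = indicat_real {y\<in>{0..1}. 1 \<le> \<bar>w (x, y)\<bar>} y"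
        using w(3)[of "(x, y)"] by (cases "(x, y) \<in> Omega L") (auto simp: B_def Omega_def indicator_def)
    qed
    then show ?thesis by (simp add: \<beta>_def)
  qed
  have i\<beta>: "integrable lborel \<beta>" and \<beta>b: "(\<integral>x. \<beta> x \<partial>lborel) = b"
    using Fubini_lborel(2,3)[OF iB] unfolding slB by (auto simp: b_def)
  have im: "integrable lborel m" and mV: "(\<integral>x. m x \<partial>lborel) = V"
    using Fubini_lborel(2,3)[OF v(2)] unfolding m_def V_def by auto
  have iK: "integrable lborel K" and KQ: "(\<integral>x. K x \<partial>lborel) = (\<integral>z. (q z)\<^sup>2 \<partial>lborel)"
    using Fubini_lborel(2,3)[OF q(2)] unfolding K_def by auto
  have bounds: "AE x in lborel. \<beta> x \<le> 1 \<and> \<beta> x \<le> K x \<and> \<beta> x \<le> 384 * m x * (K x)\<^sup>2"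
    using slice_w slice_v mean Fubini_lborel(1)[OF iw] Fubini_lborel(1)[OF iq] Fubini_lborel(1)[OF v(2)] Fubini_lborel(1)[OF q(2)]
  proof eventually_elim
    case (elim x)
    obtain c d where cd: "AE y in lborel. y \<in> {0..1} \<longrightarrow> w (x, y) = c + (\<integral>t. q (x, t) * indicator {0..y} t \<partial>lborel)"
      "AE y in lborel. y \<in> {0..1} \<longrightarrow> v (x, y) = d + (\<integral>t. w (x, t) * indicator {0..y} t \<partial>lborel)"
      using elim(1,2) by blast
    have mv: "(\<lambda>y. v (x, y)) \<in> borel_measurable borel" by measurable
    have s: "v (x, y) = 0" "w (x, y) = 0" if "y \<notin> {0..1}" for y
      using that v(3)[of "(x, y)"] w(3)[of "(x, y)"] by (auto simp: Omega_def)
    show ?case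
      unfolding \<beta>_def K_def m_def
      using slice_bounds[OF elim(4,5,6,7) mv s cd elim(3)] by blast
  qed
  have P_le: "P \<le> \<Delta> * b" and Q_le: "\<epsilon>\<^sup>2 * (\<integral>z. (q z)\<^sup>2 \<partial>lborel) \<le> \<Delta> * b"
  proof -
    have "0 \<le> (\<integral>z. (q z)\<^sup>2 \<partial>lborel)" by (intro Bochner_Integration.integral_nonneg) auto
    then have "0 \<le> \<epsilon>\<^sup>2 * (\<integral>z. (q z)\<^sup>2 \<partial>lborel)" by simp
    then show "P \<le> \<Delta> * b" "\<epsilon>\<^sup>2 * (\<integral>z. (q z)\<^sup>2 \<partial>lborel) \<le> \<Delta> * b"
      using energy P unfolding b_def B_def by linarith+
  qed
  \<comment> \<open>Otherwise \<open>v\<^sub>x\<close> would vanish, and \<open>v\<close> with it.\<close>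
  have b0: "0 < b"
  proof (rule ccontr)
    assume "\<not> 0 < b"
    then have "b = 0" by (simp add: b_def zero_less_measure_iff)
    then have "P = 0" using P_le P by simp
    have "V \<le> integral\<^sup>L (lborel :: real measure) (\<lambda>_. 0)" unfolding mV[symmetric]
    proof (rule integral_mono_AE[OF im])
      show "AE x in lborel. m x \<le> 0" using far \<open>P = 0\<close> by (simp add: m_def)
    qed simp
    then show False using V0 by simp
  qed
  define l where "l = \<Delta> / \<epsilon>\<^sup>2"
  have KI: "(\<integral>x. K x \<partial>lborel) \<le> l * (\<integral>x. \<beta> x \<partial>lborel)"
    unfolding KQ \<beta>b l_def using Q_le pos by (simp add: field_simps)
  have nn: "\<And>x. 0 \<le> \<beta> x" "\<And>x. 0 \<le> m x" "\<And>x. 0 \<le> K x"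
    unfolding \<beta>_def m_def K_def by (auto intro!: Bochner_Integration.integral_nonneg)
  have int_pos: "0 < (\<integral>x. \<beta> x \<partial>lborel)" using b0 \<beta>b by simp
  have far': "AE x in lborel. m x \<le> 8 * L * (\<Delta> * b)"
    using far
  proof eventually_elim
    case (elim x)
    have "8 * L * P \<le> 8 * L * (\<Delta> * b)" using P_le pos by (intro mult_left_mono) auto
    then show ?case using elim by (simp add: m_def)
  qed
  \<comment> \<open>The width that balances the two terms of the bound by averages; a strip this wide does not fit if \<open>h > L\<close>, but then the comparison with the left edge is better.\<close>
  define h where "h = sqrt V / sqrt (\<Delta> * b)"
  have D0: "0 < \<Delta> * b" using pos b0 by simp
  have h: "0 < h" "V / h = sqrt V * sqrt (\<Delta> * b)" "h * (\<Delta> * b) = sqrt V * sqrt (\<Delta> * b)"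
  proof -
    show "0 < h" using V0 D0 by (simp add: h_def)
    have "V = sqrt V * sqrt V" using V0 by simp
    then show "V / h = sqrt V * sqrt (\<Delta> * b)" using V0 D0 unfolding h_def by (simp add: field_simps)
    have "h * (\<Delta> * b) = sqrt V * (\<Delta> * b / sqrt (\<Delta> * b))" unfolding h_def by simp
    then show "h * (\<Delta> * b) = sqrt V * sqrt (\<Delta> * b)" using real_div_sqrt[OF less_imp_le[OF D0]] by simp
  qed
  have near': "AE x in lborel. m x \<le> 16 * (sqrt V * sqrt (\<Delta> * b))"
  proof (cases "h \<le> L")
    case True
    show ?thesis using near[OF h(1) True]
    proof eventually_elim
      case (elim x)
      have "8 * h * P \<le> 8 * (h * (\<Delta> * b))" using P_le h(1) by simp
      moreover have "8 / h * V = 8 * (V / h)" by simp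
      ultimately show ?case using elim unfolding h(2,3) by (simp add: m_def V_def)
    qed
  next
    case False
    show ?thesis using far'
    proof eventually_elim
      case (elim x)
      have "L * (\<Delta> * b) \<le> h * (\<Delta> * b)" using False D0 by (intro mult_right_mono) auto
      moreover have "0 \<le> sqrt V * sqrt (\<Delta> * b)" using V0 D0 by simp
      ultimately show ?case using elim unfolding h(3) by (simp add: mult.assoc)
    qed
  qed
  have bf: "AE x in lborel. \<beta> x \<le> 1 \<and> \<beta> x \<le> K x \<and> \<beta> x \<le> 384 * m x * (K x)\<^sup>2 \<and> m x \<le> 8 * L * (\<Delta> * b)"
    using bounds far' by eventually_elim auto
  have bn: "AE x in lborel. \<beta> x \<le> 1 \<and> \<beta> x \<le> K x \<and> \<beta> x \<le> 384 * m x * (K x)\<^sup>2 \<and> m x \<le> 16 * (sqrt V * sqrt (\<Delta> * b))"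
    using bounds near' by eventually_elim auto
  note r1 = integrate_slices[OF i\<beta> im iK bf nn int_pos KI]
  note r2 = integrate_slices[OF i\<beta> im iK bn nn int_pos KI]
  have bV: "b \<le> 384 * l\<^sup>2 * V" using r1(3) by (simp add: \<beta>b mV)
  show "\<epsilon> ^ 14 \<le> 4000 ^ 4 * (\<integral>z. (v z)\<^sup>2 \<partial>lborel)\<^sup>2 * \<Delta> ^ 8"
    using scaling_bounds(1)[OF pos V0 b0 l_def r1(1,2) r2(2) bV] by (simp add: V_def)
  show "\<epsilon> ^ 6 \<le> 4000 * measure lborel {z \<in> Omega L. 1 \<le> \<bar>w z\<bar>} * L * \<Delta> ^ 4"
    using scaling_bounds(2)[OF pos V0 b0 l_def r1(1,2) r2(2) bV] by (simp add: b_def B_def)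
qed

text \<open>The periodicity and the vanishing on the left edge are given by possibly different traces
  with different approximating sequences. They are used separately: the first yields the mean value
  zero of \<open>w\<close>, the second the bounds on the slices of \<open>v\<close>.\<close>

lemma low_energy_A1:
  assumes pos: "0 < L" "0 < \<epsilon>" "0 < \<Delta>" and u: "u \<in> A1 L" and nz: "nonzero_on (Omega L) u"
    and E: "E1 L u \<epsilon> \<Delta> \<le> \<Delta> * L"
  shows "\<epsilon> ^ 14 \<le> 4000 ^ 4 * L2norm (Omega L) u ^ 4 * \<Delta> ^ 8"
    and "\<epsilon> ^ 6 \<le> 4000 * measure lebesgue (setB L u) * L * \<Delta> ^ 4"
proof -
  have wk: "has_weak_deriv (Omega L) b f (wD L b f)" if "weakly_differentiable (Omega L) b f" for b f
    using that unfolding weakly_differentiable_def weak_deriv_def by (rule someI_ex)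
  have sq: "square_integrable (Omega L) u" "square_integrable (Omega L) (wD L ex u)"
    "square_integrable (Omega L) (wD L ey u)" "square_integrable (Omega L) (wD L ey (wD L ey u))"
    and wd: "weakly_differentiable (Omega L) ey u" "weakly_differentiable (Omega L) ey (wD L ey u)"
    using u by (auto simp: A1_def W12p_def W12_def Basis_real_prod)
  obtain v where v: "v \<in> borel_measurable borel" "integrable lborel (\<lambda>z. (v z)\<^sup>2)" "\<And>z. z \<notin> Omega L \<Longrightarrow> v z = 0"
    "AE z in lebesgue. z \<in> Omega L \<longrightarrow> u z = v z"
    using square_integrable_representative[OF sq(1) Omega_borel] by blast
  obtain p where p: "p \<in> borel_measurable borel" "integrable lborel (\<lambda>z. (p z)\<^sup>2)" "\<And>z. z \<notin> Omega L \<Longrightarrow> p z = 0"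
    "AE z in lebesgue. z \<in> Omega L \<longrightarrow> wD L ex u z = p z"
    using square_integrable_representative[OF sq(2) Omega_borel] by blast
  obtain w where w: "w \<in> borel_measurable borel" "integrable lborel (\<lambda>z. (w z)\<^sup>2)" "\<And>z. z \<notin> Omega L \<Longrightarrow> w z = 0"
    "AE z in lebesgue. z \<in> Omega L \<longrightarrow> wD L ey u z = w z"
    using square_integrable_representative[OF sq(3) Omega_borel] by blast
  obtain q where q: "q \<in> borel_measurable borel" "integrable lborel (\<lambda>z. (q z)\<^sup>2)" "\<And>z. z \<notin> Omega L \<Longrightarrow> q z = 0"
    "AE z in lebesgue. z \<in> Omega L \<longrightarrow> wD L ey (wD L ey u) z = q z"
    using square_integrable_representative[OF sq(4) Omega_borel] by blast
  have iv: "integrable lborel v" by (rule integrable_if_square_integrable[OF v(1,2) compact_Omega v(3)])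
  have iw: "integrable lborel w" by (rule integrable_if_square_integrable[OF w(1,2) compact_Omega w(3)])
  have iq: "integrable lborel q" by (rule integrable_if_square_integrable[OF q(1,2) compact_Omega q(3)])
  have slice_v: "AE x in lborel. \<exists>c. AE y in lborel. y \<in> {0..1} \<longrightarrow> v (x, y) = c + (\<integral>t. w (x, t) * indicator {0..y} t \<partial>lborel)"
    by (rule weak_deriv_ey_slices[OF pos(1) iv iw v(3) w(3) weak_identity_transfer[OF wk[OF wd(1)] v(1,3,4) w(1,3,4)]])
  have slice_w: "AE x in lborel. \<exists>c. AE y in lborel. y \<in> {0..1} \<longrightarrow> w (x, y) = c + (\<integral>t. q (x, t) * indicator {0..y} t \<partial>lborel)"
    by (rule weak_deriv_ey_slices[OF pos(1) iw iq w(3) q(3) weak_identity_transfer[OF wk[OF wd(2)] w(1,3,4) q(1,3,4)]])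
  have edges: "({0..L}, \<lambda>x. (x, 0)) \<in> edges L" "({0..L}, \<lambda>x. (x, 1)) \<in> edges L" "({0..1}, \<lambda>y. (0, y)) \<in> edges L"
    by (auto simp: edges_def)
  have line: "continuous_on UNIV (\<lambda>t. \<phi> (\<gamma> t))" if "smooth \<phi>" "continuous_on UNIV \<gamma>" for \<phi> :: "real \<times> real \<Rightarrow> real" and \<gamma> :: "real \<Rightarrow> real \<times> real"
    using continuous_on_compose2[OF smooth_continuous[OF that(1)] that(2)] by auto
  have mean: "AE x in lborel. (\<integral>y. w (x, y) \<partial>lborel) = 0"
  proof -
    obtain g \<phi> where g: "AE x in lebesgue. x \<in> {0..L} \<longrightarrow> g (x, 1) = g (x, 0)"
      and gsq: "\<And>I \<gamma>. (I, \<gamma>) \<in> edges L \<Longrightarrow> square_integrable I (\<lambda>t. g (\<gamma> t))"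
      and sm: "\<And>n. smooth (\<phi> n)"
      and der: "\<And>b. b \<in> Basis \<Longrightarrow> (\<lambda>n. L2norm (Omega L) (\<lambda>z. pderiv_at b (\<phi> n) z - wD L b u z)) \<longlonglongrightarrow> 0"
      and bd: "\<And>I \<gamma>. (I, \<gamma>) \<in> edges L \<Longrightarrow> (\<lambda>n. L2norm I (\<lambda>t. \<phi> n (\<gamma> t) - g (\<gamma> t))) \<longlonglongrightarrow> 0"
      using u unfolding A1_def W12p_def is_trace_def by blast
    obtain g0 where g0: "g0 \<in> borel_measurable borel" "integrable lborel (\<lambda>x. (g0 x)\<^sup>2)" "\<And>x. x \<notin> {0..L} \<Longrightarrow> g0 x = 0"
      "AE x in lebesgue. x \<in> {0..L} \<longrightarrow> g (x, 0) = g0 x"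
      using square_integrable_representative[OF gsq[OF edges(1)]] by auto
    obtain g1 where g1: "g1 \<in> borel_measurable borel" "integrable lborel (\<lambda>x. (g1 x)\<^sup>2)" "\<And>x. x \<notin> {0..L} \<Longrightarrow> g1 x = 0"
      "AE x in lebesgue. x \<in> {0..L} \<longrightarrow> g (x, 1) = g1 x"
      using square_integrable_representative[OF gsq[OF edges(2)]] by auto
    have "AE x in lebesgue. g1 x = g0 x"
      using g g0(4) g1(4)
    proof eventually_elim
      case (elim x) then show ?case using g0(3)[of x] g1(3)[of x] by (cases "x \<in> {0..L}") auto
    qed
    then have eq: "AE x in lborel. g1 x = g0 x" by (simp add: AE_lebesgue_iff)
    show ?thesis
    proof (rule slice_mean_zero[OF sm w(1-3) iw g1(1-3) g0(1-3) eq])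
      show "(\<lambda>n. \<integral>z. indicator (Omega L) z * (pderiv_at ey (\<phi> n) z - w z)\<^sup>2 \<partial>lborel) \<longlonglongrightarrow> 0"
        by (rule L2norm_tendsto_transfer[OF smooth_pderiv_continuous[OF sm] Omega_borel w(1,4) der]) (auto simp: Basis_real_prod)
      show "(\<lambda>n. \<integral>x. indicator {0..L} x * (\<phi> n (x, 1) - g1 x)\<^sup>2 \<partial>lborel) \<longlonglongrightarrow> 0"
        by (rule L2norm_tendsto_transfer[OF line[OF sm] _ g1(1,4) bd[OF edges(2)]]) (auto intro!: continuous_intros)
      show "(\<lambda>n. \<integral>x. indicator {0..L} x * (\<phi> n (x, 0) - g0 x)\<^sup>2 \<partial>lborel) \<longlonglongrightarrow> 0"
        by (rule L2norm_tendsto_transfer[OF line[OF sm] _ g0(1,4) bd[OF edges(1)]]) (auto intro!: continuous_intros)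
    qed
  qed
  define P where "P = (\<integral>z. (p z)\<^sup>2 \<partial>lborel)"
  define V where "V = (\<integral>z. (v z)\<^sup>2 \<partial>lborel)"
  have slices: "AE x in lborel. (\<integral>y. (v (x, y))\<^sup>2 \<partial>lborel) \<le> 8 * L * P"
    "\<And>h. 0 < h \<Longrightarrow> h \<le> L \<Longrightarrow> AE x in lborel. (\<integral>y. (v (x, y))\<^sup>2 \<partial>lborel) \<le> 8 / h * V + 8 * h * P"
  proof -
    obtain g \<phi> where g: "AE y in lebesgue. y \<in> {0..1} \<longrightarrow> g (0, y) = 0"
      and sm: "\<And>n. smooth (\<phi> n)"
      and val: "(\<lambda>n. L2norm (Omega L) (\<lambda>z. \<phi> n z - u z)) \<longlonglongrightarrow> 0"
      and der: "\<And>b. b \<in> Basis \<Longrightarrow> (\<lambda>n. L2norm (Omega L) (\<lambda>z. pderiv_at b (\<phi> n) z - wD L b u z)) \<longlonglongrightarrow> 0"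
      and bd: "\<And>I \<gamma>. (I, \<gamma>) \<in> edges L \<Longrightarrow> (\<lambda>n. L2norm I (\<lambda>t. \<phi> n (\<gamma> t) - g (\<gamma> t))) \<longlonglongrightarrow> 0"
      using u unfolding A1_def zero_left_def is_trace_def by blast
    have 1: "(\<lambda>n. \<integral>z. indicator (Omega L) z * (\<phi> n z - v z)\<^sup>2 \<partial>lborel) \<longlonglongrightarrow> 0"
      by (rule L2norm_tendsto_transfer[OF smooth_continuous[OF sm] Omega_borel v(1,4) val])
    have 2: "(\<lambda>n. \<integral>z. indicator (Omega L) z * (pderiv_at ex (\<phi> n) z - p z)\<^sup>2 \<partial>lborel) \<longlonglongrightarrow> 0"
      by (rule L2norm_tendsto_transfer[OF smooth_pderiv_continuous[OF sm] Omega_borel p(1,4) der]) (auto simp: Basis_real_prod)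
    have "(\<lambda>n. \<integral>y. indicator {0..1} y * (\<phi> n (0, y) - 0)\<^sup>2 \<partial>lborel) \<longlonglongrightarrow> 0"
      by (rule L2norm_tendsto_transfer[OF line[OF sm] _ _ g bd[OF edges(3)]]) (auto intro!: continuous_intros)
    then have 3: "(\<lambda>n. \<integral>y. indicator {0..1} y * (\<phi> n (0, y))\<^sup>2 \<partial>lborel) \<longlonglongrightarrow> 0" by simp
    show "AE x in lborel. (\<integral>y. (v (x, y))\<^sup>2 \<partial>lborel) \<le> 8 * L * P"
      "\<And>h. 0 < h \<Longrightarrow> h \<le> L \<Longrightarrow> AE x in lborel. (\<integral>y. (v (x, y))\<^sup>2 \<partial>lborel) \<le> 8 / h * V + 8 * h * P"
      using trace_slice_bounds[OF pos(1) sm v(1-3) p(1-3) 1 2 3] unfolding P_def V_def by auto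
  qed
  define B where "B = {z \<in> Omega L. 1 \<le> \<bar>w z\<bar>}"
  have Bset: "B \<in> sets borel" unfolding B_def using w(1) Omega_borel[of L] by measurable
  have aeB: "AE z in lebesgue. indicat_real B z = indicator (setB L u) z"
    using w(4) by eventually_elim (auto simp: B_def setB_def indicator_def)
  have "indicat_real B \<in> borel_measurable lebesgue" using Bset by (simp add: measurable_completion)
  from borel_measurable_AE[OF this aeB] have setB: "setB L u \<in> sets lebesgue"
    by (simp add: borel_measurable_indicator_iff)
  have mB: "measure lebesgue (setB L u) = measure lborel B"
  proof -
    have "measure lebesgue (setB L u) = measure lebesgue B"
    proof (rule measure_eq_AE)
      show "AE z in lebesgue. z \<in> setB L u \<longleftrightarrow> z \<in> B" using aeB by eventually_elim (auto simp: indicator_def split: if_splits)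
    qed (use setB Bset in auto)
    then show ?thesis using Bset by (simp add: measure_completion)
  qed
  have mA: "measure lebesgue (setA L u) = L - measure lborel B"
  proof -
    have "Omega L \<in> fmeasurable lebesgue"
      using Omega_borel[of L] emeasure_Omega_finite[of L] by (intro fmeasurableI) auto
    then have "measure lebesgue (setA L u) = measure lebesgue (Omega L) - measure lebesgue (setB L u)"
      unfolding setA_def using setB by (intro measurable_measure_Diff) (auto simp: setB_def)
    then show ?thesis using measure_Omega[OF pos(1)] mB by simp
  qed
  have "(LINT z:Omega L|lebesgue. \<epsilon>\<^sup>2 * (wD L ey (wD L ey u) z)\<^sup>2 + (wD L ex u z)\<^sup>2) = (\<integral>z. \<epsilon>\<^sup>2 * (q z)\<^sup>2 + (p z)\<^sup>2 \<partial>lborel)"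
  proof (rule set_lebesgue_transfer(2))
    show "(\<lambda>z. \<epsilon>\<^sup>2 * (q z)\<^sup>2 + (p z)\<^sup>2) \<in> borel_measurable borel" using q(1) p(1) by measurable
    show "AE z in lebesgue. z \<in> Omega L \<longrightarrow> \<epsilon>\<^sup>2 * (wD L ey (wD L ey u) z)\<^sup>2 + (wD L ex u z)\<^sup>2 = \<epsilon>\<^sup>2 * (q z)\<^sup>2 + (p z)\<^sup>2"
      using q(4) p(4) by eventually_elim auto
  qed (use q(3) p(3) in auto)
  also have "\<dots> = \<epsilon>\<^sup>2 * (\<integral>z. (q z)\<^sup>2 \<partial>lborel) + P" using q(2) p(2) by (simp add: P_def)
  finally have "E1 L u \<epsilon> \<Delta> = \<epsilon>\<^sup>2 * (\<integral>z. (q z)\<^sup>2 \<partial>lborel) + P + \<Delta> * (L - measure lborel B)"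
    unfolding E1_def mA by simp
  then have energy: "\<epsilon>\<^sup>2 * (\<integral>z. (q z)\<^sup>2 \<partial>lborel) + P \<le> \<Delta> * measure lborel {z \<in> Omega L. 1 \<le> \<bar>w z\<bar>}"
    using E by (simp add: B_def right_diff_distrib)
  have P0: "0 \<le> P" unfolding P_def by (intro Bochner_Integration.integral_nonneg) auto
  have V0: "0 < V"
  proof (rule ccontr)
    assume "\<not> 0 < V"
    moreover have "0 \<le> V" unfolding V_def by (intro Bochner_Integration.integral_nonneg) auto
    ultimately have "V = 0" by linarith
    then have "(\<integral>z. (v z)\<^sup>2 \<partial>lborel) = 0" by (simp only: V_def)
    then have "AE z in lborel. (v z)\<^sup>2 = 0"
      using v(2) by (subst (asm) integral_nonneg_eq_0_iff_AE) auto
    then have "AE z in lebesgue. v z = 0" by (simp add: AE_lebesgue_iff)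
    then have "AE z in lebesgue. z \<in> Omega L \<longrightarrow> u z = 0" using v(4) by eventually_elim auto
    then show False using nz by (simp add: nonzero_on_def)
  qed
  have norm: "L2norm (Omega L) u ^ 4 = V\<^sup>2"
  proof -
    have "(LINT z:Omega L|lebesgue. (u z)\<^sup>2) = V"
      unfolding V_def
    proof (rule set_lebesgue_transfer(2))
      show "AE z in lebesgue. z \<in> Omega L \<longrightarrow> (u z)\<^sup>2 = (v z)\<^sup>2" using v(4) by eventually_elim auto
    qed (use v(1,3) in auto)
    then have "(L2norm (Omega L) u)\<^sup>2 = V" using V0 by (simp add: L2norm_def)
    then show ?thesis by (metis power_mult numeral_Bit0 mult_2)
  qed
  note res = low_energy_bounds[OF pos v(1-3) w(1-3) q(1-3) slice_w slice_v mean slices(1) _ P0 energy]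
  show "\<epsilon> ^ 14 \<le> 4000 ^ 4 * L2norm (Omega L) u ^ 4 * \<Delta> ^ 8"
    using res(1) slices(2) V0 norm unfolding V_def by simp
  show "\<epsilon> ^ 6 \<le> 4000 * measure lebesgue (setB L u) * L * \<Delta> ^ 4"
    using res(2) slices(2) V0 unfolding V_def mB B_def by simp
qed

lemma small_not_low_energy:
  assumes pos: "0 < L" "0 < \<epsilon>" "0 < \<Delta>" and u: "u \<in> A1 L" and nz: "nonzero_on (Omega L) u"
    and small: "L2norm (Omega L) u < 1/4000 * \<epsilon> powr (7/2) * \<Delta> powi (-2) \<or>
      measure lebesgue (setB L u) < 1/4000 * \<epsilon> ^ 6 * \<Delta> powi (-4) * L powi (-1)"
  shows "\<Delta> * L < E1 L u \<epsilon> \<Delta>"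
proof (rule ccontr)
  assume "\<not> \<Delta> * L < E1 L u \<epsilon> \<Delta>"
  then have E: "E1 L u \<epsilon> \<Delta> \<le> \<Delta> * L" by simp
  note low = low_energy_A1[OF pos u nz E]
  show False using small
  proof
    assume a: "L2norm (Omega L) u < 1/4000 * \<epsilon> powr (7/2) * \<Delta> powi (-2)"
    have pw: "(\<epsilon> powr (7/2)) ^ 4 = \<epsilon> ^ 14"
    proof -
      have "(\<epsilon> powr (7/2)) ^ 4 = (\<epsilon> powr (7/2)) powr real 4"
        using pos by (intro powr_realpow[symmetric]) simp
      also have "\<dots> = \<epsilon> powr real 14" by (simp add: powr_powr)
      also have "\<dots> = \<epsilon> ^ 14" using pos by (intro powr_realpow)
      finally show ?thesis .
    qed
    have d2: "\<Delta> powi (-2) = inverse (\<Delta>\<^sup>2)" by (simp add: power_int_minus)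
    have d8: "inverse (\<Delta>\<^sup>2) ^ 4 = inverse (\<Delta> ^ 8)" by (simp add: power_inverse flip: power_mult)
    have "0 \<le> L2norm (Omega L) u"
      unfolding L2norm_def set_lebesgue_integral_def by (auto intro!: Bochner_Integration.integral_nonneg)
    then have "L2norm (Omega L) u ^ 4 < (1/4000 * \<epsilon> powr (7/2) * \<Delta> powi (-2)) ^ 4"
      using a by (intro power_strict_mono) auto
    also have "\<dots> = \<epsilon> ^ 14 / (4000 ^ 4 * \<Delta> ^ 8)"
      unfolding d2 power_mult_distrib pw d8 using pos by (simp add: field_simps)
    finally have "L2norm (Omega L) u ^ 4 < \<epsilon> ^ 14 / (4000 ^ 4 * \<Delta> ^ 8)" .
    then have "L2norm (Omega L) u ^ 4 * (4000 ^ 4 * \<Delta> ^ 8) < \<epsilon> ^ 14"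
      using pos by (subst (asm) pos_less_divide_eq) auto
    then have "4000 ^ 4 * L2norm (Omega L) u ^ 4 * \<Delta> ^ 8 < \<epsilon> ^ 14"
      by (simp only: mult_ac)
    then show False using low(1) by simp
  next
    assume "measure lebesgue (setB L u) < 1/4000 * \<epsilon> ^ 6 * \<Delta> powi (-4) * L powi (-1)"
    also have "\<Delta> powi (-4) = inverse (\<Delta> ^ 4)" by (simp add: power_int_minus)
    also have "L powi (-1) = inverse L" by (simp add: power_int_minus)
    also have "1/4000 * \<epsilon> ^ 6 * inverse (\<Delta> ^ 4) * inverse L = \<epsilon> ^ 6 / (4000 * L * \<Delta> ^ 4)"
      using pos by (simp add: field_simps)
    finally have "measure lebesgue (setB L u) * (4000 * L * \<Delta> ^ 4) < \<epsilon> ^ 6"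
      using pos by (subst (asm) pos_less_divide_eq) auto
    then have "4000 * measure lebesgue (setB L u) * L * \<Delta> ^ 4 < \<epsilon> ^ 6"
      by (simp only: mult_ac)
    then show False using low(2) by simp
  qed
qed

theorem theorem3p1:
  fixes L :: real
  assumes "L > 0"
  shows "(\<exists>C>0. \<forall>\<epsilon>>0. \<forall>\<Delta>>0. \<forall>v\<in>A1 L. nonzero_on (Omega L) v \<longrightarrow>
           L2norm (Omega L) v < C * \<epsilon> powr (7/2) * \<Delta> powi (-2) \<or>
           measure lebesgue (setB L v) < C * \<epsilon> ^ 6 * \<Delta> powi (-4) * L powi (-1) \<longrightarrow>
           E1 L v \<epsilon> \<Delta> > E1 L (\<lambda>_. 0) \<epsilon> \<Delta>)
       \<and> (\<exists>C>0. \<forall>\<epsilon>>0. \<forall>\<Delta>>0. \<forall>v\<in>A2 L. nonzero_on (Omega L) v \<longrightarrow>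
           L2norm (Omega L) v < C * \<epsilon> powr (7/2) * \<Delta> powi (-2) \<or>
           measure lebesgue (setB L v) < C * \<epsilon> ^ 6 * \<Delta> powi (-4) * L powi (-1) \<longrightarrow>
           E2 L v \<epsilon> \<Delta> > E2 L (\<lambda>_. 0) \<epsilon> \<Delta>)
       \<and> (\<exists>C>0. \<forall>\<epsilon>>0. \<forall>\<Delta>>0. \<forall>v\<in>A3 L. nonzero_on (Omega L) v \<longrightarrow>
           L2norm (Omega L) v < C * \<epsilon> powr (7/2) * \<Delta> powi (-2) \<or>
           measure lebesgue (setB L v) < C * \<epsilon> ^ 6 * \<Delta> powi (-4) * L powi (-1) \<longrightarrow>
           E3 L v \<epsilon> \<Delta> > E3 L (\<lambda>_. 0) \<epsilon> \<Delta>)"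
proof (intro conjI; intro exI[of _ "1/4000"] conjI allI impI ballI)
  fix \<epsilon> \<Delta> :: real and v
  assume pos: "\<epsilon> > 0" "\<Delta> > 0" and nz: "nonzero_on (Omega L) v"
    and small: "L2norm (Omega L) v < 1/4000 * \<epsilon> powr (7/2) * \<Delta> powi (-2) \<or>
           measure lebesgue (setB L v) < 1/4000 * \<epsilon> ^ 6 * \<Delta> powi (-4) * L powi (-1)"
  note E1 = small_not_low_energy[OF assms pos _ nz small]
  show "E1 L v \<epsilon> \<Delta> > E1 L (\<lambda>_. 0) \<epsilon> \<Delta>" if "v \<in> A1 L"
    using E1[OF that] zero_energy_le(1)[OF assms pos(2), of \<epsilon>] by linarith
  show "E2 L v \<epsilon> \<Delta> > E2 L (\<lambda>_. 0) \<epsilon> \<Delta>" if "v \<in> A2 L"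
    using E1 that admissible_nested energy_mono(1)[OF that, of \<epsilon> \<Delta>] zero_energy_le(2)[OF assms pos(2), of \<epsilon>] by fastforce
  show "E3 L v \<epsilon> \<Delta> > E3 L (\<lambda>_. 0) \<epsilon> \<Delta>" if "v \<in> A3 L"
    using E1 that admissible_nested energy_mono(2)[OF that, of \<epsilon> \<Delta>] zero_energy_le(3)[OF assms pos(2), of \<epsilon>] by fastforce
qed simp_all

end
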